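(* Let $G$ be a bipartite graph with sides $A$ and $B$, and let $<$ be a total order on $A\cup B$ with respect to which $G^b=G^{b,<}$ is computed. (1) If $<$ is $(1,1)$-admissible and $G$ is a forest, then $K_{2,2}\not\subseteq G^b$; equivalently, $G$ is $(1,1)$-stress free. (2) If $<$ is $(2,1)$-admissible and $G$ is outerplanar, then $K_{3,2}\not\subseteq G^b$; equivalently, $G$ is $(2,1)$-stress free. Similarly, if $<$ is $(1,2)$-admissible and $G$ is outerplanar, then $G$ is $(1,2)$-stress free. (3) If $<$ is $(2,2)$-admissible and $G$ is planar, then $K_{3,3}\not\subseteq G^b$; equivalently, $G$ is $(2,2)$-stress free.
   Context: Here $K_{p,q}\subseteq G^b$ means a complete bipartite subgraph with $p$ vertices in $A$ and $q$ in $B$. All graphs are finite and simple. A bipartite graph $G=(A\uplus B,E)$ has a fixed bipartition; identify $A=\{1<\dots<n\}$, $B=\{1'<\dots<m'\}$ and write $ij'$ for the pair $\{i,j'\}$. Let $S=\mathbb{R}[x_1,\dots,x_n,y_1,\dots,y_m]$, $I_G$ the ideal generated by all $x_ix_j$ ($i<j$), all $y_iy_j$ ($i<j$) and all $x_iy_j$ with $ij'\notin E$, and $\mathbb{R}[G]=S/I_G$, $\mathbb{Z}^2$-graded by $\deg x_i=(1,0)$, $\deg y_j=(0,1)$. Fix generic reals (algebraically independent over $\mathbb{Q}$) $\theta_{ij}$, $\theta_{s't'}$ and put $\theta_i=\sum_j\theta_{ij}x_j$, $\theta_{s'}=\sum_t\theta_{s't'}y_t$. For a total order $<$ on $A\uplus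 B$ extending the natural orders on $A$ and $B$, with induced lexicographic order $<_{\mathrm{lex}}$ on pairs $ij'$, $G^{b,<}$ is the bipartite graph on $A\uplus B$ whose edges are the $ij'$ with $\theta_i\theta_{j'}\notin\operatorname{span}\{\theta_p\theta_{q'}:pq'<_{\mathrm{lex}}ij'\}\subseteq\mathbb{R}[G]_{(1,1)}$. The order is $(k,l)$-admissible if it extends the natural orders and $\{1,\dots,k\}\cup\{1',\dots,l'\}$ is an initial segment of it. $G$ is $(k,l)$-stress free if $(k+1)(l+1)'$ is not an edge of $G^{b,<}$ for a $(k,l)$-admissible order $<$ (independent of the choice). *)

theory Defs
  imports "HOL-Analysis.Analysis" "HOL-Library.Poly_Mapping" "HOL-Algebra.QuotRing"
begin

section \<open>Forests, planar graphs, outerplanar graphs\<close>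

text \<open>
  A simple graph is a vertex set \<open>V\<close> together with a set \<open>Es\<close> of two-element subsets of \<open>V\<close>.
\<close>

definition graph_cycle :: "'v set set \<Rightarrow> 'v list \<Rightarrow> bool" where
  "graph_cycle Es c \<longleftrightarrow> length c \<ge> 3 \<and> distinct c \<and>
     (\<forall>i<length c. {c ! i, c ! (Suc i mod length c)} \<in> Es)"

definition forest :: "'v set set \<Rightarrow> bool" where
  "forest Es \<longleftrightarrow> (\<nexists>c. graph_cycle Es c)"

definition plane_drawing ::
  "'v set \<Rightarrow> 'v set set \<Rightarrow> ('v \<Rightarrow> complex) \<Rightarrow> ('v set \<Rightarrow> real \<Rightarrow> complex) \<Rightarrow> bool" where
  "plane_drawing V Es pos \<gamma> \<longleftrightarrow>
     inj_on pos V \<and>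
     (\<forall>e\<in>Es. arc (\<gamma> e) \<and> {pathstart (\<gamma> e), pathfinish (\<gamma> e)} = pos ` e \<and>
              path_image (\<gamma> e) \<inter> pos ` V = pos ` e) \<and>
     (\<forall>e\<in>Es. \<forall>f\<in>Es. e \<noteq> f \<longrightarrow> path_image (\<gamma> e) \<inter> path_image (\<gamma> f) = pos ` (e \<inter> f))"

definition drawing_image ::
  "'v set \<Rightarrow> 'v set set \<Rightarrow> ('v \<Rightarrow> complex) \<Rightarrow> ('v set \<Rightarrow> real \<Rightarrow> complex) \<Rightarrow> complex set" where
  "drawing_image V Es pos \<gamma> = pos ` V \<union> (\<Union>e\<in>Es. path_image (\<gamma> e))"

definition planar :: "'v set \<Rightarrow> 'v set set \<Rightarrow> bool" where
  "planar V Es \<longleftrightarrow> (\<exists>pos \<gamma>. plane_drawing V Es pos \<gamma>)"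

text \<open>
  For a finite graph the image of a drawing is compact, so its \<^const>\<open>outside\<close> is the unique
  unbounded face.
\<close>

definition outerplanar :: "'v set \<Rightarrow> 'v set set \<Rightarrow> bool" where
  "outerplanar V Es \<longleftrightarrow>
     (\<exists>pos \<gamma>. plane_drawing V Es pos \<gamma> \<and> pos ` V \<subseteq> frontier (outside (drawing_image V Es pos \<gamma>)))"


section \<open>Bipartite graphs\<close>

text \<open>
  A bipartite graph with sides \<open>A = {1,\<dots>,n}\<close> and \<open>B = {1',\<dots>,m'}\<close> is given by \<open>n\<close>, \<open>m\<close> and a set
  \<open>E \<subseteq> {1..n} \<times> {1..m}\<close>, where \<open>(i, j)\<close> stands for the pair \<open>ij'\<close>. As a vertex of
  \<open>A \<uplus> B\<close>, \<open>i\<close> is \<^term>\<open>Inl i\<close> and \<open>j'\<close> is \<^term>\<open>Inr j\<close>.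
\<close>

type_synonym vertex = "nat + nat"

definition bip_verts :: "nat \<Rightarrow> nat \<Rightarrow> vertex set" where
  "bip_verts n m = Inl ` {1..n} \<union> Inr ` {1..m}"

definition bip_edges :: "(nat \<times> nat) set \<Rightarrow> vertex set set" where
  "bip_edges E = (\<lambda>(i, j). {Inl i, Inr j}) ` E"

definition contains_biclique :: "nat \<Rightarrow> nat \<Rightarrow> (nat \<times> nat) set \<Rightarrow> bool" where
  "contains_biclique p q E \<longleftrightarrow> (\<exists>P Q. finite P \<and> finite Q \<and> card P = p \<and> card Q = q \<and> P \<times> Q \<subseteq> E)"


section \<open>Polynomials and the ring of a bipartite graph\<close>

text \<open>
  A polynomial is a finitely supported map from monomials to coefficients, a monomial a finitely
  supported map from variables to exponents; the ring operations on this type are those of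
  \<^theory>\<open>HOL-Library.Poly_Mapping\<close>.
\<close>

type_synonym ('v, 'a) mpoly = "('v \<Rightarrow>\<^sub>0 nat) \<Rightarrow>\<^sub>0 'a"

definition mpolys_over :: "'v set \<Rightarrow> ('v, 'a::zero) mpoly set" where
  "mpolys_over V = {p. \<forall>t\<in>Poly_Mapping.keys p. Poly_Mapping.keys t \<subseteq> V}"

definition mconst :: "'a::zero \<Rightarrow> ('v, 'a) mpoly" where
  "mconst c = Poly_Mapping.single 0 c"

definition mvar :: "'v \<Rightarrow> ('v, 'a::zero_neq_one) mpoly" where
  "mvar v = Poly_Mapping.single (Poly_Mapping.single v 1) 1"

definition algebraically_independent_over_rat :: "'i set \<Rightarrow> ('i \<Rightarrow> real) \<Rightarrow> bool" where
  "algebraically_independent_over_rat I a \<longleftrightarrow>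
     (\<forall>p :: ('i, rat) mpoly. p \<in> mpolys_over I \<longrightarrow>
        (\<Sum>t\<in>Poly_Mapping.keys p. of_rat (Poly_Mapping.lookup p t) *
           (\<Prod>i\<in>Poly_Mapping.keys t. a i ^ Poly_Mapping.lookup t i)) = 0 \<longrightarrow> p = 0)"

text \<open>
  \<open>\<theta> i j\<close> are the coefficients on the \<open>A\<close> side, \<open>\<theta>' s t\<close> those on the \<open>B\<close> side; all
  \<open>n\<^sup>2 + m\<^sup>2\<close> of them are jointly algebraically independent.
\<close>

definition generic :: "nat \<Rightarrow> nat \<Rightarrow> (nat \<Rightarrow> nat \<Rightarrow> real) \<Rightarrow> (nat \<Rightarrow> nat \<Rightarrow> real) \<Rightarrow> bool" where
  "generic n m \<theta> \<theta>' \<longleftrightarrow>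
     algebraically_independent_over_rat
       (Inl ` ({1..n} \<times> {1..n}) \<union> Inr ` ({1..m} \<times> {1..m}))
       (case_sum (\<lambda>(i, j). \<theta> i j) (\<lambda>(s, t). \<theta>' s t))"

definition poly_ring :: "nat \<Rightarrow> nat \<Rightarrow> (vertex, real) mpoly ring" where
  "poly_ring n m = \<lparr>carrier = mpolys_over (bip_verts n m),
     monoid.mult = (*), one = 1, zero = 0, add = (+)\<rparr>"

definition graph_ideal :: "nat \<Rightarrow> nat \<Rightarrow> (nat \<times> nat) set \<Rightarrow> (vertex, real) mpoly set" where
  "graph_ideal n m E = genideal (poly_ring n m)
     ({mvar (Inl i) * mvar (Inl j) | i j. i \<in> {1..n} \<and> j \<in> {1..n} \<and> i < j} \<union>
      {mvar (Inr i) * mvar (Inr j) | i j. i \<in> {1..m} \<and> j \<in> {1..m} \<and> i < j} \<union>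
      {mvar (Inl i) * mvar (Inr j) | i j. i \<in> {1..n} \<and> j \<in> {1..m} \<and> (i, j) \<notin> E})"

definition graph_ring :: "nat \<Rightarrow> nat \<Rightarrow> (nat \<times> nat) set \<Rightarrow> (vertex, real) mpoly set ring" where
  "graph_ring n m E = poly_ring n m Quot graph_ideal n m E"

definition residue_class ::
  "nat \<Rightarrow> nat \<Rightarrow> (nat \<times> nat) set \<Rightarrow> (vertex, real) mpoly \<Rightarrow> (vertex, real) mpoly set" where
  "residue_class n m E f = a_r_coset (poly_ring n m) (graph_ideal n m E) f"

text \<open>The real linear span in \<open>\<real>[G]\<close>; a scalar \<open>c\<close> acts as multiplication by its residue class.\<close>

definition graph_ring_span ::
  "nat \<Rightarrow> nat \<Rightarrow> (nat \<times> nat) set \<Rightarrow> (vertex, real) mpoly set set \<Rightarrow> (vertex, real) mpoly set set" where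
  "graph_ring_span n m E X =
     {finsum (graph_ring n m E)
        (\<lambda>x. residue_class n m E (mconst (c x)) \<otimes>\<^bsub>graph_ring n m E\<^esub> x) F
      | c F. finite F \<and> F \<subseteq> X}"

definition theta_A :: "nat \<Rightarrow> (nat \<Rightarrow> nat \<Rightarrow> real) \<Rightarrow> nat \<Rightarrow> (vertex, real) mpoly" where
  "theta_A n \<theta> i = (\<Sum>j\<in>{1..n}. mconst (\<theta> i j) * mvar (Inl j))"

definition theta_B :: "nat \<Rightarrow> (nat \<Rightarrow> nat \<Rightarrow> real) \<Rightarrow> nat \<Rightarrow> (vertex, real) mpoly" where
  "theta_B m \<theta>' s = (\<Sum>t\<in>{1..m}. mconst (\<theta>' s t) * mvar (Inr t))"

definition theta_prod ::
  "nat \<Rightarrow> nat \<Rightarrow> (nat \<times> nat) set \<Rightarrow> (nat \<Rightarrow> nat \<Rightarrow> real) \<Rightarrow> (nat \<Rightarrow> nat \<Rightarrow> real) \<Rightarrow>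
   nat \<times> nat \<Rightarrow> (vertex, real) mpoly set" where
  "theta_prod n m E \<theta> \<theta>' = (\<lambda>(i, j).
     residue_class n m E (theta_A n \<theta> i) \<otimes>\<^bsub>graph_ring n m E\<^esub> residue_class n m E (theta_B m \<theta>' j))"


section \<open>Balanced shifting and stress freeness\<close>

text \<open>
  A total order on \<open>A \<uplus> B\<close> is given by its strict part \<open>r\<close>. Pairs \<open>ij'\<close> are compared as
  sets: each is first listed in increasing order with respect to \<open>r\<close>.
\<close>

definition sorted_pair :: "vertex rel \<Rightarrow> nat \<times> nat \<Rightarrow> vertex \<times> vertex" where
  "sorted_pair r = (\<lambda>(i, j). if (Inl i, Inr j) \<in> r then (Inl i, Inr j) else (Inr j, Inl i))"

definition lex_less :: "vertex rel \<Rightarrow> nat \<times> nat \<Rightarrow> nat \<times> nat \<Rightarrow> bool" where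
  "lex_less r p q \<longleftrightarrow> (sorted_pair r p, sorted_pair r q) \<in> r <*lex*> r"

definition balanced_shift ::
  "nat \<Rightarrow> nat \<Rightarrow> (nat \<times> nat) set \<Rightarrow> (nat \<Rightarrow> nat \<Rightarrow> real) \<Rightarrow> (nat \<Rightarrow> nat \<Rightarrow> real) \<Rightarrow>
   vertex rel \<Rightarrow> (nat \<times> nat) set" where
  "balanced_shift n m E \<theta> \<theta>' r =
     {e \<in> {1..n} \<times> {1..m}. theta_prod n m E \<theta> \<theta>' e \<notin>
        graph_ring_span n m E
          (theta_prod n m E \<theta> \<theta>' ` {f \<in> {1..n} \<times> {1..m}. lex_less r f e})}"

text \<open>
  If \<open>k > n\<close> or \<open>l > m\<close>, the initial segment is the part of
  \<open>{1,\<dots>,k} \<union> {1',\<dots>,l'}\<close> lying in \<open>A \<uplus> B\<close>.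
\<close>

definition admissible :: "nat \<Rightarrow> nat \<Rightarrow> nat \<Rightarrow> nat \<Rightarrow> vertex rel \<Rightarrow> bool" where
  "admissible n m k l r \<longleftrightarrow>
     r \<subseteq> bip_verts n m \<times> bip_verts n m \<and>
     strict_linear_order_on (bip_verts n m) r \<and>
     (\<forall>i\<in>{1..n}. \<forall>j\<in>{1..n}. i < j \<longrightarrow> (Inl i, Inl j) \<in> r) \<and>
     (\<forall>i\<in>{1..m}. \<forall>j\<in>{1..m}. i < j \<longrightarrow> (Inr i, Inr j) \<in> r) \<and>
     (\<forall>u v. (u, v) \<in> r \<and> v \<in> bip_verts k l \<longrightarrow> u \<in> bip_verts k l)"

definition stress_free ::
  "nat \<Rightarrow> nat \<Rightarrow> (nat \<times> nat) set \<Rightarrow> (nat \<Rightarrow> nat \<Rightarrow> real) \<Rightarrow> (nat \<Rightarrow> nat \<Rightarrow> real) \<Rightarrow>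
   nat \<Rightarrow> nat \<Rightarrow> bool" where
  "stress_free n m E \<theta> \<theta>' k l \<longleftrightarrow>
     (\<exists>r. admissible n m k l r \<and> (k + 1, l + 1) \<notin> balanced_shift n m E \<theta> \<theta>' r)"

lemma lex_less_corner:
  assumes r: "admissible n m k l r" and pq: "p \<in> {1..n}" "q \<in> {1..m}"
    and kl: "k + 1 \<le> n" "l + 1 \<le> m"
  shows "lex_less r (p, q) (k + 1, l + 1) \<longleftrightarrow> p \<le> k \<or> q \<le> l"
proof -
  have tr: "trans r" and ir: "irrefl r" and tot: "total_on (bip_verts n m) r"
    using r by (auto simp: admissible_def strict_linear_order_on_def)
  have A: "(Inl i, Inl j) \<in> r \<longleftrightarrow> i < j" if "i \<in> {1..n}" "j \<in> {1..n}" for i j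
    using r that tr ir unfolding admissible_def
    by (metis irreflD linorder_neqE_nat transD)
  have B: "(Inr i, Inr j) \<in> r \<longleftrightarrow> i < j" if "i \<in> {1..m}" "j \<in> {1..m}" for i j
    using r that tr ir unfolding admissible_def
    by (metis irreflD linorder_neqE_nat transD)
  have AB: "(Inl i, Inr j) \<in> r \<longleftrightarrow> (Inr j, Inl i) \<notin> r" if "i \<in> {1..n}" "j \<in> {1..m}" for i j
  proof -
    have "(Inl i, Inr j) \<in> r \<or> (Inr j, Inl i) \<in> r"
      using tot that unfolding total_on_def bip_verts_def by blast
    moreover have "\<not> ((Inl i, Inr j) \<in> r \<and> (Inr j, Inl i) \<in> r)"
      using tr ir by (meson irreflD transD)
    ultimately show ?thesis by blast
  qed
  have seg: "u \<in> bip_verts k l" if "(u, v) \<in> r" "v \<in> bip_verts k l" for u v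
    using r that unfolding admissible_def by blast
  have s1: "(Inl i, Inr j) \<in> r" if "i \<in> {1..n}" "j \<in> {1..m}" "i \<le> k" "l < j" for i j
    using AB[of i j] seg[of "Inr j" "Inl i"] that by (auto simp: bip_verts_def)
  have s2: "(Inr j, Inl i) \<in> r" if "i \<in> {1..n}" "j \<in> {1..m}" "k < i" "j \<le> l" for i j
    using AB[of i j] seg[of "Inl i" "Inr j"] that by (auto simp: bip_verts_def)
  have K: "k + 1 \<in> {1..n}" "l + 1 \<in> {1..m}" using kl by auto
  show ?thesis
  proof (cases "p \<le> k \<or> q \<le> l")
    case True
    have "lex_less r (p, q) (k + 1, l + 1)"
      using True AB[OF pq] AB[OF K] s1[of p q] s2[of p q] s1[of p "l+1"] s2[of "k+1" q]
        A[of p "k+1"] B[of q "l+1"] pq K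
      unfolding lex_less_def sorted_pair_def by (cases "p \<le> k"; cases "q \<le> l") auto
    with True show ?thesis by simp
  next
    case False
    then have ge: "k + 1 \<le> p" "l + 1 \<le> q" by auto
    have "\<not> lex_less r (p, q) (k + 1, l + 1)"
    proof
      assume L: "lex_less r (p, q) (k + 1, l + 1)"
      have nA: "(Inl p, Inl (k+1)) \<notin> r" and nB: "(Inr q, Inr (l+1)) \<notin> r"
        using A[OF pq(1) K(1)] B[OF pq(2) K(2)] ge by auto
      have eA: "p = k + 1 \<or> (Inl (k+1), Inl p) \<in> r"
        using A[OF K(1) pq(1)] ge by auto
      have eB: "q = l + 1 \<or> (Inr (l+1), Inr q) \<in> r"
        using B[OF K(2) pq(2)] ge by auto
      show False
        using L nA nB eA eB AB[OF pq] AB[OF K] tr ir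
        unfolding lex_less_def sorted_pair_def
        by (auto split: if_splits dest: transD irreflD)
    qed
    with False show ?thesis by simp
  qed
qed

lemma admissible_exists: "\<exists>r. admissible n m k l r"
proof -
  define f :: "vertex \<Rightarrow> nat" where
    "f = case_sum (\<lambda>i. if i \<le> k then i else l + i) (\<lambda>j. if j \<le> l then k + j else n + k + l + j)"
  define r where "r = {(u, v). u \<in> bip_verts n m \<and> v \<in> bip_verts n m \<and> f u < f v}"
  have inj: "u = v" if "u \<in> bip_verts n m" "v \<in> bip_verts n m" "f u = f v" for u v
    using that by (auto simp: f_def bip_verts_def split: if_splits)
  have "strict_linear_order_on (bip_verts n m) r"
    unfolding strict_linear_order_on_def trans_def irrefl_def total_on_def r_def
    using inj by auto (meson linorder_neqE_nat)
  moreover have "u \<in> bip_verts k l" if "(u, v) \<in> r" "v \<in> bip_verts k l" for u v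
    using that by (auto simp: r_def f_def bip_verts_def split: if_splits)
  moreover have "r \<subseteq> bip_verts n m \<times> bip_verts n m" by (auto simp: r_def)
  moreover have "\<forall>i\<in>{1..n}. \<forall>j\<in>{1..n}. i < j \<longrightarrow> (Inl i, Inl j) \<in> r"
    by (auto simp: r_def f_def bip_verts_def)
  moreover have "\<forall>i\<in>{1..m}. \<forall>j\<in>{1..m}. i < j \<longrightarrow> (Inr i, Inr j) \<in> r"
    by (auto simp: r_def f_def bip_verts_def)
  ultimately have "admissible n m k l r"
    unfolding admissible_def by blast
  then show ?thesis by blast
qed

lemma stress_free_independent:
  "stress_free n m E \<theta> \<theta>' k l \<longleftrightarrow>
     (\<forall>r. admissible n m k l r \<longrightarrow> (k + 1, l + 1) \<notin> balanced_shift n m E \<theta> \<theta>' r)"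
proof -
  have indep: "(k + 1, l + 1) \<in> balanced_shift n m E \<theta> \<theta>' r \<longleftrightarrow>
      k + 1 \<le> n \<and> l + 1 \<le> m \<and> theta_prod n m E \<theta> \<theta>' (k + 1, l + 1) \<notin>
        graph_ring_span n m E (theta_prod n m E \<theta> \<theta>' `
          {(p, q). p \<in> {1..n} \<and> q \<in> {1..m} \<and> (p \<le> k \<or> q \<le> l)})"
    if "admissible n m k l r" for r
  proof (cases "k + 1 \<le> n \<and> l + 1 \<le> m")
    case True
    then have "{f \<in> {1..n} \<times> {1..m}. lex_less r f (k + 1, l + 1)} =
        {(p, q). p \<in> {1..n} \<and> q \<in> {1..m} \<and> (p \<le> k \<or> q \<le> l)}"
      using lex_less_corner[OF that] by auto
    with True show ?thesis by (simp add: balanced_shift_def)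
  next
    case False
    then show ?thesis by (auto simp: balanced_shift_def)
  qed
  show ?thesis
    unfolding stress_free_def using indep admissible_exists[of n m k l] by blast
qed

lemma mpolys_over_closed:
  fixes p q :: "('v, 'a::comm_ring_1) mpoly"
  assumes "p \<in> mpolys_over V" "q \<in> mpolys_over V"
  shows "p + q \<in> mpolys_over V" "p * q \<in> mpolys_over V" "- p \<in> mpolys_over V"
proof -
  show "p + q \<in> mpolys_over V"
    using assms Poly_Mapping.keys_add[of p q] unfolding mpolys_over_def by blast
  show "- p \<in> mpolys_over V"
    using assms unfolding mpolys_over_def by (auto simp: in_keys_iff)
  show "p * q \<in> mpolys_over V"
    unfolding mpolys_over_def
  proof (intro CollectI ballI)
    fix t assume "t \<in> Poly_Mapping.keys (p * q)"
    then obtain a b where "t = a + b" "a \<in> Poly_Mapping.keys p" "b \<in> Poly_Mapping.keys q"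
      using keys_mult[of p q] by blast
    then show "Poly_Mapping.keys t \<subseteq> V"
      using assms Poly_Mapping.keys_add[of a b] unfolding mpolys_over_def by blast
  qed
qed

lemma poly_ring_cring: "cring (poly_ring n m)"
proof (rule cringI)
  show "abelian_group (poly_ring n m)"
  proof (rule abelian_groupI)
    fix x assume x: "x \<in> carrier (poly_ring n m)"
    show "\<exists>y\<in>carrier (poly_ring n m). y \<oplus>\<^bsub>poly_ring n m\<^esub> x = \<zero>\<^bsub>poly_ring n m\<^esub>"
      using x mpolys_over_closed(3)[of x] by (intro bexI[of _ "- x"]) (auto simp: poly_ring_def)
  qed (auto simp: poly_ring_def mpolys_over_closed algebra_simps, auto simp: mpolys_over_def)
  show "Group.comm_monoid (poly_ring n m)"
    by (rule comm_monoidI)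
      (auto simp: poly_ring_def mpolys_over_closed algebra_simps, auto simp: mpolys_over_def)
qed (auto simp: poly_ring_def algebra_simps)

end

theory Submission
  imports Defs
begin

text \<open>
  Dually, the pair \<open>(k + 1, l + 1)\<close> is missing from the shifted graph as soon as the edges carry no
  nonzero \<open>(k, l)\<close>-stress: weights balanced at every vertex when the two sides are placed
  generically in \<open>\<real>\<^sup>k\<close> and \<open>\<real>\<^sup>l\<close>. A stress of a forest vanishes at the leaves. In general,
  identify two vertices of one side that are consecutive neighbours of a vertex along a face. If they have
  at most two common neighbours, a stress-free placement of the smaller graph pulls back to a
  stress-free placement of the larger one, and stress-freeness at one real placement
  passes to the generic one. In a planar graph, of the two pairs met on a path of three edges along
  a face, at least one has at most two common neighbours; in an outerplanar graph, all pairs do, because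
  there is no \<open>K\<^bsub>2,3\<^esub>\<close>.

  Planarity enters only through MacLane's criterion: the cycle space over the field with two elements is the cut
  space of a dual graph. This property survives deletions and the identifications above. For a
  drawing by arbitrary arcs it follows from Janiszewski's theorem and the Jordan curve theorem by
  counting the components of the complement.
\<close>

section \<open>Labelled bipartite graphs and their duals over the field with two elements\<close>

text \<open>Merging vertices inside a drawing by arbitrary arcs is awkward to describe, so a drawing
  is used only once, to produce \<open>dual_faces\<close>; all surgery then acts on maps from a
  fixed edge type to ends and faces. The bound of two common neighbours comes from the target space:
  at most two generic points of the plane are linearly independent. In the outerplanar case only the
  side placed on the line is identified, so common neighbours always lie in the plane. Keeping every
  vertex outer requires a face that has just two edges at the middle vertex, hence a face with
  minimal boundary. For a drawing, adding edges one at a time bounds the number of faces from above,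
  while Jordan curves make every even set a boundary; the two estimates meet, and equality yields
  both the evenness of all boundaries and the connectedness of the dual. Finally, a weight
  orthogonal to all products with first index at most \<open>k\<close> or second index at most
  \<open>l\<close> is a stress, because the full generic square matrix of the other side can be
  cancelled.\<close>

lemma odd_card_sym_diff:
  assumes "finite A" "finite B"
  shows "odd (card (sym_diff A B)) \<longleftrightarrow> odd (card A) \<noteq> odd (card B)"
proof -
  have "card (sym_diff A B) = card (A - B) + card (B - A)"
    using assms by (intro card_Un_disjoint) auto
  moreover have "card A = card (A - B) + card (A \<inter> B)" "card B = card (B - A) + card (A \<inter> B)"
    using assms by (metis card_Diff_subset_Int card_Int_Diff add.commute finite_Int inf_commute)+
  ultimately show ?thesis by presburger
qed

definition odd_deg :: "('e \<Rightarrow> 'x) \<Rightarrow> 'x \<Rightarrow> 'e set \<Rightarrow> bool" where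
  "odd_deg a x C \<longleftrightarrow> odd (card {e \<in> C. a e = x})"

definition even_edges :: "('e \<Rightarrow> 'a) \<Rightarrow> ('e \<Rightarrow> 'b) \<Rightarrow> 'e set \<Rightarrow> bool" where
  "even_edges a b C \<longleftrightarrow> (\<forall>x. \<not> odd_deg a x C) \<and> (\<forall>y. \<not> odd_deg b y C)"

text \<open>In the dual graph \<open>e\<close> joins \<open>l e\<close> to \<open>r e\<close>, and
  this is the cut around \<open>S\<close>. Inequality of truth values is addition modulo two, so the
  cut is linear in \<open>S\<close>, and edges with \<open>l e = r e\<close> lie in no cut.\<close>

definition face_boundary :: "'e set \<Rightarrow> ('e \<Rightarrow> 'f) \<Rightarrow> ('e \<Rightarrow> 'f) \<Rightarrow> 'f set \<Rightarrow> 'e set" where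
  "face_boundary E l r S = {e \<in> E. (l e \<in> S) \<noteq> (r e \<in> S)}"

text \<open>
  The edge \<open>e\<close> has ends \<open>a e\<close> and \<open>b e\<close> and separates the faces \<open>l e\<close> and \<open>r e\<close>; parallel
  edges are allowed. The condition says that the cycle space of the graph is the cut space of a
  connected graph on the faces (a Whitney dual).
\<close>

definition dual_faces ::
  "'e set \<Rightarrow> ('e \<Rightarrow> 'a) \<Rightarrow> ('e \<Rightarrow> 'b) \<Rightarrow> 'f set \<Rightarrow> ('e \<Rightarrow> 'f) \<Rightarrow> ('e \<Rightarrow> 'f) \<Rightarrow> bool" where
  "dual_faces E a b \<Phi> l r \<longleftrightarrow> finite E \<and> finite \<Phi> \<and> l ` E \<subseteq> \<Phi> \<and> r ` E \<subseteq> \<Phi> \<and>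
     (\<forall>S\<subseteq>\<Phi>. even_edges a b (face_boundary E l r S)) \<and>
     (\<forall>C\<subseteq>E. even_edges a b C \<longrightarrow> (\<exists>S\<subseteq>\<Phi>. C = face_boundary E l r S)) \<and>
     (\<forall>S\<subseteq>\<Phi>. face_boundary E l r S = {} \<longrightarrow> S = {} \<or> S = \<Phi>)"

text \<open>
  All vertices lie on the face \<open>z\<close>: a region \<open>S\<close> avoiding \<open>z\<close> whose boundary misses a vertex
  contains no face at that vertex. Edges with \<open>l e = r e\<close> are exempt, since bridges carry no
  positional information in the cycle space.
\<close>

definition outer_vertices ::
  "'e set \<Rightarrow> ('e \<Rightarrow> 'x) \<Rightarrow> 'f set \<Rightarrow> ('e \<Rightarrow> 'f) \<Rightarrow> ('e \<Rightarrow> 'f) \<Rightarrow> 'f \<Rightarrow> bool" where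
  "outer_vertices E a \<Phi> l r z \<longleftrightarrow>
     (\<forall>S x. S \<subseteq> \<Phi> \<and> z \<notin> S \<and> (\<forall>e\<in>face_boundary E l r S. a e \<noteq> x) \<longrightarrow>
        (\<forall>e\<in>E. a e = x \<and> l e \<noteq> r e \<longrightarrow> l e \<notin> S))"

section \<open>Parities of degrees, and boundaries as cuts\<close>

lemma odd_deg_empty [simp]: "\<not> odd_deg a x {}"
  by (simp add: odd_deg_def)

lemma odd_deg_sym_diff:
  assumes "finite C" "finite D"
  shows "odd_deg a x (sym_diff C D) \<longleftrightarrow> odd_deg a x C \<noteq> odd_deg a x D"
proof -
  have "{e \<in> sym_diff C D. a e = x} = sym_diff {e \<in> C. a e = x} {e \<in> D. a e = x}" by blast
  then show ?thesis unfolding odd_deg_def using assms by (simp add: odd_card_sym_diff)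
qed

lemma odd_deg_insert:
  assumes "finite C" "e \<notin> C"
  shows "odd_deg a x (insert e C) \<longleftrightarrow> odd_deg a x C \<noteq> (a e = x)"
proof -
  have "{f \<in> insert e C. a f = x} = (if a e = x then insert e {f \<in> C. a f = x} else {f \<in> C. a f = x})"
    by auto
  then show ?thesis unfolding odd_deg_def using assms by auto
qed

lemma odd_deg_unique:
  assumes "e \<in> C" "a e = x" "\<And>f. f \<in> C \<Longrightarrow> a f = x \<Longrightarrow> f = e"
  shows "odd_deg a x C"
proof -
  have "{f \<in> C. a f = x} = {e}" using assms by blast
  then show ?thesis by (simp add: odd_deg_def)
qed

lemma odd_deg_in_image: "odd_deg a x C \<Longrightarrow> x \<in> a ` C"
  unfolding odd_deg_def by (metis (mono_tags, lifting) Collect_empty_eq card.empty even_zero image_eqI)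

lemma odd_deg_other:
  assumes "\<not> odd_deg a x C" "e \<in> C" "a e = x"
  obtains f where "f \<in> C" "a f = x" "f \<noteq> e"
  using odd_deg_unique[of e C a x] assms by blast

lemma even_edges_swap: "even_edges a b C \<longleftrightarrow> even_edges b a C"
  by (auto simp: even_edges_def)

lemma even_edges_four_cycle:
  assumes "a e1 = w" "b e1 = u" "a e2 = w" "b e2 = v" "a e3 = p" "b e3 = v" "a e4 = p" "b e4 = u"
    and "w \<noteq> p" "u \<noteq> v"
  shows "even_edges a b {e1, e2, e3, e4}"
proof -
  have "distinct [e1, e2, e3, e4]" using assms by auto
  then show ?thesis using assms by (auto simp: even_edges_def odd_deg_insert)
qed

lemma dual_faces_swap: "dual_faces E a b \<Phi> l r \<longleftrightarrow> dual_faces E b a \<Phi> l r"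
  unfolding dual_faces_def by (simp add: even_edges_swap[of a b])

lemma face_boundary_compl:
  assumes "l ` E \<subseteq> \<Phi>" "r ` E \<subseteq> \<Phi>"
  shows "face_boundary E l r (\<Phi> - S) = face_boundary E l r S"
  using assms by (auto simp: face_boundary_def)

lemma face_boundary_sym_diff:
  "face_boundary E l r (sym_diff S T) = sym_diff (face_boundary E l r S) (face_boundary E l r T)"
  by (auto simp: face_boundary_def)

section \<open>Deletion and identification in the dual\<close>

lemma dual_facesD:
  assumes "dual_faces E a b \<Phi> l r"
  shows "finite E" "finite \<Phi>" "\<And>e. e \<in> E \<Longrightarrow> l e \<in> \<Phi>" "\<And>e. e \<in> E \<Longrightarrow> r e \<in> \<Phi>"
    "\<And>S. S \<subseteq> \<Phi> \<Longrightarrow> even_edges a b (face_boundary E l r S)"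
    "\<And>S. S \<subseteq> \<Phi> \<Longrightarrow> face_boundary E l r S = {} \<Longrightarrow> S = {} \<or> S = \<Phi>"
  using assms unfolding dual_faces_def by auto

text \<open>Complementary regions have the same boundary, so a region can always be chosen to avoid
  one prescribed face.\<close>

lemma dual_faces_even_avoiding:
  assumes d: "dual_faces E a b \<Phi> l r" and C: "C \<subseteq> E" "even_edges a b C"
  obtains S where "S \<subseteq> \<Phi>" "z \<notin> S" "C = face_boundary E l r S"
proof -
  obtain S where S: "S \<subseteq> \<Phi>" "C = face_boundary E l r S"
    using assms unfolding dual_faces_def by metis
  have "C = face_boundary E l r (\<Phi> - S)"
    using face_boundary_compl[of l E \<Phi> r S] d S by (simp add: dual_faces_def)
  then show ?thesis using S that[of S] that[of "\<Phi> - S"] by blast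
qed

text \<open>Deleting an edge contracts it in the dual: \<open>h\<close> merges the two faces at
  \<open>d\<close>. Regions of merged faces are the old regions that do not separate
  \<open>l d\<close> from \<open>r d\<close>, that is, those whose boundary misses
  \<open>d\<close>.\<close>

lemma dual_faces_delete:
  assumes d: "dual_faces E a b \<Phi> l r" and e: "d \<in> E"
  defines "h \<equiv> (\<lambda>x. if x = r d then l d else x)"
  shows "dual_faces (E - {d}) a b (h ` \<Phi>) (h \<circ> l) (h \<circ> r)"
    and "outer_vertices E c \<Phi> l r z \<Longrightarrow> outer_vertices (E - {d}) c (h ` \<Phi>) (h \<circ> l) (h \<circ> r) (h z)"
proof -
  note D = dual_facesD[OF d]
  define T where "T S = {x \<in> \<Phi>. h x \<in> S}" for S
  have T: "T S \<subseteq> \<Phi>" for S by (auto simp: T_def)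
  have hd: "h (l d) = l d" "h (r d) = l d" by (auto simp: h_def)
  have bd: "face_boundary (E - {d}) (h \<circ> l) (h \<circ> r) S = face_boundary E l r (T S)" for S
    using D(3,4) hd e by (auto simp: face_boundary_def T_def)
  show "dual_faces (E - {d}) a b (h ` \<Phi>) (h \<circ> l) (h \<circ> r)"
    unfolding dual_faces_def
  proof (intro conjI allI impI)
    fix S assume "S \<subseteq> h ` \<Phi>"
    then show "even_edges a b (face_boundary (E - {d}) (h \<circ> l) (h \<circ> r) S)"
      using D(5)[OF T] bd by metis
  next
    fix C assume C: "C \<subseteq> E - {d}" "even_edges a b C"
    obtain S where S: "S \<subseteq> \<Phi>" "C = face_boundary E l r S"
      using dual_faces_even_avoiding[OF d] C by (metis Diff_subset order_trans)
    have dS: "l d \<in> S \<longleftrightarrow> r d \<in> S" using C S e by (auto simp: face_boundary_def)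
    have "T (h ` S) = S" using S dS unfolding T_def h_def by (auto split: if_splits)
    then show "\<exists>S\<subseteq>h ` \<Phi>. C = face_boundary (E - {d}) (h \<circ> l) (h \<circ> r) S"
      using S bd[of "h ` S"] by (intro exI[of _ "h ` S"]) auto
  next
    fix S assume S: "S \<subseteq> h ` \<Phi>" "face_boundary (E - {d}) (h \<circ> l) (h \<circ> r) S = {}"
    then have "T S = {} \<or> T S = \<Phi>" using D(6)[OF T] bd by metis
    then show "S = {} \<or> S = h ` \<Phi>" using S unfolding T_def by auto
  qed (use D in auto)
  show "outer_vertices (E - {d}) c (h ` \<Phi>) (h \<circ> l) (h \<circ> r) (h z)" if o: "outer_vertices E c \<Phi> l r z"
    unfolding outer_vertices_def
  proof (intro allI impI ballI, elim conjE)
    fix S x e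
    assume S: "S \<subseteq> h ` \<Phi>" "h z \<notin> S" "\<forall>e\<in>face_boundary (E - {d}) (h \<circ> l) (h \<circ> r) S. c e \<noteq> x"
      and e: "e \<in> E - {d}" "c e = x" "(h \<circ> l) e \<noteq> (h \<circ> r) e"
    have "z \<notin> T S" using S by (auto simp: T_def)
    moreover have "l e \<noteq> r e" using e by auto
    ultimately have "l e \<notin> T S"
      using o S e T[of S] unfolding outer_vertices_def bd by blast
    then show "(h \<circ> l) e \<notin> S" using D(3) e by (auto simp: T_def)
  qed
qed

text \<open>Folding \<open>F\<close> together at \<open>w\<close> glues \<open>e1\<close> to
  \<open>e2\<close>. The glued edge keeps the name \<open>e1\<close> and separates the far faces
  \<open>G1\<close> and \<open>G2\<close>, so it bounds a region exactly if one of
  \<open>e1\<close>, \<open>e2\<close> did. On edge sets this is addition of the path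
  \<open>e1\<close>, \<open>e2\<close> whenever \<open>e2\<close> would occur.\<close>

lemma dual_faces_identify:
  assumes d: "dual_faces E a b \<Phi> l r"
    and e12: "e1 \<in> E" "e2 \<in> E" "a e1 = w" "a e2 = w" "b e1 = u" "b e2 = v" "u \<noteq> v"
    and F: "{l e1, r e1} = {F, G1}" "{l e2, r e2} = {F, G2}"
  defines "l' \<equiv> l(e1 := G1)" and "r' \<equiv> r(e1 := G2)" and "b' \<equiv> (\<lambda>e. if b e = v then u else b e)"
  shows "dual_faces (E - {e2}) a b' \<Phi> l' r'"
    and "outer_vertices E a \<Phi> l r z \<Longrightarrow> outer_vertices E b \<Phi> l r z \<Longrightarrow> F \<noteq> z \<Longrightarrow>
      (\<And>e. e \<in> face_boundary E l r {F} \<Longrightarrow> a e = w \<Longrightarrow> e = e1 \<or> e = e2) \<Longrightarrow>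
      outer_vertices (E - {e2}) a \<Phi> l' r' z \<and> outer_vertices (E - {e2}) b' \<Phi> l' r' z"
proof -
  note D = dual_facesD[OF d]
  have ne: "e1 \<noteq> e2" using e12 by auto
  let ?bd = "face_boundary E l r" and ?bd' = "face_boundary (E - {e2}) l' r'"
  have sides: "((l e1 \<in> S) \<noteq> (r e1 \<in> S)) \<longleftrightarrow> ((F \<in> S) \<noteq> (G1 \<in> S))"
    "((l e2 \<in> S) \<noteq> (r e2 \<in> S)) \<longleftrightarrow> ((F \<in> S) \<noteq> (G2 \<in> S))" for S
    using F by (auto simp: doubleton_eq_iff)
  have G: "G1 \<in> \<Phi>" "G2 \<in> \<Phi>" "F \<in> \<Phi>"
    using F D(3,4) e12 by (auto simp: doubleton_eq_iff)
  have bd': "?bd' S = (if e2 \<in> ?bd S then sym_diff (?bd S) {e1, e2} else ?bd S)" for S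
    using sides[of S] e12 ne by (auto simp: face_boundary_def l'_def r'_def split: if_splits)
  have fin: "finite C" if "C \<subseteq> E" for C using D(1) that finite_subset by blast
  \<comment> \<open>The degrees of \<open>u\<close> and \<open>v\<close> add modulo two at the
    merged vertex, and \<open>v\<close> keeps no edges.\<close>
  have od': "odd_deg b' x C \<longleftrightarrow> x \<noteq> v \<and> (odd_deg b x C \<noteq> (x = u \<and> odd_deg b v C))" if "C \<subseteq> E" for x C
  proof (cases "x = u")
    case True
    have "{e \<in> C. b' e = u} = sym_diff {e \<in> C. b e = u} {e \<in> C. b e = v}"
      using e12 by (auto simp: b'_def)
    then show ?thesis using True e12 fin[OF that] by (simp add: odd_deg_def odd_card_sym_diff)
  next
    case False
    then have "{e \<in> C. b' e = x} = (if x = v then {} else {e \<in> C. b e = x})"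
      by (auto simp: b'_def)
    then show ?thesis using False by (simp add: odd_deg_def)
  qed
  have two: "odd_deg a x {e1, e2} \<longleftrightarrow> False" "odd_deg b y {e1, e2} \<longleftrightarrow> y = u \<or> y = v" for x y
    using e12 ne by (auto simp: odd_deg_insert)
  have push: "even_edges a b' C" "even_edges a b' (sym_diff C {e1, e2})"
    if C: "C \<subseteq> E" "even_edges a b C" for C
  proof -
    have C': "sym_diff C {e1, e2} \<subseteq> E" using C e12 by auto
    show "even_edges a b' C" using C od' by (auto simp: even_edges_def)
    show "even_edges a b' (sym_diff C {e1, e2})"
      using C od'[OF C'] fin[OF C(1)] two e12 unfolding even_edges_def
      by (auto simp: odd_deg_sym_diff)
  qed
  show "dual_faces (E - {e2}) a b' \<Phi> l' r'"
    unfolding dual_faces_def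
  proof (intro conjI allI impI)
    fix S assume S: "S \<subseteq> \<Phi>"
    have "?bd S \<subseteq> E" by (auto simp: face_boundary_def)
    then show "even_edges a b' (?bd' S)"
      unfolding bd' using push D(5)[OF S] by simp
  next
    fix C assume C: "C \<subseteq> E - {e2}" "even_edges a b' C"
    \<comment> \<open>An even set of the identified graph has equal parities at \<open>u\<close> and
      \<open>v\<close> upstairs. If both are odd, adding the path \<open>e1\<close>,
      \<open>e2\<close> through \<open>w\<close> repairs them without disturbing
      \<open>w\<close>.\<close>
    define C1 where "C1 = (if odd_deg b u C then sym_diff C {e1, e2} else C)"
    have CE: "C \<subseteq> E" using C by auto
    have "\<not> odd_deg a x C" "y \<noteq> u \<Longrightarrow> y \<noteq> v \<Longrightarrow> \<not> odd_deg b y C" "odd_deg b u C = odd_deg b v C" for x y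
      using C od'[OF CE] e12 unfolding even_edges_def by metis+
    then have ev: "even_edges a b C1"
      using fin[OF CE] two e12 unfolding C1_def even_edges_def by (auto simp: odd_deg_sym_diff) metis
    have "C1 \<subseteq> E" using CE e12 by (auto simp: C1_def)
    then obtain S where S: "S \<subseteq> \<Phi>" "C1 = ?bd S"
      using dual_faces_even_avoiding[OF d _ ev] by metis
    have "?bd' S = C" unfolding bd' S(2)[symmetric] C1_def using C ne by auto
    then show "\<exists>S\<subseteq>\<Phi>. C = ?bd' S" using S by blast
  next
    fix S assume S: "S \<subseteq> \<Phi>" "?bd' S = {}"
    \<comment> \<open>A nonempty boundary inside \<open>{e1, e2}\<close> would have degree one at
      \<open>u\<close> or at \<open>v\<close>.\<close>
    have sub: "f = e1 \<or> f = e2" if "f \<in> ?bd S" for f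
      using S(2) that unfolding bd' by (auto split: if_splits)
    have od: "\<not> odd_deg b u (?bd S)" "\<not> odd_deg b v (?bd S)"
      using D(5)[OF S(1)] by (auto simp: even_edges_def)
    have "e1 \<notin> ?bd S"
    proof
      assume *: "e1 \<in> ?bd S"
      have "odd_deg b u (?bd S)"
        by (rule odd_deg_unique[of e1 _ b u, OF * e12(5)]) (use sub e12 in blast)
      then show False using od by simp
    qed
    moreover have "e2 \<notin> ?bd S"
    proof
      assume *: "e2 \<in> ?bd S"
      have "odd_deg b v (?bd S)"
        by (rule odd_deg_unique[of e2 _ b v, OF * e12(6)]) (use sub e12 in blast)
      then show False using od by simp
    qed
    ultimately have "?bd S = {}" using sub by blast
    then show "S = {} \<or> S = \<Phi>" using D(6) S by blast
  qed (use D G in \<open>auto simp: l'_def r'_def\<close>)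
  show "outer_vertices (E - {e2}) a \<Phi> l' r' z \<and> outer_vertices (E - {e2}) b' \<Phi> l' r' z"
    if o: "outer_vertices E a \<Phi> l r z" "outer_vertices E b \<Phi> l r z" and Fz: "F \<noteq> z"
      and Fw: "\<And>e. e \<in> ?bd {F} \<Longrightarrow> a e = w \<Longrightarrow> e = e1 \<or> e = e2"
  proof
    have oa: "l e \<notin> S" "r e \<notin> S"
      if "S \<subseteq> \<Phi>" "z \<notin> S" "\<forall>e\<in>?bd S. a e \<noteq> x" "e \<in> E" "a e = x" "l e \<noteq> r e" for S x e
    proof -
      show "l e \<notin> S" using o(1) that unfolding outer_vertices_def by blast
      then show "r e \<notin> S" using that by (auto simp: face_boundary_def)
    qed
    have ob: "l e \<notin> S" "r e \<notin> S"
      if "S \<subseteq> \<Phi>" "z \<notin> S" "\<forall>e\<in>?bd S. b e \<noteq> x" "e \<in> E" "b e = x" "l e \<noteq> r e" for S x e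
    proof -
      show "l e \<notin> S" using o(2) that unfolding outer_vertices_def by blast
      then show "r e \<notin> S" using that by (auto simp: face_boundary_def)
    qed
    have inl: "l e1 \<in> S \<or> r e1 \<in> S" if "G1 \<in> S" for S using F that by (auto simp: doubleton_eq_iff)
    have inl2: "l e2 \<in> S \<or> r e2 \<in> S" if "G2 \<in> S" for S using F that by (auto simp: doubleton_eq_iff)
    have nl: "l e1 \<noteq> r e1 \<longleftrightarrow> F \<noteq> G1" "l e2 \<noteq> r e2 \<longleftrightarrow> F \<noteq> G2"
      using F by (auto simp: doubleton_eq_iff)
    show "outer_vertices (E - {e2}) a \<Phi> l' r' z"
      unfolding outer_vertices_def
    proof (intro allI impI ballI, elim conjE)
      fix S x e
      assume S: "S \<subseteq> \<Phi>" "z \<notin> S" "\<forall>e\<in>?bd' S. a e \<noteq> x"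
        and e: "e \<in> E - {e2}" "a e = x" "l' e \<noteq> r' e"
      show "l' e \<notin> S"
      proof (cases "\<forall>e\<in>?bd S. a e \<noteq> x")
        case True
        show ?thesis
        proof (cases "e = e1")
          case False
          then show ?thesis using oa[OF S(1,2) True, of e] e by (auto simp: l'_def r'_def)
        next
          case e1: True
          then have x: "x = w" "G1 \<noteq> G2" using e e12 by (auto simp: l'_def r'_def)
          then have "e1 \<notin> ?bd S" "e2 \<notin> ?bd S" using True e12 by auto
          then have same: "F \<in> S \<longleftrightarrow> G1 \<in> S" "F \<in> S \<longleftrightarrow> G2 \<in> S"
            using sides[of S] e12 by (auto simp: face_boundary_def)
          have "G1 \<notin> S"
          proof (cases "F = G1")
            case True
            then have "G2 \<notin> S" using oa[OF S(1,2) \<open>\<forall>e\<in>?bd S. a e \<noteq> x\<close>, of e2] e12 x nl inl2 by blast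
            then show ?thesis using same by simp
          next
            case False
            then show ?thesis using oa[OF S(1,2) \<open>\<forall>e\<in>?bd S. a e \<noteq> x\<close>, of e1] e12 x nl inl by blast
          qed
          then show ?thesis using e1 by (simp add: l'_def)
        qed
      next
        case False
        then obtain f where f: "f \<in> ?bd S" "a f = x" by blast
        \<comment> \<open>An edge at \<open>x\<close> that the identification removed from the
          boundary must be \<open>e1\<close> or \<open>e2\<close>; hence \<open>x = w\<close>, and
          both were in the old boundary.\<close>
        have e2: "e2 \<in> ?bd S" using S(3) f unfolding bd' by (auto split: if_splits)
        have S3: "a g \<noteq> x" if "g \<in> sym_diff (?bd S) {e1, e2}" for g
          using S(3) e2 that unfolding bd' by simp
        have "f = e1 \<or> f = e2" using S3[of f] f by blast
        then have x: "x = w" using f e12 by blast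
        have e1: "e1 \<in> ?bd S" using S3[of e1] e12 ne x by blast
        have rest: "f = e1 \<or> f = e2" if "f \<in> ?bd S" "a f = w" for f
          using S(3) that e2 x unfolding bd' by auto
        \<comment> \<open>Toggling \<open>F\<close> takes \<open>e1\<close> and \<open>e2\<close>
          out of the boundary. They are the only boundary edges of \<open>F\<close> at
          \<open>w\<close>, so nothing replaces them there and outerness applies to the new region,
          which still avoids \<open>z\<close>.\<close>
        let ?S = "sym_diff S {F}"
        have nb: "\<forall>f\<in>?bd ?S. a f \<noteq> x"
        proof (intro ballI notI)
          fix f assume f: "f \<in> ?bd ?S" "a f = x"
          have "e1 \<in> ?bd {F}" "e2 \<in> ?bd {F}"
            using e1 e2 sides[of S] sides[of "{F}"] by (simp_all add: face_boundary_def) blast+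
          then have "e1 \<notin> ?bd ?S" "e2 \<notin> ?bd ?S" using e1 e2 by (auto simp: face_boundary_sym_diff)
          moreover have "f \<in> ?bd S \<or> f \<in> ?bd {F}" using f by (auto simp: face_boundary_def)
          ultimately show False using f rest[of f] Fw[of f] x by blast
        qed
        have S': "?S \<subseteq> \<Phi>" "z \<notin> ?S" using S(1,2) G Fz by auto
        have av: "l f \<notin> ?S" "r f \<notin> ?S" if "f \<in> E" "a f = w" "l f \<noteq> r f" for f
          using oa[OF S' nb that(1) that(2)[folded x] that(3)] by blast+
        have "F \<noteq> G1" using e1 sides[of S] by (auto simp: face_boundary_def)
        then have g1: "G1 \<notin> S" using av[of e1] inl[of ?S] nl e12 by auto
        show ?thesis
        proof (cases "e = e1")
          case True
          then show ?thesis using g1 by (simp add: l'_def)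
        next
          case ne1: False
          then have le: "l e \<noteq> r e" "e \<noteq> e2" using e by (auto simp: l'_def r'_def)
          then have "e \<notin> ?bd {F}" using Fw[of e] ne1 e x by auto
          then have "l e \<noteq> F" using le e by (auto simp: face_boundary_def)
          then show ?thesis using av(1)[of e] le e x ne1 by (auto simp: l'_def)
        qed
      qed
    qed
    show "outer_vertices (E - {e2}) b' \<Phi> l' r' z"
      unfolding outer_vertices_def
    proof (intro allI impI ballI, elim conjE)
      fix S x e
      assume S: "S \<subseteq> \<Phi>" "z \<notin> S" "\<forall>e\<in>?bd' S. b' e \<noteq> x"
        and e: "e \<in> E - {e2}" "b' e = x" "l' e \<noteq> r' e"
      have xv: "x \<noteq> v" using e(2) e12(7) by (auto simp: b'_def split: if_splits)
      have ev: "\<not> odd_deg b u (?bd S)" using D(5)[OF S(1)] by (simp add: even_edges_def)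
      \<comment> \<open>The old boundary misses all preimages of \<open>x\<close>. For
        \<open>x = u\<close> with \<open>e2\<close> in the boundary, \<open>e1\<close> would also be
        there and would be its only edge at \<open>u\<close>, against evenness.\<close>
      have av: "b f \<noteq> x \<and> (x = u \<longrightarrow> b f \<noteq> v)" if f: "f \<in> ?bd S" for f
      proof (cases "e2 \<in> ?bd S")
        case False
        then show ?thesis using S(3) f xv unfolding bd' by (auto simp: b'_def)
      next
        case True
        have **: "x \<noteq> u" 
        proof
          assume xu: "x = u"
          have g1: "e1 \<in> ?bd S" 
          proof (rule ccontr)
            assume "e1 \<notin> ?bd S"
            then have "e1 \<in> ?bd' S" using True ne unfolding bd' by auto
            then show False using S(3) xu e12 by (auto simp: b'_def)
          qed
          have "odd_deg b u (?bd S)"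
          proof (rule odd_deg_unique[of e1 "?bd S" b u, OF g1 e12(5)])
            fix g assume g: "g \<in> ?bd S" "b g = u"
            show "g = e1"
            proof (rule ccontr)
              assume "g \<noteq> e1"
              then have "g \<in> ?bd' S" using True g e12 unfolding bd' by auto
              then show False using S(3) xu g e12 by (auto simp: b'_def)
            qed
          qed
          then show False using ev by simp
        qed
        show ?thesis
        proof (cases "f = e1 \<or> f = e2")
          case False
          then have "f \<in> ?bd' S" using True f unfolding bd' by auto
          then show ?thesis using S(3) ** xv by (auto simp: b'_def)
        qed (use ** xv e12 in auto)
      qed
      have no: "l f \<notin> S \<and> r f \<notin> S" if "f \<in> E" "b' f = x" "l f \<noteq> r f" for f
      proof (cases "b f = v")
        case True
        then have "\<forall>g\<in>?bd S. b g \<noteq> v" using av that by (auto simp: b'_def)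
        then show ?thesis using ob[OF S(1,2), of v f] True that by blast
      next
        case False
        then have "b f = x" using that by (auto simp: b'_def)
        moreover have "\<forall>g\<in>?bd S. b g \<noteq> x" using av by blast
        ultimately show ?thesis using ob[OF S(1,2), of x f] that by blast
      qed
      show "l' e \<notin> S"
      proof (cases "e = e1")
        case False
        then show ?thesis using no[of e] e by (auto simp: l'_def r'_def)
      next
        case True
        then have x: "x = u" "G1 \<noteq> G2" using e e12 by (auto simp: l'_def r'_def b'_def)
        then have "e1 \<notin> ?bd S" "e2 \<notin> ?bd S" using av e12 by blast+
        then have same: "F \<in> S \<longleftrightarrow> G1 \<in> S" "F \<in> S \<longleftrightarrow> G2 \<in> S"
          using sides[of S] e12 by (auto simp: face_boundary_def)
        have b': "b' e1 = x" "b' e2 = x" using x e12 by (auto simp: b'_def)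
        have "G1 \<notin> S"
        proof (cases "F = G1")
          case True
          then have "G2 \<notin> S" using no[of e2] e12 x nl inl2 b' by blast
          then show ?thesis using same by simp
        next
          case False
          then show ?thesis using no[of e1] e12 nl inl b' by blast
        qed
        then show ?thesis using True by (simp add: l'_def)
      qed
    qed
  qed
qed

text \<open>Common neighbours of identified vertices produce parallel edges, which are deleted one
  at a time until the ends determine the edge. The outer face is followed through the mergings, so
  \<open>z'\<close> may differ from \<open>z\<close>; the implication lets the planar and the
  outerplanar case share the lemma.\<close>

lemma dual_faces_simplify:
  fixes \<Phi> :: "'f set"
  assumes "dual_faces E a b \<Phi> l r"
  shows "\<exists>E' (\<Phi>' :: 'f set) l' r' z'. E' \<subseteq> E \<and> dual_faces E' a b \<Phi>' l' r' \<and> inj_on (\<lambda>e. (a e, b e)) E' \<and>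
    (\<forall>e\<in>E. \<exists>e'\<in>E'. a e' = a e \<and> b e' = b e) \<and>
    (z \<in> \<Phi> \<and> outer_vertices E a \<Phi> l r z \<and> outer_vertices E b \<Phi> l r z \<longrightarrow>
     z' \<in> \<Phi>' \<and> outer_vertices E' a \<Phi>' l' r' z' \<and> outer_vertices E' b \<Phi>' l' r' z')"
  using assms
proof (induction "card E" arbitrary: E \<Phi> l r z rule: less_induct)
  case less
  show ?case
  proof (cases "inj_on (\<lambda>e. (a e, b e)) E")
    case True
    then show ?thesis using less.prems
      by - (rule exI[of _ E], rule exI[of _ \<Phi>], rule exI[of _ l], rule exI[of _ r], rule exI[of _ z], auto)
  next
    case False
    then obtain d e where de: "d \<in> E" "e \<in> E" "d \<noteq> e" "a d = a e" "b d = b e"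
      by (auto simp: inj_on_def)
    define h where "h = (\<lambda>x. if x = r d then l d else x)"
    have hz: "h z = (if z = r d then l d else z)" by (simp add: h_def)
    note del = dual_faces_delete[OF less.prems de(1), folded h_def]
    have "card (E - {d}) < card E"
      using dual_facesD(1)[OF less.prems] de(1) by (intro psubset_card_mono) auto
    from less.hyps[OF this del(1), of "h z"]
    obtain E' and \<Phi>' :: "'f set" and l' r' z' where E': "E' \<subseteq> E - {d}" "dual_faces E' a b \<Phi>' l' r'"
      "inj_on (\<lambda>e. (a e, b e)) E'" "\<forall>e\<in>E - {d}. \<exists>e'\<in>E'. a e' = a e \<and> b e' = b e"
      "h z \<in> h ` \<Phi> \<and> outer_vertices (E - {d}) a (h ` \<Phi>) (h \<circ> l) (h \<circ> r) (h z) \<and>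
        outer_vertices (E - {d}) b (h ` \<Phi>) (h \<circ> l) (h \<circ> r) (h z) \<longrightarrow>
        z' \<in> \<Phi>' \<and> outer_vertices E' a \<Phi>' l' r' z' \<and> outer_vertices E' b \<Phi>' l' r' z'"
      by (elim exE conjE) (rule that, assumption+)
    have "\<forall>f\<in>E. \<exists>e'\<in>E'. a e' = a f \<and> b e' = b f"
      using E'(4) de by (metis DiffI singletonD)
    then show ?thesis
      using E' del(2)[of a z, folded hz] del(2)[of b z, folded hz]
      by - (rule exI[of _ E'], rule exI[of _ \<Phi>'], rule exI[of _ l'], rule exI[of _ r'], rule exI[of _ z'], auto)
  qed
qed

text \<open>
  The edges \<open>e1\<close>, \<open>e0\<close>, \<open>e2\<close> form a path along the face \<open>F\<close>. Outside \<open>F\<close>, a path of length two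
  joining the first and third vertex would cross one joining the second and fourth: the boundary
  of the common part of the regions bounded by the two 4-cycles would be the single edge \<open>e0\<close>.
\<close>

lemma dual_faces_no_crossing:
  assumes d: "dual_faces E a b \<Phi> l r"
    and e0: "e0 \<in> face_boundary E l r {F}" "a e0 = w" "b e0 = v"
    and e1: "e1 \<in> face_boundary E l r {F}" "a e1 = w" "b e1 = u"
    and e2: "e2 \<in> face_boundary E l r {F}" "a e2 = x" "b e2 = v"
    and f: "f1 \<in> E" "f2 \<in> E" "a f1 = p" "b f1 = u" "a f2 = p" "b f2 = v" "p \<noteq> w" "p \<noteq> x"
    and g: "g1 \<in> E" "g2 \<in> E" "a g1 = w" "b g1 = s" "a g2 = x" "b g2 = s" "s \<noteq> u" "s \<noteq> v"
    and ne: "u \<noteq> v" "w \<noteq> x"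
  shows False
proof -
  let ?bd = "face_boundary E l r"
  have E: "e0 \<in> E" "e1 \<in> E" "e2 \<in> E" using e0 e1 e2 by (auto simp: face_boundary_def)
  have ev: "even_edges a b {e1, e0, f2, f1}" "even_edges a b {e0, g1, g2, e2}"
    using e0 e1 e2 f g ne by (auto intro!: even_edges_four_cycle)
  obtain S1 where S1: "S1 \<subseteq> \<Phi>" "F \<notin> S1" "{e1, e0, f2, f1} = ?bd S1"
    using dual_faces_even_avoiding[OF d _ ev(1)] E f by (metis empty_subsetI insert_subset)
  obtain S2 where S2: "S2 \<subseteq> \<Phi>" "F \<notin> S2" "{e0, g1, g2, e2} = ?bd S2"
    using dual_faces_even_avoiding[OF d _ ev(2)] E g by (metis empty_subsetI insert_subset)
  let ?X = "?bd (S1 \<inter> S2)"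
  have "?X \<subseteq> ?bd S1 \<union> ?bd S2" by (auto simp: face_boundary_def)
  then have X: "?X \<subseteq> {e1, e0, f2, f1, g1, g2, e2}" using S1 S2 by auto
  have mem: "e1 \<in> ?bd S1" "e0 \<in> ?bd S1" "e0 \<in> ?bd S2" "e2 \<in> ?bd S2" "e1 \<notin> ?bd S2" "e2 \<notin> ?bd S1"
    using S1(3)[symmetric] S2(3)[symmetric] e0 e1 e2 f g ne by auto
  \<comment> \<open>Each of these edges has \<open>F\<close> on one side, and \<open>F\<close> is in
    neither region. So membership depends on the far face: that of \<open>e0\<close> is in both
    regions, those of \<open>e1\<close> and \<open>e2\<close> in only one.\<close>
  have m: "e0 \<in> ?X" "e1 \<notin> ?X" "e2 \<notin> ?X"
    using mem e0(1) e1(1) e2(1) S1(2) S2(2) by (auto simp: face_boundary_def)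
  have od: "\<not> odd_deg a y ?X" "\<not> odd_deg b y' ?X" for y y'
    using dual_facesD(5)[OF d, of "S1 \<inter> S2"] S1(1) by (auto simp: even_edges_def)
  \<comment> \<open>The remaining candidates are peeled off in the order \<open>f1\<close>,
    \<open>f2\<close>, \<open>g2\<close>, \<open>g1\<close>: each is, when its turn comes, the only
    possible edge at one of its ends.\<close>
  have "f1 \<notin> ?X"
  proof
    assume *: "f1 \<in> ?X"
    have "odd_deg b u ?X"
      by (rule odd_deg_unique[of f1 _ b u, OF * f(4)]) (use X m e0 e1 e2 f g ne in auto)
    then show False using od by simp
  qed
  moreover have "f2 \<notin> ?X"
  proof
    assume *: "f2 \<in> ?X"
    have "odd_deg a p ?X"
      by (rule odd_deg_unique[of f2 _ a p, OF * f(5)]) (use X m \<open>f1 \<notin> ?X\<close> e0 e1 e2 f g ne in auto)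
    then show False using od by simp
  qed
  moreover have "g2 \<notin> ?X"
  proof
    assume *: "g2 \<in> ?X"
    have "odd_deg a x ?X"
      by (rule odd_deg_unique[of g2 _ a x, OF * g(5)]) (use X m e0 e1 e2 f g ne in auto)
    then show False using od by simp
  qed
  ultimately have X': "?X \<subseteq> {e0, g1}" using X m by auto
  have "g1 \<notin> ?X"
  proof
    assume *: "g1 \<in> ?X"
    have "odd_deg b s ?X"
      by (rule odd_deg_unique[of g1 _ b s, OF * g(4)]) (use X' e0(3) g(8) in blast)
    then show False using od by simp
  qed
  then have "?X = {e0}" using X' m by auto
  then have "odd_deg a w ?X" using odd_deg_unique[of e0 ?X a w] e0 by blast
  then show False using od by simp
qed

text \<open>Let \<open>S\<close> and \<open>T\<close> be bounded by the 4-cycles through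
  \<open>w1\<close>, \<open>w2\<close> and through \<open>w1\<close>, \<open>w3\<close>. As
  \<open>w2\<close> is outer and off the second cycle, its faces avoid \<open>T\<close>; likewise
  those of \<open>w3\<close> avoid \<open>S\<close>. So the boundary of the intersection has at most
  \<open>f1\<close> at \<open>u\<close>, hence not even \<open>f1\<close>. Then a face at
  \<open>w1\<close> lies in the symmetric difference, whose boundary misses \<open>w1\<close>,
  although \<open>w1\<close> is outer.\<close>

lemma outer_vertices_no_K23:
  assumes d: "dual_faces E a b \<Phi> l r" and o: "outer_vertices E a \<Phi> l r z"
    and f: "f1 \<in> E" "f2 \<in> E" "f3 \<in> E" "a f1 = w1" "a f2 = w2" "a f3 = w3" "b f1 = u" "b f2 = u" "b f3 = u"
    and g: "g1 \<in> E" "g2 \<in> E" "g3 \<in> E" "a g1 = w1" "a g2 = w2" "a g3 = w3" "b g1 = v" "b g2 = v" "b g3 = v"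
    and ne: "u \<noteq> v" "w1 \<noteq> w2" "w1 \<noteq> w3" "w2 \<noteq> w3"
  shows False
proof -
  let ?bd = "face_boundary E l r"
  have ev: "even_edges a b {f1, g1, g2, f2}" "even_edges a b {f1, g1, g3, f3}"
    using f g ne by (auto intro!: even_edges_four_cycle)
  obtain S where S: "S \<subseteq> \<Phi>" "z \<notin> S" "{f1, g1, g2, f2} = ?bd S"
    using dual_faces_even_avoiding[OF d _ ev(1)] f g by (metis empty_subsetI insert_subset)
  obtain T where T: "T \<subseteq> \<Phi>" "z \<notin> T" "{f1, g1, g3, f3} = ?bd T"
    using dual_faces_even_avoiding[OF d _ ev(2)] f g by (metis empty_subsetI insert_subset)
  have out: "l e \<notin> R" if "R \<subseteq> \<Phi>" "z \<notin> R" "\<forall>f\<in>?bd R. a f \<noteq> a e" "e \<in> E" "l e \<noteq> r e" for R e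
    using o that unfolding outer_vertices_def by blast
  let ?X = "?bd (S \<inter> T)"
  have "?X \<subseteq> ?bd S \<union> ?bd T" by (auto simp: face_boundary_def)
  then have X: "?X \<subseteq> {f1, g1, g2, f2, g3, f3}" using S T by auto
  have od: "\<not> odd_deg a y ?X" "\<not> odd_deg b y' ?X" for y y'
    using dual_facesD(5)[OF d, of "S \<inter> T"] S(1) by (auto simp: even_edges_def)
  have mem: "f1 \<in> ?bd S" "f1 \<in> ?bd T" "f2 \<in> ?bd S" "f2 \<notin> ?bd T" "f3 \<in> ?bd T" "f3 \<notin> ?bd S"
    using S(3)[symmetric] T(3)[symmetric] f g ne by auto
  have "f2 \<notin> ?X"
  proof
    assume "f2 \<in> ?X"
    then have "l f2 \<in> T" "l f2 \<noteq> r f2" using mem by (auto simp: face_boundary_def)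
    moreover have "\<forall>f\<in>?bd T. a f \<noteq> a f2" using T(3)[symmetric] f g ne by auto
    ultimately show False using out[OF T(1,2), of f2] f by blast
  qed
  moreover have "f3 \<notin> ?X"
  proof
    assume "f3 \<in> ?X"
    then have "l f3 \<in> S" "l f3 \<noteq> r f3" using mem by (auto simp: face_boundary_def)
    moreover have "\<forall>f\<in>?bd S. a f \<noteq> a f3" using S(3)[symmetric] f g ne by auto
    ultimately show False using out[OF S(1,2), of f3] f by blast
  qed
  ultimately have "?X \<inter> {e. b e = u} \<subseteq> {f1}" using X g ne by auto
  then have "f1 \<notin> ?X" using odd_deg_unique[of f1 ?X b u] od f by blast
  then have "l f1 \<in> sym_diff S T" "l f1 \<noteq> r f1" using mem by (auto simp: face_boundary_def)
  moreover have "?bd (sym_diff S T) \<subseteq> {g2, f2, g3, f3}"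
    unfolding face_boundary_sym_diff S(3)[symmetric] T(3)[symmetric] by blast
  then have "\<forall>f\<in>?bd (sym_diff S T). a f \<noteq> a f1" using f(4-6) g(4-6) ne by auto
  moreover have "sym_diff S T \<subseteq> \<Phi>" "z \<notin> sym_diff S T" using S T by auto
  ultimately show False using out[of "sym_diff S T" f1] f by blast
qed

text \<open>A connected graph has a vertex other than \<open>z\<close> that is not a cut vertex, hence whose star is a bond.\<close>

lemma dual_faces_minimal_boundary:
  assumes d: "dual_faces E a b \<Phi> l r" and z: "z \<in> \<Phi>" "\<Phi> \<noteq> {z}"
  obtains F where "F \<in> \<Phi>" "F \<noteq> z" "face_boundary E l r {F} \<noteq> {}"
    "\<And>C. C \<subseteq> face_boundary E l r {F} \<Longrightarrow> even_edges a b C \<Longrightarrow> C = {} \<or> C = face_boundary E l r {F}"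
proof -
  note D = dual_facesD[OF d]
  let ?bd = "face_boundary E l r"
  \<comment> \<open>\<open>conn T\<close> says that the dual graph induced on \<open>T\<close> is
    connected and contains \<open>z\<close>. A neighbouring face can always be added, so a maximal
    proper \<open>T\<close> omits exactly one face.\<close>
  define conn where "conn T \<longleftrightarrow> T \<subseteq> \<Phi> \<and> z \<in> T \<and>
    (\<forall>S\<subseteq>T. (\<forall>e\<in>?bd S. \<not> (l e \<in> T \<and> r e \<in> T)) \<longrightarrow> S = {} \<or> S = T)" for T
  have "conn {z}" using z by (auto simp: conn_def)
  then have "conn {z} \<and> {z} \<noteq> \<Phi>" using z by auto
  moreover have "finite {T. conn T \<and> T \<noteq> \<Phi>}"
    by (rule finite_subset[of _ "Pow \<Phi>"]) (auto simp: conn_def D(2))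
  ultimately obtain T where T: "conn T" "T \<noteq> \<Phi>"
    and max: "\<And>T'. conn T' \<Longrightarrow> T' \<noteq> \<Phi> \<Longrightarrow> T \<subseteq> T' \<Longrightarrow> T' = T"
    using finite_has_maximal[of "{T. conn T \<and> T \<noteq> \<Phi>}"] by blast
  have T\<Phi>: "T \<subseteq> \<Phi>" "z \<in> T" using T by (auto simp: conn_def)
  then obtain e where e: "e \<in> ?bd T" using D(6)[of T] T by blast
  then obtain F where F: "F \<in> \<Phi>" "F \<notin> T" "F = l e \<and> r e \<in> T \<or> F = r e \<and> l e \<in> T" and eE: "e \<in> E"
    using D(3,4) by (auto simp: face_boundary_def)
  have "conn (insert F T)"
    unfolding conn_def
  proof (intro conjI allI impI)
    fix S assume S: "S \<subseteq> insert F T" "\<forall>e\<in>?bd S. \<not> (l e \<in> insert F T \<and> r e \<in> insert F T)"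
    have "\<forall>e\<in>?bd (S \<inter> T). \<not> (l e \<in> T \<and> r e \<in> T)"
      using S by (auto simp: face_boundary_def)
    then have "S \<inter> T = {} \<or> S \<inter> T = T" using T(1) unfolding conn_def by (metis inf_le2)
    moreover have "e \<notin> ?bd S" using S F e by (auto simp: face_boundary_def)
    then have "F \<in> S \<longleftrightarrow> S \<inter> T \<noteq> {}" using F eE calculation by (auto simp: face_boundary_def)
    ultimately show "S = {} \<or> S = insert F T" using S by blast
  qed (use F T\<Phi> in auto)
  then have \<Phi>: "insert F T = \<Phi>" using max[of "insert F T"] F by blast
  show ?thesis
  proof (rule that[OF F(1)])
    show "F \<noteq> z" using F T\<Phi> by auto
    show "?bd {F} \<noteq> {}" using D(6)[of "{F}"] F(1) z \<open>F \<noteq> z\<close> by blast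
    \<comment> \<open>An even part of the star of \<open>F\<close> bounds a region in
      \<open>T\<close> that cuts no edge within \<open>T\<close>; connectedness of \<open>T\<close>
      leaves only the two trivial regions.\<close>
    fix C assume C: "C \<subseteq> ?bd {F}" "even_edges a b C"
    then have "C \<subseteq> E" by (auto simp: face_boundary_def)
    then obtain S where S: "S \<subseteq> \<Phi>" "F \<notin> S" "C = ?bd S"
      using dual_faces_even_avoiding[OF d _ C(2)] by metis
    then have "S \<subseteq> T" "\<forall>e\<in>?bd S. \<not> (l e \<in> T \<and> r e \<in> T)"
      using \<Phi> C F by (auto simp: face_boundary_def)
    then have "S = {} \<or> S = T" using T(1) unfolding conn_def by blast
    moreover have "?bd T = ?bd {F}"
      using face_boundary_compl[of l E \<Phi> r "{F}"] D(3,4) \<Phi> F by (auto simp: image_subset_iff)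
    ultimately show "C = {} \<or> C = ?bd {F}" using S by (auto simp: face_boundary_def)
  qed
qed

section \<open>Edge counts for forests and cycles\<close>

lemma card_eq_sum_deg:
  assumes "finite F" shows "card F = (\<Sum>x\<in>a ` F. card {e \<in> F. a e = x})"
  using sum.image_gen[OF assms, of "\<lambda>_. 1::nat" a] by simp

text \<open>Without nonempty even subsets, the map from edge sets to their sets of odd vertices is
  injective. With at least as many edges as vertices it would be onto, but a single vertex is never
  the set of odd vertices.\<close>

lemma acyclic_card_less:
  assumes fin: "finite F" and ne: "F \<noteq> {}" and ac: "\<And>C. C \<subseteq> F \<Longrightarrow> even_edges a b C \<Longrightarrow> C = {}"
  shows "card F < card (a ` F) + card (b ` F)"
proof (rule ccontr)
  assume "\<not> ?thesis"
  then have le: "card (Sum_Type.Plus (a ` F) (b ` F)) \<le> card F" using fin by (simp add: card_Plus)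
  define T where "T C = {v \<in> Sum_Type.Plus (a ` F) (b ` F). case v of Inl x \<Rightarrow> odd_deg a x C | Inr y \<Rightarrow> odd_deg b y C}" for C
  have inT: "odd_deg a x C \<longleftrightarrow> Inl x \<in> T C" "odd_deg b y C \<longleftrightarrow> Inr y \<in> T C" if "C \<subseteq> F" for C x y
    using that odd_deg_in_image[of a x C] odd_deg_in_image[of b y C] by (auto simp: T_def)
  have "inj_on T (Pow F)"
  proof (rule inj_onI)
    fix C D assume CD: "C \<in> Pow F" "D \<in> Pow F" "T C = T D"
    then have f: "finite C" "finite D" using fin finite_subset by auto
    have "odd_deg a x C = odd_deg a x D" "odd_deg b y C = odd_deg b y D" for x y
      using inT[of C] inT[of D] CD by auto
    then have "even_edges a b (sym_diff C D)"
      unfolding even_edges_def using f by (simp add: odd_deg_sym_diff)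
    then have "sym_diff C D = {}" using ac[of "sym_diff C D"] CD by blast
    then show "C = D" by blast
  qed
  then have "card (T ` Pow F) = 2 ^ card F" using fin by (simp add: card_image card_Pow)
  moreover have sub: "T ` Pow F \<subseteq> Pow (Sum_Type.Plus (a ` F) (b ` F))" by (auto simp: T_def)
  moreover have "card (Pow (Sum_Type.Plus (a ` F) (b ` F))) \<le> 2 ^ card F"
    using le fin by (simp add: card_Pow power_increasing)
  ultimately have "T ` Pow F = Pow (Sum_Type.Plus (a ` F) (b ` F))"
    using fin by (intro card_seteq) auto
  moreover obtain e where "e \<in> F" using ne by auto
  ultimately have "{Inl (a e)} \<in> T ` Pow F" by auto
  then obtain C where C: "C \<subseteq> F" "T C = {Inl (a e)}" by auto
  have fC: "finite C" using C fin finite_subset by blast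
  have od: "odd_deg a x C \<longleftrightarrow> x = a e" "\<not> odd_deg b y C" for x y using inT[OF C(1)] C(2) by auto
  \<comment> \<open>Counting \<open>C\<close> by its ends on the \<open>b\<close> side gives an even
    number, on the \<open>a\<close> side an odd one, since \<open>a e\<close> is the only odd
    vertex.\<close>
  have "even (card C)"
    unfolding card_eq_sum_deg[OF fC, of b] using od(2) by (intro dvd_sum) (simp add: odd_deg_def)
  moreover have ae: "a e \<in> a ` C" using od(1)[of "a e"] by (intro odd_deg_in_image) simp
  have "even (\<Sum>x\<in>a ` C - {a e}. card {f \<in> C. a f = x})"
    using od(1) by (intro dvd_sum) (auto simp: odd_deg_def)
  then have "odd (card C)"
    unfolding card_eq_sum_deg[OF fC, of a] using sum.remove[OF _ ae, of "\<lambda>x. card {f \<in> C. a f = x}"] fC od(1)[of "a e"]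
    by (simp add: odd_deg_def)
  ultimately show False by simp
qed

lemma even_deg_ge_2:
  assumes "finite C" "\<not> odd_deg a y C" "y \<in> a ` C"
  shows "2 \<le> card {e \<in> C. a e = y}"
proof -
  have "card {e \<in> C. a e = y} \<noteq> 0" using assms by auto
  then show ?thesis using assms(2) unfolding odd_deg_def by (metis One_nat_def less_2_cases not_le odd_one)
qed

text \<open>All degrees in \<open>C\<close> are at least two, so a degree of three or more makes the
  edges outnumber the vertices. But by minimality \<open>C\<close> without an edge is acyclic, so
  \<open>C\<close> has at most as many edges as vertices.\<close>

lemma minimal_even_deg_le_2:
  assumes fin: "finite C" and ev: "even_edges a b C"
    and min: "\<And>D. D \<subseteq> C \<Longrightarrow> even_edges a b D \<Longrightarrow> D = {} \<or> D = C"
  shows "card {e \<in> C. a e = x} \<le> 2"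
proof (rule ccontr)
  assume big: "\<not> ?thesis"
  then obtain e where e: "e \<in> C" "a e = x" by (metis (mono_tags, lifting) Collect_empty_eq card.empty zero_le)
  have ge: "\<And>y. y \<in> a ` C \<Longrightarrow> 2 \<le> card {e \<in> C. a e = y}" and ge': "\<And>y. y \<in> b ` C \<Longrightarrow> 2 \<le> card {e \<in> C. b e = y}"
    using ev fin by (auto simp: even_edges_def intro!: even_deg_ge_2)
  have b2: "2 * card (b ` C) \<le> card C"
    unfolding card_eq_sum_deg[OF fin, of b] using sum_bounded_below[of "b ` C" 2 "\<lambda>y. card {e \<in> C. b e = y}"] ge'
    by (simp add: mult.commute)
  have xC: "x \<in> a ` C" using e by auto
  have "2 * card (a ` C - {x}) \<le> (\<Sum>y\<in>a ` C - {x}. card {e \<in> C. a e = y})"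
    using sum_bounded_below[of "a ` C - {x}" 2 "\<lambda>y. card {e \<in> C. a e = y}"] ge by (simp add: mult.commute)
  then have a2: "2 * card (a ` C) < card C"
    unfolding card_eq_sum_deg[OF fin, of a] using big sum.remove[OF _ xC, of "\<lambda>y. card {e \<in> C. a e = y}"] fin
      card.remove[OF _ xC] by simp
  have "card (C - {e}) < card (a ` (C - {e})) + card (b ` (C - {e}))"
  proof (rule acyclic_card_less)
    show "finite (C - {e})" using fin by simp
    have "C \<noteq> {e}" using a2 by auto
    then show "C - {e} \<noteq> {}" using e by blast
    show "D = {}" if "D \<subseteq> C - {e}" "even_edges a b D" for D
      using min[of D] that e by blast
  qed
  also have "\<dots> \<le> card (a ` C) + card (b ` C)"
    using fin by (intro add_mono card_mono image_mono) auto
  finally show False using a2 b2 e fin by (simp add: card_Diff_singleton)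
qed

section \<open>Stresses\<close>

text \<open>
  No edge weighting is balanced at every vertex when the vertex \<open>i\<close> of the first side is placed at
  \<open>(X 1 i, \<dots>, X k i)\<close> and the vertex \<open>j\<close> of the second side at \<open>(Y 1 j, \<dots>, Y l j)\<close>.
\<close>

definition stress_free_at :: "nat \<Rightarrow> nat \<Rightarrow> (nat \<Rightarrow> 'a \<Rightarrow> real) \<Rightarrow> (nat \<Rightarrow> 'b \<Rightarrow> real) \<Rightarrow>
    'e set \<Rightarrow> ('e \<Rightarrow> 'a) \<Rightarrow> ('e \<Rightarrow> 'b) \<Rightarrow> bool" where
  "stress_free_at k l X Y E a b \<longleftrightarrow> (\<forall>w.
     (\<forall>j. \<forall>p\<in>{1..k}. (\<Sum>e\<in>{e \<in> E. b e = j}. w e * X p (a e)) = 0) \<and>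
     (\<forall>i. \<forall>q\<in>{1..l}. (\<Sum>e\<in>{e \<in> E. a e = i}. w e * Y q (b e)) = 0) \<longrightarrow> (\<forall>e\<in>E. w e = 0))"

lemma stress_free_at_swap: "stress_free_at k l X Y E a b \<longleftrightarrow> stress_free_at l k Y X E b a"
  unfolding stress_free_at_def by (intro iff_allI) blast

text \<open>In the support of a stress every vertex has degree at least two, because one nonzero
  term cannot cancel in the first coordinate. This contradicts the edge bound for forests.\<close>

lemma stress_free_at_acyclic:
  assumes fin: "finite E" and ac: "\<And>C. C \<subseteq> E \<Longrightarrow> even_edges a b C \<Longrightarrow> C = {}"
    and kl: "1 \<le> k" "1 \<le> l" and X: "\<And>e. e \<in> E \<Longrightarrow> X 1 (a e) \<noteq> 0" and Y: "\<And>e. e \<in> E \<Longrightarrow> Y 1 (b e) \<noteq> 0"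
  shows "stress_free_at k l X Y E a b"
  unfolding stress_free_at_def
proof (intro allI impI, elim conjE)
  fix w
  assume A: "\<forall>j. \<forall>p\<in>{1..k}. (\<Sum>e\<in>{e \<in> E. b e = j}. w e * X p (a e)) = 0"
    and B: "\<forall>i. \<forall>q\<in>{1..l}. (\<Sum>e\<in>{e \<in> E. a e = i}. w e * Y q (b e)) = 0"
  define F where "F = {e \<in> E. w e \<noteq> 0}"
  have F: "finite F" "F \<subseteq> E" using fin by (auto simp: F_def)
  have two: "2 \<le> card {e \<in> F. c e = x}"
    if x: "x \<in> c ` F" and sum: "(\<Sum>e\<in>{e \<in> E. c e = x}. w e * Z e) = 0" and Z: "\<And>e. e \<in> E \<Longrightarrow> Z e \<noteq> 0"
    for c :: "'a \<Rightarrow> 'x" and x and Z :: "'a \<Rightarrow> real"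
  proof (rule ccontr)
    assume "\<not> ?thesis"
    moreover have "card {e \<in> F. c e = x} \<noteq> 0" using x F by auto
    ultimately have "card {e \<in> F. c e = x} = 1" by linarith
    then obtain e where e: "{e \<in> F. c e = x} = {e}" by (auto simp: card_1_singleton_iff)
    have "(\<Sum>e\<in>{e \<in> E. c e = x}. w e * Z e) = (\<Sum>e\<in>{e \<in> F. c e = x}. w e * Z e)"
      using fin by (intro sum.mono_neutral_right) (auto simp: F_def)
    then have "w e * Z e = 0" using e sum by simp
    moreover have "e \<in> F" using e by blast
    ultimately show False using Z[of e] by (auto simp: F_def)
  qed
  have "F = {}"
  proof (rule ccontr)
    assume ne: "F \<noteq> {}"
    have "2 * card (a ` F) \<le> card F"
    proof -
      have "2 \<le> card {e \<in> F. a e = x}" if "x \<in> a ` F" for x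
        using two[OF that, of "\<lambda>e. Y 1 (b e)"] B kl Y by auto
      then show ?thesis
        unfolding card_eq_sum_deg[OF F(1), of a]
        using sum_bounded_below[of "a ` F" 2 "\<lambda>x. card {e \<in> F. a e = x}"] by (simp add: mult.commute)
    qed
    moreover have "2 * card (b ` F) \<le> card F"
    proof -
      have "2 \<le> card {e \<in> F. b e = x}" if "x \<in> b ` F" for x
        using two[OF that, of "\<lambda>e. X 1 (a e)"] A kl X by auto
      then show ?thesis
        unfolding card_eq_sum_deg[OF F(1), of b]
        using sum_bounded_below[of "b ` F" 2 "\<lambda>x. card {e \<in> F. b e = x}"] by (simp add: mult.commute)
    qed
    moreover have "card F < card (a ` F) + card (b ` F)"
      using acyclic_card_less[OF F(1) ne] ac F(2) by (metis order_trans)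
    ultimately show False by linarith
  qed
  then show "\<forall>e\<in>E. w e = 0" by (auto simp: F_def)
qed

text \<open>
  The placement of the identified graph, pulled back to \<open>E\<close> by giving \<open>v\<close> the position of \<open>u\<close>,
  already admits no stress: a stress would push forward to zero, hence live on the
  edges to common neighbours of \<open>u\<close> and \<open>v\<close>, whose positions are linearly independent.
\<close>

lemma stress_free_at_identify:
  assumes fin: "finite E" and inj: "inj_on (\<lambda>e. (a e, b e)) E" and uv: "u \<noteq> v"
    and b': "b' = (\<lambda>e. if b e = v then u else b e)"
    and E': "E' \<subseteq> E" "inj_on (\<lambda>e. (a e, b' e)) E'"
    and rep: "\<And>e. e \<in> E \<Longrightarrow> \<exists>e'\<in>E'. a e' = a e \<and> b' e' = b' e"
    and N: "N = a ` {e \<in> E. b e = u} \<inter> a ` {e \<in> E. b e = v}"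
    and ind: "\<And>c. \<forall>p\<in>{1..k}. (\<Sum>i\<in>N. c i * X p i) = 0 \<Longrightarrow> \<forall>i\<in>N. c i = 0"
    and sf: "stress_free_at k l X Y E' a b'"
    and gen: "\<And>X' Y'. stress_free_at k l X' Y' E a b \<Longrightarrow> stress_free_at k l X Y E a b"
  shows "stress_free_at k l X Y E a b"
proof (rule gen[of X "\<lambda>q j. Y q (if j = v then u else j)"], unfold stress_free_at_def, intro allI impI, elim conjE)
  fix w
  assume A: "\<forall>j. \<forall>p\<in>{1..k}. (\<Sum>e\<in>{e \<in> E. b e = j}. w e * X p (a e)) = 0"
    and B: "\<forall>i. \<forall>q\<in>{1..l}. (\<Sum>e\<in>{e \<in> E. a e = i}. w e * Y q (if b e = v then u else b e)) = 0"
  \<comment> \<open>\<open>\<rho>\<close> chooses the edge of \<open>E'\<close> that represents a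
    class of edges parallel after the identification; \<open>w'\<close> adds the weights over each
    class.\<close>
  define \<rho> where "\<rho> e = (SOME e'. e' \<in> E' \<and> a e' = a e \<and> b' e' = b' e)" for e
  have \<rho>: "\<rho> e \<in> E'" "a (\<rho> e) = a e" "b' (\<rho> e) = b' e" if "e \<in> E" for e
    using someI_ex[of "\<lambda>e'. e' \<in> E' \<and> a e' = a e \<and> b' e' = b' e"] rep[OF that] unfolding \<rho>_def by blast+
  have \<rho>_iff: "\<rho> e = \<rho> f \<longleftrightarrow> a e = a f \<and> b' e = b' f" if "e \<in> E" "f \<in> E" for e f
    using \<rho>[OF that(1)] \<rho>[OF that(2)] E'(2) unfolding inj_on_def by (metis prod.inject)
  have \<rho>_id: "\<rho> e = e" if "e \<in> E'" for e
    using \<rho>[of e] that E' unfolding inj_on_def by (metis prod.inject subsetD)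
  define w' where "w' e' = (\<Sum>e\<in>{e \<in> E. \<rho> e = e'}. w e)" for e'
  \<comment> \<open>Conditions and factors depending only on the identified ends are constant on
    classes, so sums over \<open>E\<close> collapse to sums over \<open>E'\<close>.\<close>
  have push: "(\<Sum>e'\<in>{e' \<in> E'. P (a e') (b' e')}. w' e' * Z (a e') (b' e')) =
      (\<Sum>e\<in>{e \<in> E. P (a e) (b' e)}. w e * Z (a e) (b' e))" for P Z
  proof -
    have fE': "finite {e' \<in> E'. P (a e') (b' e')}" using fin E'(1) finite_subset by fastforce
    have "(\<Sum>e\<in>{e \<in> E. P (a e) (b' e)}. w e * Z (a e) (b' e)) =
      (\<Sum>e'\<in>{e' \<in> E'. P (a e') (b' e')}. \<Sum>e\<in>{e \<in> {e \<in> E. P (a e) (b' e)}. \<rho> e = e'}. w e * Z (a e) (b' e))"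
      using fin fE' \<rho> by (intro sum.group[symmetric]) auto
    also have "\<dots> = (\<Sum>e'\<in>{e' \<in> E'. P (a e') (b' e')}. w' e' * Z (a e') (b' e'))"
    proof (intro sum.cong refl)
      fix e' assume e': "e' \<in> {e' \<in> E'. P (a e') (b' e')}"
      have "{e \<in> {e \<in> E. P (a e) (b' e)}. \<rho> e = e'} = {e \<in> E. \<rho> e = e'}"
        using e' \<rho> by force
      moreover have "(\<Sum>e\<in>{e \<in> E. \<rho> e = e'}. w e * Z (a e) (b' e)) = (\<Sum>e\<in>{e \<in> E. \<rho> e = e'}. w e * Z (a e') (b' e'))"
        using \<rho> by (intro sum.cong) auto
      ultimately show "(\<Sum>e\<in>{e \<in> {e \<in> E. P (a e) (b' e)}. \<rho> e = e'}. w e * Z (a e) (b' e)) = w' e' * Z (a e') (b' e')"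
        by (simp add: w'_def sum_distrib_right)
    qed
    finally show ?thesis by simp
  qed
  have "\<forall>e'\<in>E'. w' e' = 0"
  proof -
    have "(\<Sum>e'\<in>{e' \<in> E'. b' e' = j}. w' e' * X p (a e')) = 0" if p: "p \<in> {1..k}" for j p
    proof -
      have "(\<Sum>e'\<in>{e' \<in> E'. b' e' = j}. w' e' * X p (a e')) = (\<Sum>e\<in>{e \<in> E. b' e = j}. w e * X p (a e))"
        using push[where P = "\<lambda>_ y. y = j" and Z = "\<lambda>x _. X p x"] by simp
      also have "\<dots> = 0"
      \<comment> \<open>At the merged vertex the equations of \<open>u\<close> and \<open>v\<close>
        are added; \<open>v\<close> itself has no edges left.\<close>
      proof (cases "j = u")
        case True
        have "{e \<in> E. b' e = j} = {e \<in> E. b e = u} \<union> {e \<in> E. b e = v}" using True by (auto simp: b')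
        then have "(\<Sum>e\<in>{e \<in> E. b' e = j}. w e * X p (a e)) =
            (\<Sum>e\<in>{e \<in> E. b e = u}. w e * X p (a e)) + (\<Sum>e\<in>{e \<in> E. b e = v}. w e * X p (a e))"
          using fin uv by (simp add: sum.union_disjoint disjoint_iff)
        then show ?thesis using A p by simp
      next
        case False
        show ?thesis
        proof (cases "j = v")
          case True
          then have "{e \<in> E. b' e = j} = {}" using uv by (auto simp: b')
          then show ?thesis by (simp only: sum.empty)
        next
          case False
          then have "{e \<in> E. b' e = j} = {e \<in> E. b e = j}" using \<open>j \<noteq> u\<close> by (auto simp: b')
          then show ?thesis using A p by (simp only:)
        qed
      qed
      finally show ?thesis .
    qed
    moreover have "(\<Sum>e'\<in>{e' \<in> E'. a e' = i}. w' e' * Y q (b' e')) = 0" if q: "q \<in> {1..l}" for i q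
      using push[where P = "\<lambda>x _. x = i" and Z = "\<lambda>_ y. Y q y"] B q by (simp add: b')
    ultimately show ?thesis using sf unfolding stress_free_at_def by blast
  qed
  then have fib: "(\<Sum>f\<in>{f \<in> E. a f = a e \<and> b' f = b' e}. w f) = 0" if "e \<in> E" for e
  proof -
    have "{f \<in> E. a f = a e \<and> b' f = b' e} = {f \<in> E. \<rho> f = \<rho> e}" using \<rho>_iff that by blast
    then show ?thesis using \<open>\<forall>e'\<in>E'. w' e' = 0\<close> \<rho>(1)[OF that] unfolding w'_def by simp
  qed
  have eqE: "e = f" if "e \<in> E" "f \<in> E" "a e = a f" "b e = b f" for e f
    using inj that unfolding inj_on_def by blast
  have single: "w e = 0" if e: "e \<in> E" and u: "\<And>f. f \<in> E \<Longrightarrow> a f = a e \<Longrightarrow> b' f = b' e \<Longrightarrow> f = e" for e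
  proof -
    have "{f \<in> E. a f = a e \<and> b' f = b' e} = {e}" using e u by blast
    then show ?thesis using fib[OF e] by simp
  qed
  have out: "w f = 0" if "f \<in> E" "b f = u" "a f \<notin> N" for f
  proof (rule single[OF that(1)])
    fix g assume g: "g \<in> E" "a g = a f" "b' g = b' f"
    then have "b g \<noteq> v" using that unfolding N by (metis (mono_tags, lifting) IntI image_eqI mem_Collect_eq)
    then show "g = f" using g that eqE[of g f] uv by (auto simp: b' split: if_splits)
  qed
  have wu: "w e = 0" if e: "e \<in> E" "b e = u" for e
  proof (cases "a e \<in> N")
    case False
    then show ?thesis using out e by blast
  next
    case aN: True
    \<comment> \<open>In the equation at \<open>u\<close> only edges to common neighbours survive,
      and \<open>ind\<close> annihilates their coefficients. Each \<open>c i\<close> is the weight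
      of one edge because \<open>E\<close> has no parallel edges.\<close>
    define c where "c i = (\<Sum>f\<in>{f \<in> E. b f = u \<and> a f = i}. w f)" for i
    have fN: "finite N" unfolding N using fin by simp
    have "(\<Sum>i\<in>N. c i * X p i) = 0" if p: "p \<in> {1..k}" for p
    proof -
      have "(\<Sum>e\<in>{e \<in> E. b e = u}. w e * X p (a e)) = (\<Sum>e\<in>{e \<in> E. b e = u \<and> a e \<in> N}. w e * X p (a e))"
        using fin out by (intro sum.mono_neutral_right) auto
      also have "\<dots> = (\<Sum>i\<in>N. \<Sum>e\<in>{e \<in> {e \<in> E. b e = u \<and> a e \<in> N}. a e = i}. w e * X p (a e))"
        using fin fN by (intro sum.group[symmetric]) auto
      also have "\<dots> = (\<Sum>i\<in>N. c i * X p i)"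
      proof (intro sum.cong refl)
        fix i assume i: "i \<in> N"
        have "{e \<in> {e \<in> E. b e = u \<and> a e \<in> N}. a e = i} = {e \<in> E. b e = u \<and> a e = i}" using i by auto
        then show "(\<Sum>e\<in>{e \<in> {e \<in> E. b e = u \<and> a e \<in> N}. a e = i}. w e * X p (a e)) = c i * X p i"
          by (simp add: c_def sum_distrib_right)
      qed
      finally show ?thesis using A p by simp
    qed
    then have "c (a e) = 0" using ind[of c] aN by blast
    moreover have "{f \<in> E. b f = u \<and> a f = a e} = {e}" using e by (auto intro: eqE)
    ultimately show ?thesis by (simp add: c_def)
  qed
  show "\<forall>e\<in>E. w e = 0"
  proof
    fix e assume e: "e \<in> E"
    show "w e = 0"
    proof (cases "b e = u")
      case True
      then show ?thesis using wu e by blast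
    next
      case nu: False
      show ?thesis
      proof (cases "\<exists>f\<in>E. a f = a e \<and> b' f = b' e \<and> f \<noteq> e")
        case False
        then show ?thesis using single[OF e] by blast
      next
        case True
        then obtain f where f: "f \<in> E" "a f = a e" "b' f = b' e" "f \<noteq> e" by blast
        \<comment> \<open>A class with more than one edge consists of one edge at \<open>u\<close>
          and one at \<open>v\<close> with opposite weights.\<close>
        have bb: "b f = u \<and> b e = v" using f e nu eqE[of f e] by (auto simp: b' split: if_splits)
        have "{f \<in> E. a f = a e \<and> b' f = b' e} = {e, f}"
        proof (intro equalityI subsetI)
          fix g assume g: "g \<in> {f \<in> E. a f = a e \<and> b' f = b' e}"
          then have "b g = u \<or> b g = v" using bb uv by (auto simp: b' split: if_splits)
          then show "g \<in> {e, f}" using g f e bb eqE[of g e] eqE[of g f] by auto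
        qed (use e f in auto)
        then have "w e + w f = 0" using fib[OF e] f(4) by simp
        then show ?thesis using wu[of f] f bb by simp
      qed
    qed
  qed
qed

section \<open>The two inductions on the number of edges\<close>

lemma even_boundary_edges:
  assumes d: "dual_faces E a b \<Phi> l r" and C: "C \<subseteq> E" "even_edges a b C" "C \<noteq> {}"
  obtains F e where "e \<in> face_boundary E l r {F}" "F \<in> \<Phi>"
proof -
  obtain S where S: "S \<subseteq> \<Phi>" "C = face_boundary E l r S"
    using dual_faces_even_avoiding[OF d C(1,2)] by metis
  then obtain e where "e \<in> face_boundary E l r S" using C(3) by blast
  then have "e \<in> E" "l e \<noteq> r e" by (auto simp: face_boundary_def)
  then have "e \<in> face_boundary E l r {l e}" "l e \<in> \<Phi>" using dual_facesD(3)[OF d] by (auto simp: face_boundary_def)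
  then show ?thesis using that by blast
qed

lemma face_boundary_singleton_sides:
  assumes "e \<in> face_boundary E l r {F}"
  obtains G where "{l e, r e} = {F, G}" "G \<noteq> F" "e \<in> E"
  using assms that[of "l e"] that[of "r e"] by (auto simp: face_boundary_def insert_commute)

text \<open>Simplification after the identification restores injectivity of the end map, which the
  induction needs again; the loss of \<open>e2\<close> makes the edge number drop.\<close>

lemma identify_step:
  fixes \<Phi> :: "'f set"
  assumes d: "dual_faces E a b \<Phi> l r" and inj: "inj_on (\<lambda>e. (a e, b e)) E"
    and e: "e1 \<in> face_boundary E l r {F}" "e2 \<in> face_boundary E l r {F}" "e1 \<noteq> e2" "a e1 = a e2"
  obtains b' E' and \<Phi>' :: "'f set" and l' r' z' where
    "b' = (\<lambda>e. if b e = b e2 then b e1 else b e)" "E' \<subseteq> E - {e2}"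
    "inj_on (\<lambda>e. (a e, b' e)) E'" "\<And>e. e \<in> E \<Longrightarrow> \<exists>e'\<in>E'. a e' = a e \<and> b' e' = b' e"
    "dual_faces E' a b' \<Phi>' l' r'"
    "z \<in> \<Phi> \<and> outer_vertices E a \<Phi> l r z \<and> outer_vertices E b \<Phi> l r z \<and> F \<noteq> z \<and>
      (\<forall>e\<in>face_boundary E l r {F}. a e = a e1 \<longrightarrow> e = e1 \<or> e = e2) \<longrightarrow>
      z' \<in> \<Phi>' \<and> outer_vertices E' a \<Phi>' l' r' z' \<and> outer_vertices E' b' \<Phi>' l' r' z'"
proof -
  obtain G1 where G1: "{l e1, r e1} = {F, G1}" "e1 \<in> E" using face_boundary_singleton_sides[OF e(1)] by metis
  obtain G2 where G2: "{l e2, r e2} = {F, G2}" "e2 \<in> E" using face_boundary_singleton_sides[OF e(2)] by metis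
  define b' where "b' = (\<lambda>e. if b e = b e2 then b e1 else b e)"
  have ne: "b e1 \<noteq> b e2" using inj e G1 G2 unfolding inj_on_def by blast
  note idf = dual_faces_identify[OF d G1(2) G2(2) refl e(4)[symmetric] refl refl ne G1(1) G2(1), folded b'_def]
  from dual_faces_simplify[OF idf(1), of z]
  obtain E' and \<Phi>' :: "'f set" and l' r' z' where E': "E' \<subseteq> E - {e2}" "dual_faces E' a b' \<Phi>' l' r'"
    "inj_on (\<lambda>e. (a e, b' e)) E'" "\<forall>e\<in>E - {e2}. \<exists>e'\<in>E'. a e' = a e \<and> b' e' = b' e"
    "z \<in> \<Phi> \<and> outer_vertices (E - {e2}) a \<Phi> (l(e1 := G1)) (r(e1 := G2)) z \<and>
      outer_vertices (E - {e2}) b' \<Phi> (l(e1 := G1)) (r(e1 := G2)) z \<longrightarrow>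
      z' \<in> \<Phi>' \<and> outer_vertices E' a \<Phi>' l' r' z' \<and> outer_vertices E' b' \<Phi>' l' r' z'"
    by (elim exE conjE) (rule that, assumption+)
  show ?thesis
  proof (rule that[OF b'_def E'(1,3) _ E'(2), of z'])
    fix f assume f: "f \<in> E"
    show "\<exists>e'\<in>E'. a e' = a f \<and> b' e' = b' f"
    proof (cases "f = e2")
      case True
      have "e1 \<in> E - {e2}" "a e1 = a e2" "b' e1 = b' e2" using G1(2) e ne by (auto simp: b'_def)
      then show ?thesis using E'(4) True by metis
    qed (use E'(4) f in auto)
  next
    show "z \<in> \<Phi> \<and> outer_vertices E a \<Phi> l r z \<and> outer_vertices E b \<Phi> l r z \<and> F \<noteq> z \<and>
        (\<forall>e\<in>face_boundary E l r {F}. a e = a e1 \<longrightarrow> e = e1 \<or> e = e2) \<longrightarrow>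
        z' \<in> \<Phi>' \<and> outer_vertices E' a \<Phi>' l' r' z' \<and> outer_vertices E' b' \<Phi>' l' r' z'"
      using idf(2)[of z] E'(5) by blast
  qed
qed

text \<open>Among three common neighbours one avoids the two vertices already on the face path,
  which is the form required by \<open>dual_faces_no_crossing\<close>.\<close>

lemma card_common_gt_2:
  assumes "\<not> card N \<le> 2" "N \<subseteq> a ` {e \<in> E. b e = u} \<inter> a ` {e \<in> E. b e = v}"
  obtains p f1 f2 where "f1 \<in> E" "f2 \<in> E" "a f1 = p" "b f1 = u" "a f2 = p" "b f2 = v" "p \<noteq> w" "p \<noteq> x"
proof -
  have "\<not> N \<subseteq> {w, x}" using assms(1) card_mono[of "{w, x}" N] by (auto simp: card_insert_if split: if_splits)
  then obtain p where "p \<in> N" "p \<noteq> w" "p \<noteq> x" by blast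
  then show ?thesis using assms(2) that by blast
qed

text \<open>\<open>gen\<close> quantifies over all graphs labelled in \<open>A\<close> and
  \<open>B\<close>, because the induction changes edges and end maps while the placement
  \<open>X\<close>, \<open>Y\<close> stays fixed.\<close>

theorem stress_free_at_planar:
  fixes E :: "'e set" and \<Phi> :: "'f set" and X :: "nat \<Rightarrow> 'a \<Rightarrow> real" and Y :: "nat \<Rightarrow> 'b \<Rightarrow> real"
  assumes d: "dual_faces E a b \<Phi> l r" and inj: "inj_on (\<lambda>e. (a e, b e)) E" and AB: "a ` E \<subseteq> A" "b ` E \<subseteq> B"
    and gen: "\<And>(E :: 'e set) a b X' Y'. finite E \<Longrightarrow> a ` E \<subseteq> A \<Longrightarrow> b ` E \<subseteq> B \<Longrightarrow>
      stress_free_at 2 2 X' Y' E a b \<Longrightarrow> stress_free_at 2 2 X Y E a b"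
    and indA: "\<And>N c. finite N \<Longrightarrow> N \<subseteq> A \<Longrightarrow> card N \<le> 2 \<Longrightarrow>
      \<forall>p\<in>{1..2}. (\<Sum>i\<in>N. c i * X p i) = 0 \<Longrightarrow> \<forall>i\<in>N. c i = 0"
    and indB: "\<And>N c. finite N \<Longrightarrow> N \<subseteq> B \<Longrightarrow> card N \<le> 2 \<Longrightarrow>
      \<forall>p\<in>{1..2}. (\<Sum>i\<in>N. c i * Y p i) = 0 \<Longrightarrow> \<forall>i\<in>N. c i = 0"
    and nz: "\<And>i. i \<in> A \<Longrightarrow> X 1 i \<noteq> 0" "\<And>j. j \<in> B \<Longrightarrow> Y 1 j \<noteq> 0"
  shows "stress_free_at 2 2 X Y E a b"
  using d inj AB
proof (induction "card E" arbitrary: E a b \<Phi> l r rule: less_induct)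
  case less
  note d = less.prems(1) and inj = less.prems(2) and AB = less.prems(3,4)
  note D = dual_facesD[OF d]
  have fin: "finite E" by (rule D)
  show ?case
  proof (cases "\<forall>C\<subseteq>E. even_edges a b C \<longrightarrow> C = {}")
    case True
    then have "C = {}" if "C \<subseteq> E" "even_edges a b C" for C using that by blast
    moreover have "X 1 (a e) \<noteq> 0" "Y 1 (b e) \<noteq> 0" if "e \<in> E" for e using nz AB that by blast+
    ultimately show ?thesis by (intro stress_free_at_acyclic[OF fin]) simp_all
  next
    case False
    then obtain F e0 where e0: "e0 \<in> face_boundary E l r {F}" and F: "F \<in> \<Phi>"
      using even_boundary_edges[OF d] by metis
    have ev: "even_edges a b (face_boundary E l r {F})" using D(5)[of "{F}"] F by simp
    \<comment> \<open>Evenness at both ends of \<open>e0\<close> extends it to a path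
      \<open>e1\<close>, \<open>e0\<close>, \<open>e2\<close> on the boundary of \<open>F\<close>;
      as there are no parallel edges, its four vertices are distinct.\<close>
    obtain e1 where e1: "e1 \<in> face_boundary E l r {F}" "a e1 = a e0" "e1 \<noteq> e0"
      using ev e0 odd_deg_other[of a "a e0"] unfolding even_edges_def by metis
    obtain e2 where e2: "e2 \<in> face_boundary E l r {F}" "b e2 = b e0" "e2 \<noteq> e0"
      using ev e0 odd_deg_other[of b "b e0"] unfolding even_edges_def by metis
    have E: "e0 \<in> E" "e1 \<in> E" "e2 \<in> E" using e0 e1 e2 by (auto simp: face_boundary_def)
    have ne: "b e1 \<noteq> b e0" "a e0 \<noteq> a e2" using inj E e1 e2 unfolding inj_on_def by metis+
    let ?N = "a ` {e \<in> E. b e = b e1} \<inter> a ` {e \<in> E. b e = b e0}"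
    let ?M = "b ` {e \<in> E. a e = a e0} \<inter> b ` {e \<in> E. a e = a e2}"
    show ?thesis
    proof (cases "card ?N \<le> 2")
      case N: True
      obtain b' E' and \<Phi>' :: "'f set" and l' r' where E': "b' = (\<lambda>e. if b e = b e0 then b e1 else b e)"
        "E' \<subseteq> E - {e0}" "inj_on (\<lambda>e. (a e, b' e)) E'" "\<And>e. e \<in> E \<Longrightarrow> \<exists>e'\<in>E'. a e' = a e \<and> b' e' = b' e"
        "dual_faces E' a b' \<Phi>' l' r'"
        by (rule identify_step[OF d inj e1(1) e0 e1(3,2)]) (rule that, assumption+)
      have cE: "card E' < card E" using E'(2) E(1) fin by (intro psubset_card_mono) auto
      have "a ` E' \<subseteq> A" "b' ` E' \<subseteq> B" using AB E'(1,2) E by auto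
      then have sf: "stress_free_at 2 2 X Y E' a b'" by (rule less.hyps[OF cE E'(5,3)])
      have NA: "finite ?N" "?N \<subseteq> A" using fin AB by auto
      show ?thesis
        by (rule stress_free_at_identify[OF fin inj ne(1) E'(1) _ E'(3,4) refl _ sf])
          (use E'(2) indA[OF NA N] gen[OF fin AB] in auto)
    next
      case N: False
      have M: "card ?M \<le> 2"
      proof (rule ccontr)
        assume M: "\<not> card ?M \<le> 2"
        obtain p f1 f2 where f: "f1 \<in> E" "f2 \<in> E" "a f1 = p" "b f1 = b e1" "a f2 = p" "b f2 = b e0"
          "p \<noteq> a e0" "p \<noteq> a e2" using card_common_gt_2[OF N order_refl] by metis
        obtain s g1 g2 where g: "g1 \<in> E" "g2 \<in> E" "b g1 = s" "a g1 = a e0" "b g2 = s" "a g2 = a e2"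
          "s \<noteq> b e1" "s \<noteq> b e0" using card_common_gt_2[OF M order_refl] by metis
        show False
          by (rule dual_faces_no_crossing[OF d e0 refl refl e1(1,2) refl e2(1) refl e2(2) f g(1,2,4,3,6,5,7,8) ne])
      qed
      \<comment> \<open>The pair \<open>b e1\<close>, \<open>b e0\<close> is given up for
        \<open>a e0\<close>, \<open>a e2\<close>. Exchanging the sides turns this into the same kind
        of identification.\<close>
      have d': "dual_faces E b a \<Phi> l r" using d dual_faces_swap by blast
      have inj': "inj_on (\<lambda>e. (b e, a e)) E" using inj unfolding inj_on_def by auto
      obtain a' E' and \<Phi>' :: "'f set" and l' r' where E': "a' = (\<lambda>e. if a e = a e2 then a e0 else a e)"
        "E' \<subseteq> E - {e2}" "inj_on (\<lambda>e. (b e, a' e)) E'" "\<And>e. e \<in> E \<Longrightarrow> \<exists>e'\<in>E'. b e' = b e \<and> a' e' = a' e"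
        "dual_faces E' b a' \<Phi>' l' r'"
        by (rule identify_step[OF d' inj' e0 e2(1) e2(3)[symmetric] e2(2)[symmetric]]) (rule that, assumption+)
      have cE: "card E' < card E" using E'(2) E(3) fin by (intro psubset_card_mono) auto
      have AB': "a' ` E' \<subseteq> A" "b ` E' \<subseteq> B" using AB E'(1,2) E by auto
      have dE: "dual_faces E' a' b \<Phi>' l' r'" using E'(5) dual_faces_swap by blast
      have "inj_on (\<lambda>e. (a' e, b e)) E'" using E'(3) unfolding inj_on_def by auto
      from less.hyps[OF cE dE this AB']
      have sf: "stress_free_at 2 2 Y X E' b a'" using stress_free_at_swap by blast
      have MB: "finite ?M" "?M \<subseteq> B" using fin AB by auto
      have "stress_free_at 2 2 Y X E b a"
        by (rule stress_free_at_identify[OF fin inj' ne(2) E'(1) _ E'(3,4) refl _ sf])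
          (use E'(2) indB[OF MB M] gen[OF fin AB] in \<open>auto simp: stress_free_at_swap[of 2 2 _ _ E a b]\<close>)
      then show ?thesis using stress_free_at_swap by blast
    qed
  qed
qed

text \<open>Every step identifies on the \<open>b\<close> side, so independence is only asked of at
  most two generic points of the plane. The induction ends when \<open>z\<close> is the only face,
  which means that no cycle is left.\<close>

theorem stress_free_at_outerplanar:
  fixes E :: "'e set" and \<Phi> :: "'f set" and X :: "nat \<Rightarrow> 'a \<Rightarrow> real" and Y :: "nat \<Rightarrow> 'b \<Rightarrow> real"
  assumes d: "dual_faces E a b \<Phi> l r" and inj: "inj_on (\<lambda>e. (a e, b e)) E" and AB: "a ` E \<subseteq> A" "b ` E \<subseteq> B"
    and o: "z \<in> \<Phi>" "outer_vertices E a \<Phi> l r z" "outer_vertices E b \<Phi> l r z"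
    and gen: "\<And>(E :: 'e set) a b X' Y'. finite E \<Longrightarrow> a ` E \<subseteq> A \<Longrightarrow> b ` E \<subseteq> B \<Longrightarrow>
      stress_free_at 2 1 X' Y' E a b \<Longrightarrow> stress_free_at 2 1 X Y E a b"
    and indA: "\<And>N c. finite N \<Longrightarrow> N \<subseteq> A \<Longrightarrow> card N \<le> 2 \<Longrightarrow>
      \<forall>p\<in>{1..2}. (\<Sum>i\<in>N. c i * X p i) = 0 \<Longrightarrow> \<forall>i\<in>N. c i = 0"
    and nz: "\<And>i. i \<in> A \<Longrightarrow> X 1 i \<noteq> 0" "\<And>j. j \<in> B \<Longrightarrow> Y 1 j \<noteq> 0"
  shows "stress_free_at 2 1 X Y E a b"
  using d inj AB o
proof (induction "card E" arbitrary: E a b \<Phi> l r z rule: less_induct)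
  case less
  note d = less.prems(1) and inj = less.prems(2) and AB = less.prems(3,4) and o = less.prems(5-7)
  note D = dual_facesD[OF d]
  have fin: "finite E" by (rule D)
  show ?case
  proof (cases "\<Phi> = {z}")
    case True
    have "C = {}" if C: "C \<subseteq> E" "even_edges a b C" for C
    proof -
      obtain S where "S \<subseteq> \<Phi>" "z \<notin> S" "C = face_boundary E l r S"
        using dual_faces_even_avoiding[OF d C] by metis
      then show ?thesis using True by (auto simp: face_boundary_def)
    qed
    moreover have "X 1 (a e) \<noteq> 0" "Y 1 (b e) \<noteq> 0" if "e \<in> E" for e using nz AB that by blast+
    ultimately show ?thesis by (intro stress_free_at_acyclic[OF fin]) simp_all
  next
    case False
    \<comment> \<open>The minimal boundary is a cycle, so just two of its edges meet at
      \<open>a e0\<close>; this is the condition under which \<open>dual_faces_identify\<close>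
      keeps the vertices outer.\<close>
    obtain F where F: "F \<in> \<Phi>" "F \<noteq> z" "face_boundary E l r {F} \<noteq> {}"
      and min: "\<And>C. C \<subseteq> face_boundary E l r {F} \<Longrightarrow> even_edges a b C \<Longrightarrow> C = {} \<or> C = face_boundary E l r {F}"
      using dual_faces_minimal_boundary[OF d o(1) False] by metis
    let ?C = "face_boundary E l r {F}"
    have ev: "even_edges a b ?C" using D(5)[of "{F}"] F by simp
    obtain e0 where e0: "e0 \<in> ?C" using F(3) by blast
    obtain e1 where e1: "e1 \<in> ?C" "a e1 = a e0" "e1 \<noteq> e0"
      using ev e0 odd_deg_other[of a "a e0"] unfolding even_edges_def by metis
    have finC: "finite ?C" using fin by (simp add: face_boundary_def)
    have le2: "card {e \<in> ?C. a e = a e0} \<le> 2" by (rule minimal_even_deg_le_2[OF finC ev min])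
    have "{e1, e0} = {e \<in> ?C. a e = a e0}"
      by (rule card_seteq) (use finC e0 e1 le2 in auto)
    then have only: "e = e1 \<or> e = e0" if "e \<in> ?C" "a e = a e1" for e using that e1 by auto
    have E: "e0 \<in> E" "e1 \<in> E" using e0 e1 by (auto simp: face_boundary_def)
    have ne: "b e1 \<noteq> b e0" using inj E e1 unfolding inj_on_def by metis
    let ?N = "a ` {e \<in> E. b e = b e1} \<inter> a ` {e \<in> E. b e = b e0}"
    have N: "card ?N \<le> 2"
    proof (rule ccontr)
      assume "\<not> card ?N \<le> 2"
      then have "3 \<le> card ?N" by simp
      then obtain T where T: "T \<subseteq> ?N" "card T = 3" by (rule obtain_subset_with_card_n)
      then obtain w1 w2 w3 where w: "T = {w1, w2, w3}" "w1 \<noteq> w2" "w2 \<noteq> w3" "w1 \<noteq> w3"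
        by (auto simp: card_3_iff)
      have "\<forall>w\<in>T. \<exists>f. f \<in> E \<and> a f = w \<and> b f = b e1" using T(1) by auto
      from bchoice[OF this] obtain f where f: "\<forall>w\<in>T. f w \<in> E \<and> a (f w) = w \<and> b (f w) = b e1" ..
      have "\<forall>w\<in>T. \<exists>g. g \<in> E \<and> a g = w \<and> b g = b e0" using T(1) by auto
      from bchoice[OF this] obtain g where g: "\<forall>w\<in>T. g w \<in> E \<and> a (g w) = w \<and> b (g w) = b e0" ..
      show False
        by (rule outer_vertices_no_K23[OF d o(2) _ _ _ _ _ _ _ _ _ _ _ _ _ _ _ _ _ _ ne w(2,4,3),
              where ?f1.0 = "f w1" and ?f2.0 = "f w2" and ?f3.0 = "f w3" and
                ?g1.0 = "g w1" and ?g2.0 = "g w2" and ?g3.0 = "g w3"])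
          (use f g w(1) in auto)
    qed
    obtain b' E' and \<Phi>' :: "'f set" and l' r' z' where E': "b' = (\<lambda>e. if b e = b e0 then b e1 else b e)"
      "E' \<subseteq> E - {e0}" "inj_on (\<lambda>e. (a e, b' e)) E'" "\<And>e. e \<in> E \<Longrightarrow> \<exists>e'\<in>E'. a e' = a e \<and> b' e' = b' e"
      "dual_faces E' a b' \<Phi>' l' r'"
      "z \<in> \<Phi> \<and> outer_vertices E a \<Phi> l r z \<and> outer_vertices E b \<Phi> l r z \<and> F \<noteq> z \<and>
        (\<forall>e\<in>?C. a e = a e1 \<longrightarrow> e = e1 \<or> e = e0) \<longrightarrow>
        z' \<in> \<Phi>' \<and> outer_vertices E' a \<Phi>' l' r' z' \<and> outer_vertices E' b' \<Phi>' l' r' z'"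
      by (rule identify_step[OF d inj e1(1) e0 e1(3,2), of z]) (rule that, assumption+)
    have o': "z' \<in> \<Phi>' \<and> outer_vertices E' a \<Phi>' l' r' z' \<and> outer_vertices E' b' \<Phi>' l' r' z'"
      using E'(6) o F(2) only by blast
    have cE: "card E' < card E" using E'(2) E(1) fin by (intro psubset_card_mono) auto
    have AB': "a ` E' \<subseteq> A" "b' ` E' \<subseteq> B" using AB E'(1,2) E by auto
    have sf: "stress_free_at 2 1 X Y E' a b'" by (rule less.hyps[OF cE E'(5,3) AB']) (use o' in blast)+
    have NA: "finite ?N" "?N \<subseteq> A" using fin AB by auto
    show ?thesis
      by (rule stress_free_at_identify[OF fin inj ne E'(1) _ E'(3,4) refl _ sf])
        (use E'(2) indA[OF NA N] gen[OF fin AB] in auto)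
  qed
qed

section \<open>Circuits\<close>

fun path_edges :: "'v list \<Rightarrow> 'v set set" where
  "path_edges (x # y # p) = insert {x, y} (path_edges (y # p))"
| "path_edges _ = {}"

definition even_set :: "'v set set \<Rightarrow> bool" where
  "even_set C \<longleftrightarrow> (\<forall>x. even (card {e \<in> C. x \<in> e}))"

text \<open>Minimality suits the splitting of even sets into circuits. The cyclic order needed for a
  Jordan curve is recovered by \<open>circuit_minus_edge\<close>.\<close>

definition circuit :: "'v set set \<Rightarrow> bool" where
  "circuit C \<longleftrightarrow> C \<noteq> {} \<and> even_set C \<and> (\<forall>D\<subseteq>C. even_set D \<longrightarrow> D = {} \<or> D = C)"

lemma path_edges_subset: "e \<in> path_edges p \<Longrightarrow> e \<subseteq> set p"
  by (induction p rule: path_edges.induct) auto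

lemma path_edges_append: "path_edges (y # q) \<subseteq> path_edges (p @ y # q)"
proof (induction p)
  case (Cons a p)
  then show ?case by (cases p) auto
qed simp

lemma finite_path_edges [simp]: "finite (path_edges p)"
  by (induction p rule: path_edges.induct) auto

lemma even_set_sym_diff:
  assumes "finite C" "finite D" "even_set C" "even_set D"
  shows "even_set (sym_diff C D)"
  unfolding even_set_def
proof
  fix x
  have "{e \<in> sym_diff C D. x \<in> e} = sym_diff {e \<in> C. x \<in> e} {e \<in> D. x \<in> e}" by blast
  then show "even (card {e \<in> sym_diff C D. x \<in> e})"
    using assms odd_card_sym_diff[of "{e \<in> C. x \<in> e}" "{e \<in> D. x \<in> e}"] unfolding even_set_def by auto
qed

lemma odd_card_star_insert:
  assumes "finite C" "e \<notin> C"
  shows "odd (card {f \<in> insert e C. x \<in> f}) \<longleftrightarrow> odd (card {f \<in> C. x \<in> f}) \<noteq> (x \<in> e)"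
proof -
  have "{f \<in> insert e C. x \<in> f} = (if x \<in> e then insert e {f \<in> C. x \<in> f} else {f \<in> C. x \<in> f})" by auto
  then show ?thesis using assms by auto
qed

text \<open>Each edge added at the head toggles the parity at its two ends; the exclusive or also
  covers the path with a single vertex.\<close>

lemma odd_card_star_path_edges:
  assumes "distinct p" "p \<noteq> []"
  shows "odd (card {f \<in> path_edges p. x \<in> f}) \<longleftrightarrow> (x = hd p) \<noteq> (x = last p)"
  using assms
proof (induction p rule: path_edges.induct)
  case (1 y z p)
  have "{y, z} \<notin> path_edges (z # p)" using path_edges_subset[of "{y, z}" "z # p"] 1 by auto
  then have "odd (card {f \<in> path_edges (y # z # p). x \<in> f}) \<longleftrightarrow>
      odd (card {f \<in> path_edges (z # p). x \<in> f}) \<noteq> (x \<in> {y, z})"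
    by (simp add: odd_card_star_insert del: insert_iff)
  also have "\<dots> \<longleftrightarrow> (x = y) \<noteq> (x = last (y # z # p))" using 1 by auto
  finally show ?case by simp
qed auto

lemma even_set_cycle:
  assumes "distinct p" "p \<noteq> []" "hd p \<noteq> last p" "{hd p, last p} \<notin> path_edges p"
  shows "even_set (insert {hd p, last p} (path_edges p))"
  unfolding even_set_def
proof
  fix x
  have "odd (card {f \<in> insert {hd p, last p} (path_edges p). x \<in> f}) \<longleftrightarrow>
      ((x = hd p) \<noteq> (x = last p)) \<noteq> (x \<in> {hd p, last p})"
    using odd_card_star_insert[OF finite_path_edges assms(4), of x] odd_card_star_path_edges[OF assms(1,2), of x]
    by simp
  then show "even (card {f \<in> insert {hd p, last p} (path_edges p). x \<in> f})" using assms(3) by auto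
qed

text \<open>Asking for distinct vertices makes every witness a simple path, ready to be drawn as an
  arc or closed to a cycle; \<open>reachable_step\<close> shortens a path at a repeated
  vertex.\<close>

definition reachable :: "'v set set \<Rightarrow> 'v \<Rightarrow> 'v set" where
  "reachable Y u = {x. \<exists>p. p \<noteq> [] \<and> hd p = x \<and> last p = u \<and> distinct p \<and> path_edges p \<subseteq> Y}"

lemma reachable_self: "u \<in> reachable Y u"
  unfolding reachable_def by (intro CollectI exI[of _ "[u]"]) auto

lemma reachable_step:
  assumes x: "x \<in> reachable Y u" and xy: "{y, x} \<in> Y"
  shows "y \<in> reachable Y u"
proof -
  obtain p where p: "p \<noteq> []" "hd p = x" "last p = u" "distinct p" "path_edges p \<subseteq> Y"
    using x by (auto simp: reachable_def)
  show ?thesis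
  proof (cases "y \<in> set p")
    case True
    then obtain q r where q: "p = q @ y # r" by (meson split_list)
    then have "path_edges (y # r) \<subseteq> Y" using p(5) path_edges_append[of y r q] by auto
    then show ?thesis using p q unfolding reachable_def by (intro CollectI exI[of _ "y # r"]) auto
  next
    case False
    obtain p' where "p = x # p'" using p by (cases p) auto
    then show ?thesis using p False xy unfolding reachable_def by (intro CollectI exI[of _ "y # p"]) auto
  qed
qed

lemma reachable_edge:
  assumes "e \<in> Y" "e = {x, y}"
  shows "e \<subseteq> reachable Y u \<or> e \<inter> reachable Y u = {}"
  using assms reachable_step[of x Y u y] reachable_step[of y Y u x] by (auto simp: insert_commute)

text \<open>By the handshake lemma, the component of \<open>u\<close> in \<open>X\<close> minus the edge \<open>uv\<close> contains a second vertex of odd degree.\<close>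

lemma even_set_reachable:
  assumes fin: "finite X" and two: "\<And>e. e \<in> X \<Longrightarrow> \<exists>x y. x \<noteq> y \<and> e = {x, y}"
    and ev: "even_set X" and uv: "{u, v} \<in> X" "u \<noteq> v"
  shows "v \<in> reachable (X - {{u, v}}) u"
proof (rule ccontr)
  let ?Y = "X - {{u, v}}" let ?K = "reachable ?Y u \<inter> \<Union>X"
  assume v: "v \<notin> reachable ?Y u"
  have finK: "finite ?K" using fin two by fastforce
  have uK: "u \<in> ?K" using reachable_self uv by auto
  have "(\<Sum>x\<in>?K. card {e \<in> ?Y. x \<in> e}) = (\<Sum>x\<in>?K. \<Sum>e\<in>?Y. if x \<in> e then 1 else 0)"
    using fin by (simp add: sum.If_cases Int_def conj_commute)
  also have "\<dots> = (\<Sum>e\<in>?Y. \<Sum>x\<in>?K. if x \<in> e then 1 else 0)" by (rule sum.swap)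
  also have "even \<dots>"
  proof (rule dvd_sum)
    fix e assume e: "e \<in> ?Y"
    then have "e \<in> X" by simp
    then obtain x y where xy: "x \<noteq> y" "e = {x, y}" using two by meson
    have "(\<Sum>x\<in>?K. if x \<in> e then 1 else 0) = card (?K \<inter> e)"
      using finK by (simp add: sum.If_cases Int_def)
    also have "?K \<inter> e = {} \<or> ?K \<inter> e = e" using reachable_edge[OF e xy(2), of u] e by blast
    then have "even (card (?K \<inter> e))" using xy by auto
    finally show "2 dvd (\<Sum>x\<in>?K. if x \<in> e then 1 else 0 :: nat)" .
  qed
  finally have "even (\<Sum>x\<in>?K. card {e \<in> ?Y. x \<in> e})" .
  moreover have deg: "odd (card {e \<in> ?Y. x \<in> e}) \<longleftrightarrow> x \<in> {u, v}" for x
  proof -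
    have "insert {u, v} ?Y = X" using uv by auto
    then have "odd (card {f \<in> X. x \<in> f}) \<longleftrightarrow> odd (card {f \<in> ?Y. x \<in> f}) \<noteq> (x \<in> {u, v})"
      using odd_card_star_insert[of ?Y "{u, v}" x] fin by simp
    then show ?thesis using ev unfolding even_set_def by blast
  qed
  have "even (\<Sum>x\<in>?K - {u}. card {e \<in> ?Y. x \<in> e})"
  proof (rule dvd_sum)
    fix x assume "x \<in> ?K - {u}"
    then have "x \<notin> {u, v}" using v by auto
    then show "even (card {e \<in> ?Y. x \<in> e})" using deg by blast
  qed
  then have "odd (\<Sum>x\<in>?K. card {e \<in> ?Y. x \<in> e})"
    using sum.remove[OF finK uK, of "\<lambda>x. card {e \<in> ?Y. x \<in> e}"] deg[of u] by simp
  ultimately show False by simp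
qed

text \<open>A path between the ends of the edge inside the rest of \<open>C\<close>, closed by that
  edge, is an even subset of \<open>C\<close>, so by minimality it is all of
  \<open>C\<close>.\<close>

lemma circuit_minus_edge:
  assumes fin: "finite C" and two: "\<And>e. e \<in> C \<Longrightarrow> \<exists>x y. x \<noteq> y \<and> e = {x, y}"
    and C: "circuit C" and uv: "{u, v} \<in> C" "u \<noteq> v"
  obtains p where "p \<noteq> []" "distinct p" "hd p = v" "last p = u" "path_edges p = C - {{u, v}}"
proof -
  obtain p where p: "p \<noteq> []" "hd p = v" "last p = u" "distinct p" "path_edges p \<subseteq> C - {{u, v}}"
    using even_set_reachable[OF fin two _ uv] C unfolding circuit_def reachable_def by blast
  have "even_set (insert {hd p, last p} (path_edges p))"
    using p uv by (intro even_set_cycle) (auto simp: insert_commute)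
  then have "insert {u, v} (path_edges p) = C"
    using C p uv unfolding circuit_def by (metis insert_commute insert_not_empty insert_subset subset_Diff_insert Diff_subset order_trans)
  then show ?thesis using that[of p] p by blast
qed

text \<open>Take a smallest even subset \<open>D\<close> containing \<open>e\<close>. For an even
  part of \<open>D\<close> without \<open>e\<close>, the complement in \<open>D\<close> is even and
  contains \<open>e\<close>, so the part is empty.\<close>

lemma circuit_through:
  assumes fin: "finite C" and ev: "even_set C" and e: "e \<in> C"
  obtains D where "D \<subseteq> C" "circuit D" "e \<in> D"
proof -
  let ?P = "{D. D \<subseteq> C \<and> even_set D \<and> e \<in> D}"
  have "finite ?P" using fin by simp
  moreover have "C \<in> ?P" using ev e by simp
  ultimately have "\<exists>D\<in>?P. D \<subseteq> C \<and> (\<forall>D'\<in>?P. D' \<subseteq> D \<longrightarrow> D = D')" by (rule finite_has_minimal2)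
  then obtain D where D: "D \<in> ?P" and min: "\<forall>D'\<in>?P. D' \<subseteq> D \<longrightarrow> D = D'" by (elim bexE conjE)
  have "D' = {} \<or> D' = D" if D': "D' \<subseteq> D" "even_set D'" for D'
  proof (cases "e \<in> D'")
    case True
    then show ?thesis using min D' D by auto
  next
    case False
    have fD: "finite D" "finite D'" using D D' fin by (auto intro: finite_subset)
    have "sym_diff D D' = D - D'" using D' by blast
    then have "even_set (D - D')" using even_set_sym_diff[OF fD] D D' by auto
    then have "D - D' \<in> ?P" using D False by auto
    then have "D = D - D'" using min by (metis Diff_subset)
    then show ?thesis using D' by blast
  qed
  then have "circuit D" using D unfolding circuit_def by blast
  then show ?thesis using that D by blast
qed

section \<open>Faces of a plane drawing\<close>

locale plane_graph =
  fixes V :: "'v set" and Es :: "'v set set" and pos :: "'v \<Rightarrow> complex" and \<gamma> :: "'v set \<Rightarrow> real \<Rightarrow> complex"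
  assumes drawing: "plane_drawing V Es pos \<gamma>" and fin: "finite Es"
    and edges: "\<And>e. e \<in> Es \<Longrightarrow> \<exists>x y. x \<noteq> y \<and> e = {x, y}"
    and verts: "\<And>e. e \<in> Es \<Longrightarrow> e \<subseteq> V"
begin

section \<open>Arcs, Jordan curves and separation by drawn edges\<close>

definition image_of :: "'v set set \<Rightarrow> complex set" where
  "image_of X = (\<Union>e\<in>X. path_image (\<gamma> e))"

abbreviation linked :: "'v set set \<Rightarrow> complex \<Rightarrow> complex \<Rightarrow> bool" where
  "linked X \<equiv> connected_component (- image_of X)"

lemma arc_edge: "e \<in> Es \<Longrightarrow> arc (\<gamma> e)"
  and ends_edge: "e \<in> Es \<Longrightarrow> {pathstart (\<gamma> e), pathfinish (\<gamma> e)} = pos ` e"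
  and edge_Int: "e \<in> Es \<Longrightarrow> f \<in> Es \<Longrightarrow> e \<noteq> f \<Longrightarrow> path_image (\<gamma> e) \<inter> path_image (\<gamma> f) = pos ` (e \<inter> f)"
  and edge_verts: "e \<in> Es \<Longrightarrow> path_image (\<gamma> e) \<inter> pos ` V = pos ` e"
  and inj_pos: "inj_on pos V"
  using drawing unfolding plane_drawing_def by blast+

lemma image_of_mono: "X \<subseteq> Y \<Longrightarrow> image_of X \<subseteq> image_of Y"
  by (auto simp: image_of_def)

lemma image_of_insert: "image_of (insert e X) = path_image (\<gamma> e) \<union> image_of X"
  by (auto simp: image_of_def)

lemma image_of_Un: "image_of (X \<union> Y) = image_of X \<union> image_of Y"
  by (auto simp: image_of_def)

lemma compact_image_of: "X \<subseteq> Es \<Longrightarrow> compact (image_of X)"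
  unfolding image_of_def using fin finite_subset arc_edge
  by (intro compact_UN) (auto simp: compact_arc_image)

lemma closed_image_of: "X \<subseteq> Es \<Longrightarrow> closed (image_of X)"
  by (simp add: compact_image_of compact_imp_closed)

lemma linked_mono: "linked X a b \<Longrightarrow> Y \<subseteq> X \<Longrightarrow> linked Y a b"
  using connected_component_of_subset image_of_mono by (metis Compl_anti_mono)

lemma oriented_edge:
  assumes "{x, y} \<in> Es"
  obtains g where "arc g" "pathstart g = pos x" "pathfinish g = pos y" "path_image g = path_image (\<gamma> {x, y})"
proof -
  have "{pathstart (\<gamma> {x, y}), pathfinish (\<gamma> {x, y})} = {pos x, pos y}" using ends_edge[OF assms] by simp
  then consider "pathstart (\<gamma> {x, y}) = pos x" "pathfinish (\<gamma> {x, y}) = pos y"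
    | "pathstart (\<gamma> {x, y}) = pos y" "pathfinish (\<gamma> {x, y}) = pos x" by (auto simp: doubleton_eq_iff)
  then show ?thesis
  proof cases
    case 1
    then show ?thesis using that[of "\<gamma> {x, y}"] arc_edge[OF assms] by blast
  next
    case 2
    then show ?thesis using that[of "reversepath (\<gamma> {x, y})"] arc_edge[OF assms] by (simp add: arc_reversepath)
  qed
qed

lemma edge_in_path_image: "e \<in> Es \<Longrightarrow> pos ` e \<subseteq> path_image (\<gamma> e)"
  using edge_verts by blast

lemma arc_path_edges:
  assumes "distinct p" "2 \<le> length p" "path_edges p \<subseteq> Es"
  shows "\<exists>g. arc g \<and> pathstart g = pos (hd p) \<and> pathfinish g = pos (last p) \<and> path_image g = image_of (path_edges p)"
  using assms
proof (induction p rule: path_edges.induct)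
  case (1 x y p)
  obtain g where g: "arc g" "pathstart g = pos x" "pathfinish g = pos y" "path_image g = path_image (\<gamma> {x, y})"
    using oriented_edge[of x y] 1 by auto
  show ?case
  proof (cases p)
    case Nil
    then show ?thesis using g by (intro exI[of _ g]) (auto simp: image_of_def)
  next
    case (Cons z q)
    then obtain h where h: "arc h" "pathstart h = pos y" "pathfinish h = pos (last (y # p))"
      "path_image h = image_of (path_edges (y # p))" using 1 by auto
    have "path_image g \<inter> path_image h \<subseteq> {pos y}"
    proof
      fix t assume t: "t \<in> path_image g \<inter> path_image h"
      then obtain f where f: "f \<in> path_edges (y # p)" "t \<in> path_image (\<gamma> f)" using h by (auto simp: image_of_def)
      have "x \<notin> f" using path_edges_subset[OF f(1)] 1 by auto
      moreover have "f \<in> Es" "{x, y} \<in> Es" using f 1 by auto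
      ultimately have "t \<in> pos ` ({x, y} \<inter> f)" using edge_Int[of "{x, y}" f] t f g by blast
      then show "t \<in> {pos y}" using \<open>x \<notin> f\<close> by auto
    qed
    then have "arc (g +++ h)" using g h by (intro arc_join) auto
    moreover have "path_image (g +++ h) = image_of (path_edges (x # y # p))"
      using g h by (simp add: path_image_join image_of_insert)
    ultimately show ?thesis using g h by (intro exI[of _ "g +++ h"]) simp
  qed
qed auto

lemma circuit_edge_arc:
  assumes C: "circuit C" "C \<subseteq> Es" and e: "e \<in> C"
  obtains u v g where "e = {u, v}" "u \<noteq> v" "arc g" "pathstart g = pos v" "pathfinish g = pos u"
    "path_image g = image_of (C - {e})"
proof -
  obtain u v where uv: "e = {u, v}" "u \<noteq> v" using edges e C(2) by blast
  have finC: "finite C" using C(2) fin finite_subset by blast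
  obtain p where p: "p \<noteq> []" "distinct p" "hd p = v" "last p = u" "path_edges p = C - {e}"
    using circuit_minus_edge[OF finC _ C(1), of u v] edges C(2) e uv by (metis subsetD)
  have "2 \<le> length p"
  proof (rule ccontr)
    assume "\<not> ?thesis"
    then obtain x where "p = [x]" using p(1) by (cases p rule: path_edges.cases) auto
    then show False using p uv by auto
  qed
  then obtain g where "arc g" "pathstart g = pos (hd p)" "pathfinish g = pos (last p)" "path_image g = image_of (path_edges p)"
    using arc_path_edges[of p] p C(2) by blast
  then show ?thesis using that[OF uv] p by simp
qed

lemma circuit_minus_edge_connected:
  assumes C: "circuit C" "C \<subseteq> Es" and e: "e \<in> C"
  shows "connected (image_of (C - {e}))" "pos ` e \<subseteq> image_of (C - {e})"
proof -
  obtain u v g where g: "e = {u, v}" "arc g" "pathstart g = pos v" "pathfinish g = pos u"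
    "path_image g = image_of (C - {e})" by (rule circuit_edge_arc[OF assms])
  show "connected (image_of (C - {e}))" using connected_arc_image[OF g(2)] g(5) by simp
  have "{pathstart g, pathfinish g} \<subseteq> path_image g" by auto
  then show "pos ` e \<subseteq> image_of (C - {e})" using g by auto
qed

lemma circuit_Jordan:
  assumes C: "circuit C" "C \<subseteq> Es"
  obtains c where "simple_path c" "pathfinish c = pathstart c" "path_image c = image_of C"
proof -
  obtain e where e: "e \<in> C" using C by (auto simp: circuit_def)
  obtain u v g where g: "e = {u, v}" "u \<noteq> v" "arc g" "pathstart g = pos v" "pathfinish g = pos u"
    "path_image g = image_of (C - {e})" by (rule circuit_edge_arc[OF assms e])
  have eE: "{u, v} \<in> Es" using C e g by auto
  obtain h where h: "arc h" "pathstart h = pos u" "pathfinish h = pos v" "path_image h = path_image (\<gamma> e)"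
    using oriented_edge[OF eE] g by metis
  have "path_image h \<inter> path_image g \<subseteq> {pos u, pos v}"
  proof
    fix t assume t: "t \<in> path_image h \<inter> path_image g"
    then obtain f where f: "f \<in> C" "f \<noteq> e" "t \<in> path_image (\<gamma> f)" using g by (auto simp: image_of_def)
    then have "t \<in> pos ` (e \<inter> f)" using edge_Int[of e f] t h C e by blast
    then show "t \<in> {pos u, pos v}" using g by auto
  qed
  then have "simple_path (h +++ g)" using g h by (intro simple_path_join_loop) auto
  moreover have "insert e (C - {e}) = C" using e by auto
  then have "path_image (h +++ g) = image_of C"
    using g h image_of_insert[of e "C - {e}"] by (simp add: path_image_join)
  ultimately show ?thesis using that[of "h +++ g"] g h by simp
qed

lemma circuit_sides:
  assumes "circuit C" "C \<subseteq> Es"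
  shows "open (inside (image_of C))" "connected (inside (image_of C))"
    "open (outside (image_of C))" "connected (outside (image_of C))"
    "inside (image_of C) \<inter> outside (image_of C) = {}"
    "inside (image_of C) \<union> outside (image_of C) = - image_of C"
    "frontier (inside (image_of C)) = image_of C" "frontier (outside (image_of C)) = image_of C"
proof -
  obtain c where c: "simple_path c" "pathfinish c = pathstart c" "path_image c = image_of C"
    by (rule circuit_Jordan[OF assms])
  show "open (inside (image_of C))" "connected (inside (image_of C))"
    "open (outside (image_of C))" "connected (outside (image_of C))"
    "inside (image_of C) \<inter> outside (image_of C) = {}"
    "inside (image_of C) \<union> outside (image_of C) = - image_of C"
    "frontier (inside (image_of C)) = image_of C" "frontier (outside (image_of C)) = image_of C"
    using Jordan_inside_outside[OF c(1,2)] unfolding c(3) by blast+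
qed

lemma linked_circuit_iff:
  assumes C: "circuit C" "C \<subseteq> Es" and ab: "a \<notin> image_of C" "b \<notin> image_of C"
  shows "linked C a b \<longleftrightarrow> (a \<in> inside (image_of C) \<longleftrightarrow> b \<in> inside (image_of C))"
proof
  note S = circuit_sides[OF C]
  assume "linked C a b"
  then obtain T where T: "connected T" "T \<subseteq> - image_of C" "a \<in> T" "b \<in> T"
    by (auto simp: connected_component_def)
  have "inside (image_of C) \<inter> T = {} \<or> outside (image_of C) \<inter> T = {}"
    using connectedD[OF T(1) S(1,3)] S(5,6) T(2) by blast
  then show "a \<in> inside (image_of C) \<longleftrightarrow> b \<in> inside (image_of C)" using S(5,6) T by blast
next
  note S = circuit_sides[OF C]
  assume same: "a \<in> inside (image_of C) \<longleftrightarrow> b \<in> inside (image_of C)"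
  show "linked C a b"
  proof (cases "a \<in> inside (image_of C)")
    case True
    then show ?thesis using same S(2,6) unfolding connected_component_def by blast
  next
    case False
    then have "a \<in> outside (image_of C)" "b \<in> outside (image_of C)" using same S(6) ab by blast+
    then show ?thesis using S(4,6) unfolding connected_component_def by blast
  qed
qed

text \<open>The drawings of \<open>X - {e}\<close> and \<open>C\<close> meet exactly in the arc
  formed by \<open>C - {e}\<close>, which contains the ends of \<open>e\<close>. This intersection
  is connected, as Janiszewski's theorem demands.\<close>

lemma linked_add_circuit:
  assumes C: "circuit C" "C \<subseteq> X" "X \<subseteq> Es" "e \<in> C"
    and ab: "linked (X - {e}) a b" "linked C a b"
  shows "linked X a b"
proof -
  have CE: "C \<subseteq> Es" using C by blast
  have "image_of (X - {e}) \<inter> image_of C = image_of (C - {e})"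
  proof
    show "image_of (X - {e}) \<inter> image_of C \<subseteq> image_of (C - {e})"
    proof
      fix t assume t: "t \<in> image_of (X - {e}) \<inter> image_of C"
      then obtain f g where fg: "f \<in> X" "f \<noteq> e" "t \<in> path_image (\<gamma> f)" "g \<in> C" "t \<in> path_image (\<gamma> g)"
        by (auto simp: image_of_def)
      show "t \<in> image_of (C - {e})"
      proof (cases "g = e")
        case True
        then have "t \<in> pos ` (f \<inter> e)" using edge_Int[of f e] fg C by blast
        then show ?thesis using circuit_minus_edge_connected(2)[OF C(1) CE C(4)] by blast
      next
        case False
        then show ?thesis using fg by (auto simp: image_of_def)
      qed
    qed
    show "image_of (C - {e}) \<subseteq> image_of (X - {e}) \<inter> image_of C"
      using image_of_mono[of "C - {e}" "X - {e}"] image_of_mono[of "C - {e}" C] C by blast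
  qed
  then have "connected (image_of (X - {e}) \<inter> image_of C)"
    using circuit_minus_edge_connected(1)[OF C(1) CE C(4)] by simp
  then have "connected_component (- (image_of (X - {e}) \<union> image_of C)) a b"
    using Janiszewski[OF compact_image_of closed_image_of[OF CE] _ ab] C(3) by blast
  moreover have "(X - {e}) \<union> C = X" using C by blast
  then have "image_of (X - {e}) \<union> image_of C = image_of X" using image_of_Un by metis
  ultimately show ?thesis by simp
qed

text \<open>The ends of \<open>e\<close> are not joined in \<open>X - {e}\<close>, which therefore
  splits into the edges in the component of \<open>u\<close> and the others. Two applications of
  Janiszewski's theorem glue \<open>e\<close> to the second part, then the first part to the result;
  each intersection has at most one point, and \<open>e\<close> alone does not separate the plane
  because it is an arc.\<close>

lemma linked_add_bridge:
  assumes X: "X \<subseteq> Es" "e \<in> X" and br: "\<And>C. C \<subseteq> X \<Longrightarrow> even_set C \<Longrightarrow> e \<notin> C"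
    and ab: "linked (X - {e}) a b" "a \<notin> image_of X" "b \<notin> image_of X"
  shows "linked X a b"
proof -
  obtain u v where uv: "e = {u, v}" "u \<noteq> v" using edges X by blast
  let ?K = "reachable (X - {e}) u"
  have vK: "v \<notin> ?K"
  proof
    assume "v \<in> ?K"
    then obtain p where p: "p \<noteq> []" "hd p = v" "last p = u" "distinct p" "path_edges p \<subseteq> X - {e}"
      by (auto simp: reachable_def)
    have "even_set (insert {hd p, last p} (path_edges p))"
      using p uv by (intro even_set_cycle) (auto simp: insert_commute)
    then show False using br[of "insert {hd p, last p} (path_edges p)"] p uv X by (auto simp: insert_commute)
  qed
  have uK: "u \<in> ?K" by (rule reachable_self)
  define X1 where "X1 = {f \<in> X - {e}. f \<subseteq> ?K}"
  define X2 where "X2 = {f \<in> X - {e}. f \<inter> ?K = {}}"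
  have X12: "X - {e} = X1 \<union> X2"
  proof -
    have "f \<subseteq> ?K \<or> f \<inter> ?K = {}" if f: "f \<in> X - {e}" for f
    proof -
      obtain x y where "f = {x, y}" using edges f X by blast
      then show ?thesis using reachable_edge[OF f] by blast
    qed
    then show ?thesis by (auto simp: X1_def X2_def)
  qed
  have sub: "X1 \<subseteq> Es" "X2 \<subseteq> Es" "insert e X2 \<subseteq> Es" using X by (auto simp: X1_def X2_def)
  have eE: "e \<in> Es" using X by blast
  have small: "connected T" if "T \<subseteq> {t}" for T :: "complex set" and t
    using that by (metis connected_empty connected_sing subset_singletonD)
  have l2: "linked (insert e X2) a b"
  proof -
    have "path_image (\<gamma> e) \<inter> image_of X2 \<subseteq> {pos v}"
    proof
      fix t assume t: "t \<in> path_image (\<gamma> e) \<inter> image_of X2"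
      then obtain f where f: "f \<in> X2" "t \<in> path_image (\<gamma> f)" by (auto simp: image_of_def)
      then have "f \<noteq> e" "f \<in> Es" "u \<notin> f" using uK X by (auto simp: X2_def)
      then have "t \<in> pos ` (e \<inter> f)" using edge_Int[OF eE, of f] t f by blast
      then show "t \<in> {pos v}" using uv \<open>u \<notin> f\<close> by auto
    qed
    moreover have "connected_component (- path_image (\<gamma> e)) a b"
    proof -
      have "connected (- path_image (\<gamma> e))" using connected_arc_complement[OF arc_edge[OF eE]] by simp
      moreover have "a \<notin> path_image (\<gamma> e)" "b \<notin> path_image (\<gamma> e)" using ab X by (auto simp: image_of_def)
      ultimately show ?thesis unfolding connected_component_def by blast
    qed
    moreover have "linked X2 a b" using linked_mono[OF ab(1)] X12 by blast
    ultimately show ?thesis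
      using Janiszewski[OF compact_arc_image[OF arc_edge[OF eE]] closed_image_of[OF sub(2)] small]
      by (simp add: image_of_insert)
  qed
  have "image_of X1 \<inter> image_of (insert e X2) \<subseteq> {pos u}"
  proof
    fix t assume t: "t \<in> image_of X1 \<inter> image_of (insert e X2)"
    then obtain f g where fg: "f \<in> X1" "t \<in> path_image (\<gamma> f)" "g \<in> insert e X2" "t \<in> path_image (\<gamma> g)"
      by (auto simp: image_of_def)
    have f: "f \<in> Es" "f \<noteq> e" "f \<subseteq> ?K" using fg X by (auto simp: X1_def)
    have edges_f: "f \<noteq> {}" using edges[OF f(1)] by blast
    have "f \<noteq> g" "g \<in> Es" using fg f sub edges_f by (auto simp: X2_def)
    then have "t \<in> pos ` (f \<inter> g)" using edge_Int[OF f(1), of g] fg by blast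
    then show "t \<in> {pos u}" using fg f uv vK by (auto simp: X2_def)
  qed
  moreover have "linked X1 a b" using linked_mono[OF ab(1)] X12 by blast
  ultimately have "connected_component (- (image_of X1 \<union> image_of (insert e X2))) a b"
    using Janiszewski[OF compact_image_of[OF sub(1)] closed_image_of[OF sub(3)] small _ l2] by blast
  moreover have "X1 \<union> insert e X2 = X" using X12 X(2) by blast
  ultimately show ?thesis using image_of_Un by metis
qed

end

lemma components_eq: "W \<in> components S \<Longrightarrow> a \<in> W \<Longrightarrow> W = connected_component_set S a"
  unfolding components_iff by (metis connected_component_eq)

context plane_graph
begin

section \<open>Counting faces and attaching them to edges\<close>

abbreviation faces :: "'v set set \<Rightarrow> complex set set" where
  "faces X \<equiv> components (- image_of X)"

lemma faceE:
  assumes "W \<in> faces X" obtains a where "a \<in> W" "a \<notin> image_of X"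
  using assms in_components_nonempty in_components_subset by blast

lemma face_disjoint: "W \<in> faces X \<Longrightarrow> a \<in> W \<Longrightarrow> a \<notin> image_of X"
  using in_components_subset by blast

lemma face_linked: "W \<in> faces X \<Longrightarrow> a \<in> W \<Longrightarrow> b \<in> W \<longleftrightarrow> linked X a b"
  using components_eq by blast

lemma face_eqI: "W \<in> faces X \<Longrightarrow> W' \<in> faces X \<Longrightarrow> a \<in> W \<Longrightarrow> b \<in> W' \<Longrightarrow> linked X a b \<Longrightarrow> W = W'"
  using components_eq by (metis connected_component_eq mem_Collect_eq)

definition cycle_space :: "'v set set \<Rightarrow> 'v set set set" where
  "cycle_space X = {C. C \<subseteq> X \<and> even_set C}"

lemma interior_points:
  assumes e: "e \<in> Es"
  shows "path_image (\<gamma> e) - pos ` e \<noteq> {}" "connected (path_image (\<gamma> e) - pos ` e)"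
    "X \<subseteq> Es \<Longrightarrow> e \<notin> X \<Longrightarrow> (path_image (\<gamma> e) - pos ` e) \<inter> image_of X = {}"
proof -
  have a: "simple_path (\<gamma> e)" using arc_edge[OF e] arc_imp_simple_path by blast
  show "path_image (\<gamma> e) - pos ` e \<noteq> {}"
    using simple_path_endless[OF a] ends_edge[OF e] by auto
  show "connected (path_image (\<gamma> e) - pos ` e)"
    using connected_simple_path_endless[OF a] ends_edge[OF e] by simp
  show "(path_image (\<gamma> e) - pos ` e) \<inter> image_of X = {}" if X: "X \<subseteq> Es" "e \<notin> X"
  proof -
    have False if t: "t \<in> path_image (\<gamma> e)" "t \<notin> pos ` e" "f \<in> X" "t \<in> path_image (\<gamma> f)" for t f
    proof -
      have "t \<in> pos ` (e \<inter> f)" using edge_Int[OF e, of f] t X by blast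
      then show False using t(2) by blast
    qed
    then show ?thesis by (auto simp: image_of_def)
  qed
qed

lemma linked_interior:
  assumes "e \<in> Es" "X \<subseteq> Es" "e \<notin> X" "s \<in> path_image (\<gamma> e) - pos ` e" "t \<in> path_image (\<gamma> e) - pos ` e"
  shows "linked X s t"
  using interior_points[OF assms(1)] assms unfolding connected_component_def by blast

text \<open>A connected set going from the inside to the outside of \<open>C\<close> without
  touching \<open>X\<close> must hit \<open>C\<close> in an interior point of \<open>e\<close>,
  since the ends of \<open>e\<close> lie on \<open>C - {e}\<close>. So only the old face containing
  the interior of \<open>e\<close> can be split by \<open>e\<close>.\<close>

lemma crossing_edge:
  assumes C: "circuit C" "C \<subseteq> insert e X" "insert e X \<subseteq> Es" "e \<notin> X"
    and ab: "linked X a b" "a \<in> inside (image_of C)" "b \<in> outside (image_of C)"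
    and t: "t \<in> path_image (\<gamma> e) - pos ` e"
  shows "linked X a t"
proof -
  have CE: "C \<subseteq> Es" using C by blast
  note S = circuit_sides[OF C(1) CE]
  obtain T where T: "connected T" "T \<subseteq> - image_of X" "a \<in> T" "b \<in> T"
    using ab(1) by (auto simp: connected_component_def)
  have "T \<inter> image_of C \<noteq> {}"
    using connectedD[OF T(1) S(1,3)] S(5,6) T ab by blast
  then obtain s where s: "s \<in> T" "s \<in> image_of C" by blast
  then obtain f where f: "f \<in> C" "s \<in> path_image (\<gamma> f)" by (auto simp: image_of_def)
  have "f \<notin> X" using f s T by (auto simp: image_of_def)
  then have fe: "f = e" "e \<in> C" using f C by auto
  have "pos ` e \<subseteq> image_of X"
    using circuit_minus_edge_connected(2)[OF C(1) CE fe(2)] image_of_mono[of "C - {e}" X] C by blast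
  then have "s \<in> path_image (\<gamma> e) - pos ` e" using s f fe T by blast
  then have "linked X s t" using linked_interior[of e X s t] C t by blast
  moreover have "linked X a s" using T s unfolding connected_component_def by blast
  ultimately show ?thesis using connected_component_trans by metis
qed

text \<open>A bridge creates no face. Any other edge adds at most one face and at least doubles the
  cycle space. The factor two records that the empty graph already has one face.\<close>

lemma card_faces:
  assumes "X \<subseteq> Es"
  shows "finite (faces X) \<and> 2 ^ card (faces X) \<le> 2 * card (cycle_space X)"
proof -
  have "finite X" using assms fin finite_subset by blast
  then show ?thesis using assms
  proof (induction X)
    case empty
    have "components (UNIV :: complex set) = {UNIV}" by (simp add: components_eq_sing_iff)
    moreover have "cycle_space {} = {{}}" by (auto simp: cycle_space_def even_set_def)
    ultimately show ?case by (simp add: image_of_def)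
  next
    case (insert e X)
    let ?X = "insert e X"
    have IH: "finite (faces X)" "2 ^ card (faces X) \<le> 2 * card (cycle_space X)" using insert by auto
    have X: "?X \<subseteq> Es" "e \<in> Es" "X \<subseteq> Es" "?X - {e} = X" using insert by auto
    have finZ: "finite (cycle_space ?X)" "finite (cycle_space X)"
      using insert.hyps(1) by (auto simp: cycle_space_def)
    define rep where "rep W = (SOME a. a \<in> W)" for W :: "complex set"
    have rep: "rep W \<in> W" if "W \<in> faces ?X" for W
      using faceE[OF that] someI_ex[of "\<lambda>a. a \<in> W"] unfolding rep_def by blast
    have rep_out: "rep W \<notin> image_of ?X" "rep W \<notin> image_of X" if "W \<in> faces ?X" for W
      using face_disjoint[OF that rep[OF that]] image_of_mono[of X ?X] by blast+
    define \<kappa> where "\<kappa> W = connected_component_set (- image_of X) (rep W)" for W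
    have \<kappa>: "\<kappa> W \<in> faces X" if "W \<in> faces ?X" for W
      unfolding \<kappa>_def using rep_out(2)[OF that] by (intro componentsI) simp
    have \<kappa>_eq: "linked X (rep W) (rep W')" if "W \<in> faces ?X" "W' \<in> faces ?X" "\<kappa> W = \<kappa> W'" for W W'
      using that rep_out unfolding \<kappa>_def
      by (metis ComplI connected_component_refl_eq mem_Collect_eq)
    have sub: "cycle_space X \<subseteq> cycle_space ?X" by (auto simp: cycle_space_def)
    show ?case
    proof (cases "\<exists>C\<subseteq>?X. even_set C \<and> e \<in> C")
      case False
      have inj: "inj_on \<kappa> (faces ?X)"
      proof (rule inj_onI)
        fix W W' assume W: "W \<in> faces ?X" "W' \<in> faces ?X" "\<kappa> W = \<kappa> W'"
        have "linked ?X (rep W) (rep W')"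
          using \<kappa>_eq[OF W] rep_out W X False by (intro linked_add_bridge[of ?X e]) auto
        then show "W = W'" using face_eqI[OF W(1,2) rep rep] W by blast
      qed
      have im: "\<kappa> ` faces ?X \<subseteq> faces X" using \<kappa> by blast
      have "finite (faces ?X)" using inj_on_finite[OF inj im IH(1)] .
      moreover have "card (faces ?X) \<le> card (faces X)" by (rule card_inj_on_le[OF inj im IH(1)])
      then have "(2::nat) ^ card (faces ?X) \<le> 2 ^ card (faces X)" by (intro power_increasing) auto
      moreover have "card (cycle_space X) \<le> card (cycle_space ?X)" by (rule card_mono[OF finZ(1) sub])
      ultimately show ?thesis using IH(2) by linarith
    next
      case True
      then obtain C where C: "circuit C" "C \<subseteq> ?X" "e \<in> C"
        using circuit_through insert.hyps(1) by (metis finite.insertI finite_subset order_trans)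
      have CE: "C \<subseteq> Es" using C X by blast
      note S = circuit_sides[OF C(1) CE]
      obtain t where t: "t \<in> path_image (\<gamma> e) - pos ` e" using interior_points(1)[OF X(2)] by blast
      define Q where "Q = connected_component_set (- image_of X) t"
      have outC: "rep W \<notin> image_of C" if "W \<in> faces ?X" for W
        using rep_out(1)[OF that] image_of_mono[OF C(2)] by blast
      \<comment> \<open>New faces in one old face and on the same side of \<open>C\<close> coincide.
        If they lie on different sides, the old face is \<open>Q\<close>; the extra value
        \<open>None\<close> is reserved for its part inside \<open>C\<close>.\<close>
      define \<mu> where "\<mu> W = (if \<kappa> W = Q \<and> rep W \<in> inside (image_of C) then None else Some (\<kappa> W))" for W
      have inj: "inj_on \<mu> (faces ?X)"
      proof (rule inj_onI)
        fix W W' assume W: "W \<in> faces ?X" "W' \<in> faces ?X" "\<mu> W = \<mu> W'"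
        have \<kappa>W: "\<kappa> W = \<kappa> W'" using W(3) by (auto simp: \<mu>_def split: if_splits)
        note L = \<kappa>_eq[OF W(1,2) \<kappa>W]
        have crossQ: "\<kappa> U = Q" if U: "U \<in> faces ?X" "rep U \<in> inside (image_of C)" 
          "U' \<in> faces ?X" "rep U' \<notin> inside (image_of C)" "linked X (rep U) (rep U')" for U U'
        proof -
          have "rep U' \<in> outside (image_of C)" using U outC[OF U(3)] S(6) by blast
          then have "linked X (rep U) t" using crossing_edge[OF C(1,2) X(1) insert.hyps(2) U(5,2)] t by blast
          then show ?thesis unfolding \<kappa>_def Q_def by (metis connected_component_eq mem_Collect_eq)
        qed
        have "rep W \<in> inside (image_of C) \<longleftrightarrow> rep W' \<in> inside (image_of C)"
        proof (rule ccontr)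
          assume "\<not> ?thesis"
          then consider "rep W \<in> inside (image_of C)" "rep W' \<notin> inside (image_of C)"
            | "rep W' \<in> inside (image_of C)" "rep W \<notin> inside (image_of C)" by blast
          then show False
          proof cases
            case 1
            then show ?thesis using crossQ[OF W(1) _ W(2) _ L] W(3) by (simp add: \<mu>_def)
          next
            case 2
            have "linked X (rep W') (rep W)" using L by (rule connected_component_sym)
            then show ?thesis using crossQ[OF W(2) _ W(1)] 2 W(3) by (simp add: \<mu>_def)
          qed
        qed
        then have "linked C (rep W) (rep W')" using linked_circuit_iff[OF C(1) CE outC[OF W(1)] outC[OF W(2)]] by blast
        then have "linked ?X (rep W) (rep W')"
          using linked_add_circuit[OF C(1,2) X(1) C(3)] L X(4) by simp
        then show "W = W'" using face_eqI[OF W(1,2) rep rep] W by blast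
      qed
      have im: "\<mu> ` faces ?X \<subseteq> insert None (Some ` faces X)" using \<kappa> by (auto simp: \<mu>_def)
      have finQ: "finite (insert None (Some ` faces X))" using IH by simp
      have fP: "finite (faces ?X)" using inj_on_finite[OF inj im finQ] .
      have "card (faces ?X) \<le> card (insert None (Some ` faces X))" by (rule card_inj_on_le[OF inj im finQ])
      also have "\<dots> = Suc (card (faces X))" using IH by (simp add: card_image)
      finally have "(2::nat) ^ card (faces ?X) \<le> 2 ^ Suc (card (faces X))" by (intro power_increasing) auto
      moreover have "2 * card (cycle_space X) \<le> card (cycle_space ?X)"
      proof -
        have finC: "finite C" using CE fin finite_subset by blast
        \<comment> \<open>Adding \<open>C\<close> gives as many further even sets, all of which
          contain \<open>e\<close>.\<close>
        let ?T = "(\<lambda>D. sym_diff D C) ` cycle_space X"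
        have "inj_on (\<lambda>D. sym_diff D C) (cycle_space X)" by (rule inj_onI) blast
        then have "card ?T = card (cycle_space X)" by (rule card_image)
        moreover have "cycle_space X \<inter> ?T = {}" using C(3) insert.hyps(2) by (auto simp: cycle_space_def)
        ultimately have "card (cycle_space X \<union> ?T) = 2 * card (cycle_space X)"
          using finZ by (simp add: card_Un_disjoint)
        moreover have "?T \<subseteq> cycle_space ?X"
        proof
          fix D' assume "D' \<in> ?T"
          then obtain D where D: "D \<subseteq> X" "even_set D" "D' = sym_diff D C" by (auto simp: cycle_space_def)
          have "finite D" using D(1) insert.hyps(1) finite_subset by blast
          then have "even_set D'" using even_set_sym_diff[OF _ finC] D C(1) by (auto simp: circuit_def)
          then show "D' \<in> cycle_space ?X" using D C(2) by (auto simp: cycle_space_def)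
        qed
        then have "card (cycle_space X \<union> ?T) \<le> card (cycle_space ?X)"
          using sub by (intro card_mono[OF finZ(1)]) blast
        ultimately show ?thesis by simp
      qed
      ultimately show ?thesis using IH(2) fP by simp
    qed
  qed
qed

text \<open>An arbitrary arc has no local two-sided picture. Instead, the Jordan curve is the
  frontier of both its sides, so each side has points in a ball that avoids all other edges.\<close>

lemma near_edge:
  assumes C: "circuit C" "C \<subseteq> Es" "e \<in> C" and y: "y \<in> path_image (\<gamma> e) - pos ` e"
    and U: "open U" "y \<in> U"
    and s: "s = inside (image_of C) \<or> s = outside (image_of C)"
  obtains a where "a \<in> U" "a \<in> s" "a \<notin> image_of Es" "linked (Es - {e}) y a"
proof -
  have eE: "e \<in> Es" using C by blast
  note S = circuit_sides[OF C(1,2)]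
  have "y \<notin> image_of (Es - {e})" using interior_points(3)[OF eE, of "Es - {e}"] y by blast
  moreover have "open (- image_of (Es - {e}))" using closed_image_of[of "Es - {e}"] by auto
  ultimately have "open (U \<inter> - image_of (Es - {e}))" "y \<in> U \<inter> - image_of (Es - {e})" using U by auto
  then obtain d where d: "0 < d" "ball y d \<subseteq> U \<inter> - image_of (Es - {e})"
    using open_contains_ball by blast
  have yC: "y \<in> image_of C" using y C by (auto simp: image_of_def)
  then have "y \<in> closure s" using S(7,8) s by (auto simp: frontier_def)
  then obtain a where a: "a \<in> s" "a \<in> ball y d"
    using d(1) by (metis closure_approachable dist_commute mem_ball)
  have "a \<notin> image_of C" using a(1) s S(6) by blast
  then have "a \<notin> path_image (\<gamma> e)" using C by (auto simp: image_of_def)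
  moreover have "a \<notin> image_of (Es - {e})" using a(2) d(2) by blast
  ultimately have "a \<notin> image_of Es" by (auto simp: image_of_def)
  moreover have "linked (Es - {e}) y a"
    unfolding connected_component_def using d a by (intro exI[of _ "ball y d"]) auto
  ultimately show ?thesis using that a d(2) by blast
qed

text \<open>Points close to \<open>e\<close> on one side of \<open>C\<close> are linked off the
  other edges, through the interior of \<open>e\<close>, and also off \<open>C\<close>. By
  \<open>linked_add_circuit\<close> they share a face, which therefore accompanies \<open>e\<close>
  along its whole length.\<close>

lemma edge_sides:
  assumes C: "circuit C" "C \<subseteq> Es" "e \<in> C"
  shows "\<exists>l\<in>faces Es. \<exists>r\<in>faces Es. l \<noteq> r \<and>
    (\<forall>y U. y \<in> path_image (\<gamma> e) - pos ` e \<and> open U \<and> y \<in> U \<longrightarrow> U \<inter> l \<noteq> {} \<and> U \<inter> r \<noteq> {})"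
proof -
  have eE: "e \<in> Es" using C by blast
  obtain y0 where y0: "y0 \<in> path_image (\<gamma> e) - pos ` e" using interior_points(1)[OF eE] by blast
  have one: "\<exists>l\<in>faces Es. l \<inter> s \<noteq> {} \<and>
      (\<forall>y U. y \<in> path_image (\<gamma> e) - pos ` e \<and> open U \<and> y \<in> U \<longrightarrow> U \<inter> l \<noteq> {})"
    if s: "s = inside (image_of C) \<or> s = outside (image_of C)" for s
  proof -
    obtain a0 where a0: "a0 \<in> s" "a0 \<notin> image_of Es" "linked (Es - {e}) y0 a0"
      by (rule near_edge[OF C y0 open_UNIV UNIV_I s])
    let ?l = "connected_component_set (- image_of Es) a0"
    have "U \<inter> ?l \<noteq> {}" if y: "y \<in> path_image (\<gamma> e) - pos ` e" "open U" "y \<in> U" for y U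
    proof -
      obtain a where a: "a \<in> U" "a \<in> s" "a \<notin> image_of Es" "linked (Es - {e}) y a"
        by (rule near_edge[OF C y s])
      have "linked (Es - {e}) y0 y" using linked_interior[OF eE _ _ y0 y(1)] by blast
      then have L: "linked (Es - {e}) a0 a"
        using a0(3) a(4) by (meson connected_component_sym connected_component_trans)
      have "a0 \<notin> image_of C" "a \<notin> image_of C" using a0 a image_of_mono[OF C(2)] by blast+
      moreover have "a0 \<in> inside (image_of C) \<longleftrightarrow> a \<in> inside (image_of C)"
        using s a0(1) a(2) circuit_sides(5)[OF C(1,2)] by blast
      ultimately have "linked C a0 a" using linked_circuit_iff[OF C(1,2)] by blast
      then have "linked Es a0 a" using linked_add_circuit[OF C(1,2) order_refl C(3) L] by blast
      then show ?thesis using a(1) by blast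
    qed
    moreover have "?l \<in> faces Es" using a0(2) by (intro componentsI) simp
    moreover have "a0 \<in> ?l" using a0(2) by simp
    ultimately show ?thesis using a0(1) by (intro bexI[of _ ?l]) blast+
  qed
  from one[of "inside (image_of C)"] obtain l where l: "l \<in> faces Es" "l \<inter> inside (image_of C) \<noteq> {}"
    "\<forall>y U. y \<in> path_image (\<gamma> e) - pos ` e \<and> open U \<and> y \<in> U \<longrightarrow> U \<inter> l \<noteq> {}" by blast
  from one[of "outside (image_of C)"] obtain r where r: "r \<in> faces Es" "r \<inter> outside (image_of C) \<noteq> {}"
    "\<forall>y U. y \<in> path_image (\<gamma> e) - pos ` e \<and> open U \<and> y \<in> U \<longrightarrow> U \<inter> r \<noteq> {}" by blast
  have "l \<noteq> r"
  proof
    assume lr: "l = r"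
    obtain a b where ab: "a \<in> l" "a \<in> inside (image_of C)" "b \<in> l" "b \<in> outside (image_of C)"
      using l r lr by blast
    have "linked Es a b" using face_linked[OF l(1) ab(1)] ab(3) by blast
    then have "linked C a b" by (rule linked_mono[OF _ C(2)])
    then show False
      using linked_circuit_iff[OF C(1,2), of a b] ab face_disjoint[OF l(1)] image_of_mono[OF C(2)]
        circuit_sides(5)[OF C(1,2)] by blast
  qed
  then have "l \<noteq> r \<and> (\<forall>y U. y \<in> path_image (\<gamma> e) - pos ` e \<and> open U \<and> y \<in> U \<longrightarrow> U \<inter> l \<noteq> {} \<and> U \<inter> r \<noteq> {})"
    using l(3) r(3) by auto
  then show ?thesis by - (rule bexI[OF _ l(1)], rule bexI[OF _ r(1)])
qed

lemma face_side:
  assumes C: "circuit C" "C \<subseteq> Es" and W: "W \<in> faces Es" "a \<in> W"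
  shows "W \<subseteq> inside (image_of C) \<longleftrightarrow> a \<in> inside (image_of C)"
proof
  assume a: "a \<in> inside (image_of C)"
  show "W \<subseteq> inside (image_of C)"
  proof
    fix b assume b: "b \<in> W"
    have "linked C a b" using face_linked[OF W] b linked_mono[OF _ C(2)] by blast
    then show "b \<in> inside (image_of C)"
      using linked_circuit_iff[OF C] a face_disjoint[OF W(1)] W(2) b image_of_mono[OF C(2)] by blast
  qed
qed (use W in blast)

lemma same_side:
  assumes C: "circuit C" "C \<subseteq> Es" and W: "W \<in> faces Es" "W' \<in> faces Es"
    and U: "connected U" "U \<inter> image_of C = {}" "U \<inter> W \<noteq> {}" "U \<inter> W' \<noteq> {}"
  shows "W \<subseteq> inside (image_of C) \<longleftrightarrow> W' \<subseteq> inside (image_of C)"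
proof -
  obtain a b where ab: "a \<in> U" "a \<in> W" "b \<in> U" "b \<in> W'" using U by blast
  have "linked C a b" unfolding connected_component_def using U ab by (intro exI[of _ U]) auto
  then show ?thesis
    using linked_circuit_iff[OF C, of a b] face_side[OF C W(1) ab(2)] face_side[OF C W(2) ab(4)] U(2) ab by blast
qed

text \<open>For an edge off \<open>C\<close> with two faces, both meet a small ball that misses
  \<open>C\<close>, so they are on one side. For an edge of \<open>C\<close>, its two faces are
  linked without that edge but not with it, so \<open>C\<close> must separate them. Edges with equal
  faces lie on no circuit.\<close>

lemma circuit_face_boundary:
  assumes C: "circuit C" "C \<subseteq> Es"
    and lr: "\<And>e. e \<in> Es \<Longrightarrow> l e \<in> faces Es \<and> r e \<in> faces Es"
    and loop: "\<And>e D. e \<in> Es \<Longrightarrow> l e = r e \<Longrightarrow> circuit D \<Longrightarrow> D \<subseteq> Es \<Longrightarrow> e \<notin> D"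
    and touch: "\<And>e y U. e \<in> Es \<Longrightarrow> l e \<noteq> r e \<Longrightarrow> y \<in> path_image (\<gamma> e) - pos ` e \<Longrightarrow> open U \<Longrightarrow> y \<in> U \<Longrightarrow>
      U \<inter> l e \<noteq> {} \<and> U \<inter> r e \<noteq> {}"
  shows "C = face_boundary Es l r {W \<in> faces Es. W \<subseteq> inside (image_of C)}"
proof -
  have "e \<in> C \<longleftrightarrow> (l e \<subseteq> inside (image_of C)) \<noteq> (r e \<subseteq> inside (image_of C))" if e: "e \<in> Es" for e
  proof (cases "l e = r e")
    case True
    then show ?thesis using loop[OF e True C] by simp
  next
    case False
    obtain y where y: "y \<in> path_image (\<gamma> e) - pos ` e" using interior_points(1)[OF e] by blast
    have "y \<notin> image_of (Es - {e})" using interior_points(3)[OF e, of "Es - {e}"] y by blast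
    moreover have "open (- image_of (Es - {e}))" using closed_image_of[of "Es - {e}"] by auto
    ultimately obtain d where d: "0 < d" "ball y d \<subseteq> - image_of (Es - {e})"
      using open_contains_ball by (metis ComplI)
    have t: "ball y d \<inter> l e \<noteq> {}" "ball y d \<inter> r e \<noteq> {}" using touch[OF e False y, of "ball y d"] d(1) by auto
    show ?thesis
    proof (cases "e \<in> C")
      case nC: False
      then have "image_of C \<subseteq> image_of (Es - {e})" using C(2) by (intro image_of_mono) blast
      then have "ball y d \<inter> image_of C = {}" using d(2) by blast
      then show ?thesis using same_side[OF C _ _ connected_ball _ t] lr[OF e] nC by blast
    next
      case eC: True
      obtain a b where ab: "a \<in> ball y d" "a \<in> l e" "b \<in> ball y d" "b \<in> r e" using t by blast
      have L: "linked (Es - {e}) a b"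
        unfolding connected_component_def using d ab by (intro exI[of _ "ball y d"]) auto
      have "\<not> linked C a b"
        using linked_add_circuit[OF C order_refl eC L] face_eqI[of "l e" Es "r e" a b] lr[OF e] ab False by blast
      moreover have "a \<notin> image_of C" "b \<notin> image_of C"
        using face_disjoint[of _ Es] lr[OF e] ab image_of_mono[OF C(2)] by blast+
      ultimately have "(a \<in> inside (image_of C)) \<noteq> (b \<in> inside (image_of C))"
        using linked_circuit_iff[OF C] by blast
      moreover have "l e \<subseteq> inside (image_of C) \<longleftrightarrow> a \<in> inside (image_of C)"
        "r e \<subseteq> inside (image_of C) \<longleftrightarrow> b \<in> inside (image_of C)"
        using face_side[OF C] lr[OF e] ab by blast+
      ultimately show ?thesis using eC by blast
    qed
  qed
  then show ?thesis using lr C(2) unfolding face_boundary_def by blast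
qed

text \<open>Circuits are peeled off and their inside regions added modulo two. The separation clause
  is kept for outer vertices: a difference in the summed region comes from a single circuit within
  \<open>C\<close>.\<close>

lemma even_set_face_boundary:
  assumes ci: "\<And>C. circuit C \<Longrightarrow> C \<subseteq> Es \<Longrightarrow> C = face_boundary Es l r {W \<in> faces Es. W \<subseteq> inside (image_of C)}"
    and C: "C \<subseteq> Es" "even_set C"
  shows "\<exists>S\<subseteq>faces Es. C = face_boundary Es l r S \<and> (\<forall>W\<in>faces Es. \<forall>W'\<in>faces Es. (W \<in> S) \<noteq> (W' \<in> S) \<longrightarrow>
    (\<exists>D\<subseteq>C. circuit D \<and> (W \<subseteq> inside (image_of D)) \<noteq> (W' \<subseteq> inside (image_of D))))"
  using C
proof (induction "card C" arbitrary: C rule: less_induct)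
  case less
  have finC: "finite C" using less.prems fin finite_subset by blast
  show ?case
  proof (cases "C = {}")
    case True
    then show ?thesis by (intro exI[of _ "{}"]) (auto simp: face_boundary_def)
  next
    case False
    then obtain e where e: "e \<in> C" by blast
    obtain D where D: "D \<subseteq> C" "circuit D" "e \<in> D" by (rule circuit_through[OF finC less.prems(2) e])
    have finD: "finite D" using D finC finite_subset by blast
    have sd: "sym_diff C D = C - D" using D by blast
    have "even_set D" using D by (simp add: circuit_def)
    then have ev: "even_set (C - D)" using even_set_sym_diff[OF finC finD less.prems(2)] sd by simp
    have "card (C - D) < card C" using D e finC by (intro psubset_card_mono) auto
    from less.hyps[OF this _ ev] less.prems(1)
    obtain S where S: "S \<subseteq> faces Es" "C - D = face_boundary Es l r S" and
      sep: "\<forall>W\<in>faces Es. \<forall>W'\<in>faces Es. (W \<in> S) \<noteq> (W' \<in> S) \<longrightarrow>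
        (\<exists>D'\<subseteq>C - D. circuit D' \<and> (W \<subseteq> inside (image_of D')) \<noteq> (W' \<subseteq> inside (image_of D')))" by blast
    let ?T = "{W \<in> faces Es. W \<subseteq> inside (image_of D)}"
    have DE: "D \<subseteq> Es" using D less.prems(1) by blast
    have "C = sym_diff (C - D) D" using D by blast
    also have "\<dots> = face_boundary Es l r (sym_diff S ?T)"
      unfolding face_boundary_sym_diff S(2)[symmetric] ci[OF D(2) DE, symmetric] by simp
    finally have "C = face_boundary Es l r (sym_diff S ?T)" .
    moreover have "\<exists>D'\<subseteq>C. circuit D' \<and> (W \<subseteq> inside (image_of D')) \<noteq> (W' \<subseteq> inside (image_of D'))"
      if W: "W \<in> faces Es" "W' \<in> faces Es" "(W \<in> sym_diff S ?T) \<noteq> (W' \<in> sym_diff S ?T)" for W W'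
    proof (cases "(W \<in> S) = (W' \<in> S)")
      case True
      then have "(W \<subseteq> inside (image_of D)) \<noteq> (W' \<subseteq> inside (image_of D))" using W by blast
      then show ?thesis using D by blast
    next
      case False
      then obtain D' where "D' \<subseteq> C - D" "circuit D'"
        "(W \<subseteq> inside (image_of D')) \<noteq> (W' \<subseteq> inside (image_of D'))" using sep W by meson
      then show ?thesis by (intro exI[of _ D']) auto
    qed
    moreover have "sym_diff S ?T \<subseteq> faces Es" using S(1) by blast
    ultimately show ?thesis by (intro exI[of _ "sym_diff S ?T"]) meson
  qed
qed

lemma outside_face: "outside (image_of Es) \<in> faces Es"
proof -
  have b: "bounded (image_of Es)" using compact_image_of[of Es] compact_imp_bounded by blast
  have "connected (outside (image_of Es))" using connected_outside[OF b] by simp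
  moreover have "outside (image_of Es) \<noteq> {}" using outside_bounded_nonempty[OF b] .
  ultimately show ?thesis by (simp add: outside_in_components)
qed

lemma interior_point_near_vertex:
  assumes e: "e \<in> Es" "x \<in> e" and U: "open U" "pos x \<in> U"
  obtains y where "y \<in> U" "y \<in> path_image (\<gamma> e) - pos ` e"
proof -
  obtain x' where x': "e = {x, x'}" "x' \<noteq> x" using edges[OF e(1)] e(2) by blast
  have ne: "pos x' \<noteq> pos x" using inj_pos verts[OF e(1)] x' unfolding inj_on_def by blast
  have sub: "{pos x, pos x'} \<subseteq> path_image (\<gamma> e)" using edge_in_path_image[OF e(1)] x' by simp
  have "connected (path_image (\<gamma> e))" using arc_edge[OF e(1)] connected_arc_image by blast
  moreover have "\<nexists>a. path_image (\<gamma> e) = {a}" using sub ne by auto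
  ultimately have lim: "pos x islimpt path_image (\<gamma> e)" using connected_imp_perfect sub by blast
  have "open (U - {pos x'})" "pos x \<in> U - {pos x'}" using U ne by (auto intro: open_delete)
  then have "\<exists>y\<in>path_image (\<gamma> e). y \<in> U - {pos x'} \<and> y \<noteq> pos x"
    using lim[unfolded islimpt_def, rule_format, of "U - {pos x'}"] by simp
  then obtain y where "y \<in> path_image (\<gamma> e)" "y \<in> U - {pos x'}" "y \<noteq> pos x" by (elim bexE conjE)
  then show ?thesis using that x' by auto
qed

text \<open>Besides the count, the outer clause is proved as follows: if \<open>l e\<close> were in
  \<open>S\<close>, some circuit in the boundary of \<open>S\<close> would separate it from
  \<open>z\<close>. That circuit misses \<open>x\<close>, so a small ball around
  \<open>pos x\<close> misses it too while meeting both faces, which puts them on the same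
  side.\<close>

theorem dual_of_drawing:
  obtains l r where "\<And>e. e \<in> Es \<Longrightarrow> l e \<in> faces Es \<and> r e \<in> faces Es" "finite (faces Es)"
    "\<And>C. C \<subseteq> Es \<Longrightarrow> even_set C \<Longrightarrow> \<exists>S\<subseteq>faces Es. C = face_boundary Es l r S"
    "\<And>S. S \<subseteq> faces Es \<Longrightarrow> even_set (face_boundary Es l r S)"
    "\<And>S. S \<subseteq> faces Es \<Longrightarrow> face_boundary Es l r S = {} \<Longrightarrow> S = {} \<or> S = faces Es"
    "\<And>S x z e. S \<subseteq> faces Es \<Longrightarrow> z \<in> faces Es \<Longrightarrow> x \<in> V \<Longrightarrow> pos x \<in> closure z \<Longrightarrow> z \<notin> S \<Longrightarrow>
      \<forall>f\<in>face_boundary Es l r S. x \<notin> f \<Longrightarrow> e \<in> Es \<Longrightarrow> x \<in> e \<Longrightarrow> l e \<noteq> r e \<Longrightarrow> l e \<notin> S"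
proof -
  define good where "good e l r \<longleftrightarrow> l \<in> faces Es \<and> r \<in> faces Es \<and>
    (l = r \<longrightarrow> (\<forall>D. circuit D \<and> D \<subseteq> Es \<longrightarrow> e \<notin> D)) \<and>
    (l \<noteq> r \<longrightarrow> (\<forall>y U. y \<in> path_image (\<gamma> e) - pos ` e \<and> open U \<and> y \<in> U \<longrightarrow> U \<inter> l \<noteq> {} \<and> U \<inter> r \<noteq> {}))" for e l r
  have ex: "\<exists>l r. good e l r" for e
  proof (cases "\<exists>C. circuit C \<and> C \<subseteq> Es \<and> e \<in> C")
    case True
    then obtain C where "circuit C" "C \<subseteq> Es" "e \<in> C" by blast
    from edge_sides[OF this] show ?thesis unfolding good_def by (elim bexE) auto
  next
    case False
    \<comment> \<open>An edge on no circuit receives an arbitrary face, twice, so that it belongs to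
      no boundary.\<close>
    then have "good e (outside (image_of Es)) (outside (image_of Es))"
      unfolding good_def using outside_face by blast
    then show ?thesis by blast
  qed
  define l where "l e = (SOME l. \<exists>r. good e l r)" for e
  define r where "r e = (SOME r. good e (l e) r)" for e
  have "\<exists>r. good e (l e) r" for e unfolding l_def using ex by (rule someI_ex)
  then have good: "good e (l e) (r e)" for e unfolding r_def by (rule someI_ex)
  let ?bd = "face_boundary Es l r"
  have lr: "l e \<in> faces Es \<and> r e \<in> faces Es" for e using good unfolding good_def by blast
  have touch: "U \<inter> l e \<noteq> {} \<and> U \<inter> r e \<noteq> {}"
    if "l e \<noteq> r e" "y \<in> path_image (\<gamma> e) - pos ` e" "open U" "y \<in> U" for e y U
    using good[of e] that unfolding good_def by blast
  have ci: "C = ?bd {W \<in> faces Es. W \<subseteq> inside (image_of C)}" if C: "circuit C" "C \<subseteq> Es" for C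
  proof (rule circuit_face_boundary[OF C lr])
    show "e \<notin> D" if "l e = r e" "circuit D" "D \<subseteq> Es" for e D
      using good[of e] that unfolding good_def by blast
  qed (use touch in blast)
  note decomp = even_set_face_boundary[OF ci]
  have finF: "finite (faces Es)" and cnt: "2 ^ card (faces Es) \<le> 2 * card (cycle_space Es)"
    using card_faces[of Es] by auto
  let ?z = "outside (image_of Es)"
  have lr': "l ` Es \<subseteq> faces Es" "r ` Es \<subseteq> faces Es" using lr by auto
  have compl: "?bd (faces Es - S) = ?bd S" for S by (rule face_boundary_compl[OF lr'])
  let ?P = "Pow (faces Es - {?z})"
  have img: "?bd S \<in> ?bd ` ?P" if "S \<subseteq> faces Es" for S
  proof (cases "?z \<in> S")
    case True
    then have "faces Es - S \<in> ?P" by blast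
    then show ?thesis using compl[of S] by (metis imageI)
  next
    case False
    then show ?thesis using that by blast
  qed
  have Z: "cycle_space Es \<subseteq> ?bd ` ?P"
  proof
    fix C assume "C \<in> cycle_space Es"
    then have "C \<subseteq> Es" "even_set C" by (auto simp: cycle_space_def)
    from decomp[OF _ _ this] obtain S where "S \<subseteq> faces Es" "C = ?bd S" by blast
    then show "C \<in> ?bd ` ?P" using img by blast
  qed
  have finP: "finite ?P" using finF by simp
  \<comment> \<open>Fixing \<open>?z\<close> outside the region removes the ambiguity of
    complements. The face count gives at least as many even sets as elements of \<open>?P\<close>,
    and their boundaries already cover the cycle space, so \<open>?bd\<close> is a bijection between
    the two.\<close>
  have "card ?P = 2 ^ (card (faces Es) - 1)" using finF outside_face by (simp add: card_Pow)
  moreover have "card (faces Es) \<noteq> 0" using finF outside_face by auto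
  then have "(2::nat) ^ card (faces Es) = 2 * 2 ^ (card (faces Es) - 1)" by (cases "card (faces Es)") auto
  ultimately have le: "card ?P \<le> card (cycle_space Es)" using cnt by linarith
  have "card (?bd ` ?P) \<le> card ?P" using finP by (rule card_image_le)
  then have eq: "cycle_space Es = ?bd ` ?P" using le Z finP by (intro card_seteq) auto
  then have "card (?bd ` ?P) = card ?P" using le \<open>card (?bd ` ?P) \<le> card ?P\<close> by simp
  then have inj: "inj_on ?bd ?P" by (rule eq_card_imp_inj_on[OF finP])
  have ev: "even_set (?bd S)" if "S \<subseteq> faces Es" for S
    using img[OF that] eq unfolding cycle_space_def by blast
  have bd0: "?bd {} = {}" by (simp add: face_boundary_def)
  have triv: "S = {} \<or> S = faces Es" if S: "S \<subseteq> faces Es" "?bd S = {}" for S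
  proof (cases "?z \<in> S")
    case False
    then show ?thesis using inj_onD[OF inj, of S "{}"] S bd0 by auto
  next
    case True
    then have "faces Es - S = {}" using inj_onD[OF inj, of "faces Es - S" "{}"] S bd0 compl[of S] by auto
    then show ?thesis using S by blast
  qed
  show ?thesis
  proof (rule that[of l r, OF lr finF _ ev triv])
    show "\<exists>S\<subseteq>faces Es. C = ?bd S" if "C \<subseteq> Es" "even_set C" for C
      using decomp[OF _ _ that] by blast
    fix S x z e
    assume S: "S \<subseteq> faces Es" "z \<in> faces Es" "x \<in> V" "pos x \<in> closure z" "z \<notin> S" "\<forall>f\<in>?bd S. x \<notin> f"
      and e: "e \<in> Es" "x \<in> e" "l e \<noteq> r e"
    show "l e \<notin> S"
    proof
      assume le: "l e \<in> S"
      have sub: "?bd S \<subseteq> Es" by (auto simp: face_boundary_def)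
      from decomp[OF _ _ sub ev[OF S(1)]]
      obtain T where T: "T \<subseteq> faces Es" "?bd S = ?bd T"
        and sep: "\<forall>W\<in>faces Es. \<forall>W'\<in>faces Es. (W \<in> T) \<noteq> (W' \<in> T) \<longrightarrow>
          (\<exists>D\<subseteq>?bd S. circuit D \<and> (W \<subseteq> inside (image_of D)) \<noteq> (W' \<subseteq> inside (image_of D)))" by blast
      \<comment> \<open>\<open>T\<close> is \<open>S\<close> or its complement; in either case it
        distinguishes \<open>l e\<close> from \<open>z\<close>, which is all that the separating
        circuit needs.\<close>
      have "?bd (sym_diff S T) = {}" using T(2) by (simp add: face_boundary_sym_diff)
      then have "sym_diff S T = {} \<or> sym_diff S T = faces Es" using triv[of "sym_diff S T"] S(1) T(1) by blast
      then have "(l e \<in> T) \<noteq> (z \<in> T)" using le S(2,5) lr[of e] by blast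
      then obtain D where D: "D \<subseteq> ?bd S" "circuit D"
        "(l e \<subseteq> inside (image_of D)) \<noteq> (z \<subseteq> inside (image_of D))" using sep lr[of e] S(2) by meson
      have DE: "D \<subseteq> Es" using D(1) sub by blast
      have "pos x \<notin> image_of D"
      proof
        assume "pos x \<in> image_of D"
        then obtain f where f: "f \<in> D" "pos x \<in> path_image (\<gamma> f)" by (auto simp: image_of_def)
        then have "pos x \<in> pos ` f" using edge_verts[of f] DE S(3) by blast
        then have "x \<in> f" using inj_pos verts[of f] f(1) DE S(3) by (metis inj_on_image_mem_iff subsetD)
        then show False using S(6) f(1) D(1) by blast
      qed
      moreover have "open (- image_of D)" using closed_image_of[OF DE] by auto
      ultimately obtain d where d: "0 < d" "ball (pos x) d \<subseteq> - image_of D"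
        using open_contains_ball by (metis ComplI)
      have "ball (pos x) d \<inter> z \<noteq> {}" using S(4) d(1) by (metis closure_iff_nhds_not_empty centre_in_ball inf_commute open_ball order_refl)
      moreover obtain y where y: "y \<in> ball (pos x) d" "y \<in> path_image (\<gamma> e) - pos ` e"
        by (rule interior_point_near_vertex[OF e(1,2), of "ball (pos x) d"]) (use d(1) in auto)
      then have "ball (pos x) d \<inter> l e \<noteq> {}" using touch[OF e(3) y(2) open_ball y(1)] by blast
      moreover have "ball (pos x) d \<inter> image_of D = {}" using d(2) by blast
      ultimately have "l e \<subseteq> inside (image_of D) \<longleftrightarrow> z \<subseteq> inside (image_of D)"
        using same_side[OF D(2) DE _ S(2) connected_ball] lr[of e] by blast
      then show False using D(3) by blast
    qed
  qed
qed

end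

section \<open>Transfer to bipartite graphs\<close>

lemma even_set_bip_edges:
  assumes "finite C"
  shows "even_set (bip_edges C) \<longleftrightarrow> even_edges fst snd C"
proof -
  let ?\<iota> = "\<lambda>(i, j). {Inl i, Inr j} :: vertex set"
  have inj: "inj_on ?\<iota> X" for X :: "(nat \<times> nat) set" by (auto simp: inj_on_def doubleton_eq_iff)
  have "{f \<in> bip_edges C. Inl i \<in> f} = ?\<iota> ` {e \<in> C. fst e = i}" for i
    by (auto simp: bip_edges_def)
  then have 1: "card {f \<in> bip_edges C. Inl i \<in> f} = card {e \<in> C. fst e = i}" for i
    by (simp only: card_image[OF inj])
  have "{f \<in> bip_edges C. Inr j \<in> f} = ?\<iota> ` {e \<in> C. snd e = j}" for j
    by (auto simp: bip_edges_def)
  then have 2: "card {f \<in> bip_edges C. Inr j \<in> f} = card {e \<in> C. snd e = j}" for j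
    by (simp only: card_image[OF inj])
  show ?thesis
    unfolding even_set_def even_edges_def odd_deg_def by (simp add: split_sum_all 1 2)
qed

theorem bip_drawing_dual:
  assumes E: "E \<subseteq> {1..n} \<times> {1..m}"
    and dr: "plane_drawing (bip_verts n m) (bip_edges E) pos \<gamma>"
  obtains \<Phi> :: "complex set set" and l r where "dual_faces E fst snd \<Phi> l r"
    "pos ` bip_verts n m \<subseteq> frontier (outside (drawing_image (bip_verts n m) (bip_edges E) pos \<gamma>)) \<longrightarrow>
      (\<exists>z\<in>\<Phi>. outer_vertices E fst \<Phi> l r z \<and> outer_vertices E snd \<Phi> l r z)"
proof -
  define \<iota> :: "nat \<times> nat \<Rightarrow> vertex set" where "\<iota> = (\<lambda>(i, j). {Inl i, Inr j})"
  have bip: "bip_edges X = \<iota> ` X" for X by (simp add: bip_edges_def \<iota>_def)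
  have inj: "inj \<iota>" by (auto simp: inj_on_def \<iota>_def doubleton_eq_iff)
  have in\<iota>: "Inl i \<in> \<iota> f \<longleftrightarrow> fst f = i" "Inr i \<in> \<iota> f \<longleftrightarrow> snd f = i" for i f
    by (auto simp: \<iota>_def split: prod.splits)
  have finE: "finite E" using E finite_subset by blast
  interpret plane_graph "bip_verts n m" "bip_edges E" pos \<gamma>
  proof
    show "finite (bip_edges E)" using finE by (simp add: bip)
    show "\<exists>x y. x \<noteq> y \<and> e = {x, y}" if "e \<in> bip_edges E" for e
      using that by (auto simp: bip_edges_def)
    show "e \<subseteq> bip_verts n m" if "e \<in> bip_edges E" for e
      using that E by (auto simp: bip_edges_def bip_verts_def)
  qed (rule dr)
  let ?F = "faces (bip_edges E)"
  obtain l r where lr: "\<And>e. e \<in> bip_edges E \<Longrightarrow> l e \<in> ?F \<and> r e \<in> ?F" and finF: "finite ?F"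
    and Da: "\<And>C. C \<subseteq> bip_edges E \<Longrightarrow> even_set C \<Longrightarrow> \<exists>S\<subseteq>?F. C = face_boundary (bip_edges E) l r S"
    and Db: "\<And>S. S \<subseteq> ?F \<Longrightarrow> even_set (face_boundary (bip_edges E) l r S)"
    and Dc: "\<And>S. S \<subseteq> ?F \<Longrightarrow> face_boundary (bip_edges E) l r S = {} \<Longrightarrow> S = {} \<or> S = ?F"
    and Out: "\<And>S x z e. S \<subseteq> ?F \<Longrightarrow> z \<in> ?F \<Longrightarrow> x \<in> bip_verts n m \<Longrightarrow> pos x \<in> closure z \<Longrightarrow> z \<notin> S \<Longrightarrow>
      \<forall>f\<in>face_boundary (bip_edges E) l r S. x \<notin> f \<Longrightarrow> e \<in> bip_edges E \<Longrightarrow> x \<in> e \<Longrightarrow> l e \<noteq> r e \<Longrightarrow> l e \<notin> S"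
    by (rule dual_of_drawing) (rule that, assumption+)
  have fb: "face_boundary (bip_edges E) l r S = bip_edges (face_boundary E (l \<circ> \<iota>) (r \<circ> \<iota>) S)" for S
    by (auto simp: face_boundary_def bip)
  have fsub: "face_boundary E (l \<circ> \<iota>) (r \<circ> \<iota>) S \<subseteq> E" for S by (auto simp: face_boundary_def)
  have fbfin: "finite (face_boundary E (l \<circ> \<iota>) (r \<circ> \<iota>) S)" for S using fsub finE finite_subset by blast
  have dual: "dual_faces E fst snd ?F (l \<circ> \<iota>) (r \<circ> \<iota>)"
    unfolding dual_faces_def
  proof (intro conjI allI impI)
    show "finite E" "finite ?F" using finE finF by auto
    show "(l \<circ> \<iota>) ` E \<subseteq> ?F" "(r \<circ> \<iota>) ` E \<subseteq> ?F" using lr by (auto simp: bip)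
    fix S assume S: "S \<subseteq> ?F"
    show "even_edges fst snd (face_boundary E (l \<circ> \<iota>) (r \<circ> \<iota>) S)"
      using Db[OF S] even_set_bip_edges[OF fbfin] unfolding fb by blast
  next
    fix C assume C: "C \<subseteq> E" "even_edges fst snd C"
    have "finite C" using C(1) finE finite_subset by blast
    then have "even_set (bip_edges C)" using C(2) even_set_bip_edges by blast
    moreover have "bip_edges C \<subseteq> bip_edges E" using C(1) by (auto simp: bip)
    ultimately obtain S where S: "S \<subseteq> ?F" "bip_edges C = face_boundary (bip_edges E) l r S" using Da by metis
    then have "\<iota> ` C = \<iota> ` face_boundary E (l \<circ> \<iota>) (r \<circ> \<iota>) S" using fb[of S] bip by metis
    then have "C = face_boundary E (l \<circ> \<iota>) (r \<circ> \<iota>) S" using inj by (simp add: inj_image_eq_iff)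
    then show "\<exists>S\<subseteq>?F. C = face_boundary E (l \<circ> \<iota>) (r \<circ> \<iota>) S" using S(1) by blast
  next
    fix S assume "S \<subseteq> ?F" "face_boundary E (l \<circ> \<iota>) (r \<circ> \<iota>) S = {}"
    then show "S = {} \<or> S = ?F" using Dc[of S] unfolding fb by (simp add: bip)
  qed
  show ?thesis
  proof (rule that[OF dual], intro impI)
    let ?D = "drawing_image (bip_verts n m) (bip_edges E) pos \<gamma>" and ?z = "outside (image_of (bip_edges E))"
    assume fr: "pos ` bip_verts n m \<subseteq> frontier (outside ?D)"
    \<comment> \<open>The drawing also contains isolated vertices, whereas \<open>?z\<close> is the
      outside of the edges alone. Enlarging the set shrinks its outside, so closure points carry
      over to \<open>?z\<close>.\<close>
    have "image_of (bip_edges E) \<subseteq> ?D" by (auto simp: image_of_def drawing_image_def)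
    then have "closure (outside ?D) \<subseteq> closure ?z" by (intro closure_mono outside_mono)
    then have cl: "pos x \<in> closure ?z" if "x \<in> bip_verts n m" for x using fr that by (auto simp: frontier_def)
    have "l (\<iota> e) \<notin> S"
      if S: "S \<subseteq> ?F" "?z \<notin> S" "\<forall>f\<in>face_boundary E (l \<circ> \<iota>) (r \<circ> \<iota>) S. x \<notin> \<iota> f"
        and e: "e \<in> E" "x \<in> \<iota> e" "l (\<iota> e) \<noteq> r (\<iota> e)" for S x e
    proof -
      have eE: "\<iota> e \<in> bip_edges E" using e(1) by (simp add: bip)
      have x: "x \<in> bip_verts n m" using verts[OF eE] e(2) by blast
      have "\<forall>f\<in>face_boundary (bip_edges E) l r S. x \<notin> f" using S(3) unfolding fb by (auto simp: bip)
      then show ?thesis using Out[OF S(1) outside_face x cl[OF x] S(2) _ eE e(2,3)] by blast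
    qed
    note O = this
    have "outer_vertices E fst ?F (l \<circ> \<iota>) (r \<circ> \<iota>) ?z"
      unfolding outer_vertices_def
    proof (intro allI impI ballI, elim conjE)
      fix S i e
      assume "S \<subseteq> ?F" "?z \<notin> S" "\<forall>e\<in>face_boundary E (l \<circ> \<iota>) (r \<circ> \<iota>) S. fst e \<noteq> i" "e \<in> E" "fst e = i"
        "(l \<circ> \<iota>) e \<noteq> (r \<circ> \<iota>) e"
      then show "(l \<circ> \<iota>) e \<notin> S" using O[of S "Inl i" e] by (simp add: in\<iota>)
    qed
    moreover have "outer_vertices E snd ?F (l \<circ> \<iota>) (r \<circ> \<iota>) ?z"
      unfolding outer_vertices_def
    proof (intro allI impI ballI, elim conjE)
      fix S j e
      assume "S \<subseteq> ?F" "?z \<notin> S" "\<forall>e\<in>face_boundary E (l \<circ> \<iota>) (r \<circ> \<iota>) S. snd e \<noteq> j" "e \<in> E" "snd e = j"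
        "(l \<circ> \<iota>) e \<noteq> (r \<circ> \<iota>) e"
      then show "(l \<circ> \<iota>) e \<notin> S" using O[of S "Inr j" e] by (simp add: in\<iota>)
    qed
    ultimately show "\<exists>z\<in>?F. outer_vertices E fst ?F (l \<circ> \<iota>) (r \<circ> \<iota>) z \<and> outer_vertices E snd ?F (l \<circ> \<iota>) (r \<circ> \<iota>) z"
      using outside_face by blast
  qed
qed

text \<open>An edge of a nonempty even set has its ends joined by a path avoiding it, by
  \<open>even_set_reachable\<close>; closing the path gives a cycle of length at least
  three.\<close>

lemma forest_no_even_set:
  assumes fin: "finite E" and fo: "forest (bip_edges E)" and C: "C \<subseteq> E" "even_edges fst snd C"
  shows "C = {}"
proof (rule ccontr)
  assume "C \<noteq> {}"
  then obtain i j where ij: "(i, j) \<in> C" by auto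
  have finC: "finite C" using C fin finite_subset by blast
  let ?e = "{Inl i, Inr j} :: vertex set"
  have e: "?e \<in> bip_edges C" using ij by (force simp: bip_edges_def)
  have "even_set (bip_edges C)" using C(2) even_set_bip_edges[OF finC] by blast
  moreover have "finite (bip_edges C)" using finC by (simp add: bip_edges_def)
  ultimately have "Inr j \<in> reachable (bip_edges C - {?e}) (Inl i)"
    using e by (intro even_set_reachable) (auto simp: bip_edges_def)
  then obtain p where p: "p \<noteq> []" "hd p = Inr j" "last p = Inl i" "distinct p" "path_edges p \<subseteq> bip_edges C - {?e}"
    by (auto simp: reachable_def)
  have nth: "{p ! k, p ! Suc k} \<in> path_edges p" if "Suc k < length p" for p :: "vertex list" and k
    using that
  proof (induction p arbitrary: k rule: path_edges.induct)
    case (1 x y p)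
    then show ?case by (cases k) auto
  qed auto
  have len: "3 \<le> length p"
  proof (rule ccontr)
    assume "\<not> ?thesis"
    then consider x where "p = [x]" | x y where "p = [x, y]" using p(1)
      by (cases p rule: path_edges.cases; cases "tl (tl p)") auto
    then show False using p by cases (auto simp: insert_commute)
  qed
  have CE: "bip_edges C \<subseteq> bip_edges E" using C(1) by (auto simp: bip_edges_def)
  have "{p ! k, p ! (Suc k mod length p)} \<in> bip_edges E" if k: "k < length p" for k
  proof (cases "Suc k < length p")
    case True
    then have "{p ! k, p ! (Suc k mod length p)} \<in> bip_edges C" using nth[OF True] p(5) by auto
    then show ?thesis using CE by blast
  next
    case False
    then have "Suc k = length p" using k by simp
    then have "p ! k = last p" "Suc k mod length p = 0" using p(1) by (metis diff_Suc_1 last_conv_nth, simp)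
    then have "{p ! k, p ! (Suc k mod length p)} = ?e" using p by (simp add: hd_conv_nth)
    then show ?thesis using e CE by auto
  qed
  then have "graph_cycle (bip_edges E) p" using p(4) len by (simp add: graph_cycle_def)
  then show False using fo by (auto simp: forest_def)
qed

section \<open>Generic points\<close>

text \<open>Together with \<open>poly_value\<close>, this names the evaluation written out in
  \<open>algebraically_independent_over_rat\<close>.\<close>

definition monom_value :: "('i \<Rightarrow> real) \<Rightarrow> ('i \<Rightarrow>\<^sub>0 nat) \<Rightarrow> real" where
  "monom_value a t = (\<Prod>i\<in>Poly_Mapping.keys t. a i ^ Poly_Mapping.lookup t i)"

definition poly_value :: "('i \<Rightarrow> real) \<Rightarrow> ('i, rat) mpoly \<Rightarrow> real" where
  "poly_value a p = (\<Sum>t\<in>Poly_Mapping.keys p. of_rat (Poly_Mapping.lookup p t) * monom_value a t)"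

lemma monom_value_superset:
  assumes "finite K" "Poly_Mapping.keys t \<subseteq> K"
  shows "monom_value a t = (\<Prod>i\<in>K. a i ^ Poly_Mapping.lookup t i)"
  unfolding monom_value_def using assms by (intro prod.mono_neutral_left) (auto simp: in_keys_iff)

lemma monom_value_add: "monom_value a (s + t) = monom_value a s * monom_value a t"
proof -
  let ?K = "Poly_Mapping.keys s \<union> Poly_Mapping.keys t"
  have "monom_value a (s + t) = (\<Prod>i\<in>?K. a i ^ Poly_Mapping.lookup (s + t) i)"
    using Poly_Mapping.keys_add[of s t] by (intro monom_value_superset) auto
  also have "\<dots> = (\<Prod>i\<in>?K. a i ^ Poly_Mapping.lookup s i) * (\<Prod>i\<in>?K. a i ^ Poly_Mapping.lookup t i)"
    by (simp add: lookup_add power_add prod.distrib)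
  also have "\<dots> = monom_value a s * monom_value a t"
    using monom_value_superset[of ?K s a] monom_value_superset[of ?K t a] by simp
  finally show ?thesis .
qed

lemma poly_value_superset:
  assumes "finite K" "Poly_Mapping.keys p \<subseteq> K"
  shows "poly_value a p = (\<Sum>t\<in>K. of_rat (Poly_Mapping.lookup p t) * monom_value a t)"
  unfolding poly_value_def using assms by (intro sum.mono_neutral_left) (auto simp: in_keys_iff)

lemma poly_value_add: "poly_value a (p + q) = poly_value a p + poly_value a q"
proof -
  let ?K = "Poly_Mapping.keys p \<union> Poly_Mapping.keys q"
  have "poly_value a (p + q) = (\<Sum>t\<in>?K. of_rat (Poly_Mapping.lookup (p + q) t) * monom_value a t)"
    using Poly_Mapping.keys_add[of p q] by (intro poly_value_superset) auto
  also have "\<dots> = (\<Sum>t\<in>?K. of_rat (Poly_Mapping.lookup p t) * monom_value a t) +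
      (\<Sum>t\<in>?K. of_rat (Poly_Mapping.lookup q t) * monom_value a t)"
    by (simp add: lookup_add of_rat_add distrib_right sum.distrib)
  also have "\<dots> = poly_value a p + poly_value a q"
    using poly_value_superset[of ?K p a] poly_value_superset[of ?K q a] by simp
  finally show ?thesis .
qed

lemma poly_value_0 [simp]: "poly_value a 0 = 0"
  by (simp add: poly_value_def)

lemma poly_value_single: "poly_value a (Poly_Mapping.single t c) = of_rat c * monom_value a t"
  by (cases "c = 0") (auto simp: poly_value_def)

lemma poly_value_sum: "poly_value a (\<Sum>x\<in>A. f x) = (\<Sum>x\<in>A. poly_value a (f x))"
  by (induction A rule: infinite_finite_induct) (auto simp: poly_value_add)

lemma sum_single_lookup: "(\<Sum>t\<in>Poly_Mapping.keys p. Poly_Mapping.single t (Poly_Mapping.lookup p t)) = p"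
  by (rule poly_mapping_eqI) (auto simp: lookup_sum lookup_single when_def in_keys_iff)

lemma poly_value_mult: "poly_value a (p * q) = poly_value a p * poly_value a q"
proof -
  have "p * q = (\<Sum>s\<in>Poly_Mapping.keys p. Poly_Mapping.single s (Poly_Mapping.lookup p s)) *
      (\<Sum>t\<in>Poly_Mapping.keys q. Poly_Mapping.single t (Poly_Mapping.lookup q t))"
    by (simp add: sum_single_lookup)
  also have "\<dots> = (\<Sum>s\<in>Poly_Mapping.keys p. \<Sum>t\<in>Poly_Mapping.keys q.
      Poly_Mapping.single (s + t) (Poly_Mapping.lookup p s * Poly_Mapping.lookup q t))"
    by (simp add: sum_product mult_single)
  finally have "poly_value a (p * q) = (\<Sum>s\<in>Poly_Mapping.keys p. \<Sum>t\<in>Poly_Mapping.keys q.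
      of_rat (Poly_Mapping.lookup p s) * monom_value a s * (of_rat (Poly_Mapping.lookup q t) * monom_value a t))"
    by (simp add: poly_value_sum poly_value_single monom_value_add of_rat_mult mult_ac)
  then show ?thesis by (simp add: poly_value_def sum_product)
qed

lemma poly_value_uminus: "poly_value a (- p) = - poly_value a p"
  using poly_value_add[of a p "- p"] by simp

text \<open>Functions of the point, rather than polynomials, can be evaluated both at a special real
  point and at the generic one, and elimination needs only pointwise operations.\<close>

definition rat_poly_fun :: "'i set \<Rightarrow> (('i \<Rightarrow> real) \<Rightarrow> real) \<Rightarrow> bool" where
  "rat_poly_fun I f \<longleftrightarrow> (\<exists>p\<in>mpolys_over I. \<forall>x. f x = poly_value x p)"

lemma rat_poly_fun_zero: "rat_poly_fun I (\<lambda>x. 0)"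
  unfolding rat_poly_fun_def by (intro bexI[of _ 0]) (auto simp: mpolys_over_def)

lemma rat_poly_fun_var:
  assumes "i \<in> I" shows "rat_poly_fun I (\<lambda>x. x i)"
proof -
  have "poly_value x (Poly_Mapping.single (Poly_Mapping.single i 1) 1) = x i" for x :: "'a \<Rightarrow> real"
    by (simp add: poly_value_single monom_value_def)
  then show ?thesis
    unfolding rat_poly_fun_def using assms
    by (intro bexI[of _ "Poly_Mapping.single (Poly_Mapping.single i 1) 1"]) (auto simp: mpolys_over_def)
qed

lemma rat_poly_fun_mult: "rat_poly_fun I f \<Longrightarrow> rat_poly_fun I g \<Longrightarrow> rat_poly_fun I (\<lambda>x. f x * g x)"
  unfolding rat_poly_fun_def using mpolys_over_closed(2) poly_value_mult by metis

lemma rat_poly_fun_diff: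
  assumes "rat_poly_fun I f" "rat_poly_fun I g" shows "rat_poly_fun I (\<lambda>x. f x - g x)"
proof -
  obtain p q where pq: "p \<in> mpolys_over I" "q \<in> mpolys_over I" "\<forall>x. f x = poly_value x p" "\<forall>x. g x = poly_value x q"
    using assms unfolding rat_poly_fun_def by blast
  have "p + - q \<in> mpolys_over I" using pq mpolys_over_closed by metis
  moreover have "f x - g x = poly_value x (p + - q)" for x
    unfolding poly_value_add poly_value_uminus using pq by simp
  ultimately show ?thesis unfolding rat_poly_fun_def by blast
qed

lemma rat_poly_fun_generic_nonzero:
  assumes ai: "algebraically_independent_over_rat I a" and f: "rat_poly_fun I f" and nz: "f x \<noteq> 0"
  shows "f a \<noteq> 0"
proof
  assume "f a = 0"
  obtain p where p: "p \<in> mpolys_over I" "\<forall>x. f x = poly_value x p" using f unfolding rat_poly_fun_def by blast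
  then have "poly_value a p = 0" using \<open>f a = 0\<close> by simp
  then have "p = 0"
    using ai p(1) unfolding algebraically_independent_over_rat_def poly_value_def monom_value_def by blast
  then show False using p(2) nz by simp
qed

text \<open>Fraction-free Gaussian elimination keeps the matrix entries polynomial.\<close>

lemma generic_injective:
  fixes M :: "'r \<Rightarrow> 'e \<Rightarrow> ('i \<Rightarrow> real) \<Rightarrow> real"
  assumes ai: "algebraically_independent_over_rat I a" and fin: "finite E"
    and M: "\<And>r e. r \<in> R \<Longrightarrow> e \<in> E \<Longrightarrow> rat_poly_fun I (M r e)"
    and x: "\<And>w. \<forall>r\<in>R. (\<Sum>e\<in>E. w e * M r e x) = 0 \<Longrightarrow> \<forall>e\<in>E. w e = 0"
    and w: "\<forall>r\<in>R. (\<Sum>e\<in>E. w e * M r e a) = 0"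
  shows "\<forall>e\<in>E. w e = 0"
  using fin M x w
proof (induction E arbitrary: M w)
  case (insert e0 E)
  note M = insert.prems(1) and x = insert.prems(2) and w = insert.prems(3)
  have S: "(\<Sum>e\<in>insert e0 E. v e * N e) = v e0 * N e0 + (\<Sum>e\<in>E. v e * N e)" for v N :: "'e \<Rightarrow> real"
    using insert.hyps by simp
  \<comment> \<open>If column \<open>e0\<close> vanished at \<open>x\<close>, the unit vector at
    \<open>e0\<close> would be in the kernel.\<close>
  have "\<exists>r\<in>R. M r e0 x \<noteq> 0"
  proof (rule ccontr)
    assume "\<not> ?thesis"
    then have "\<forall>r\<in>R. (\<Sum>e\<in>insert e0 E. (if e = e0 then 1 else 0) * M r e x) = 0"
      using insert.hyps by (simp add: sum.neutral)
    from x[OF this] show False by simp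
  qed
  then obtain r0 where r0: "r0 \<in> R" "M r0 e0 x \<noteq> 0" by blast
  have a0: "M r0 e0 a \<noteq> 0" using rat_poly_fun_generic_nonzero[OF ai M[OF r0(1)] r0(2)] by simp
  define M' where "M' r e = (\<lambda>y. M r0 e0 y * M r e y - M r e0 y * M r0 e y)" for r e
  have M'_sum: "(\<Sum>e\<in>E. v e * M' r e y) = M r0 e0 y * (\<Sum>e\<in>E. v e * M r e y) - M r e0 y * (\<Sum>e\<in>E. v e * M r0 e y)"
    for v r y unfolding M'_def by (simp add: sum_distrib_left sum_subtractf algebra_simps)
  have wE: "\<forall>e\<in>E. w e = 0"
  proof (rule insert.IH[of M'])
    show "rat_poly_fun I (M' r e)" if "r \<in> R" "e \<in> E" for r e
      unfolding M'_def using M r0(1) that by (intro rat_poly_fun_diff rat_poly_fun_mult) auto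
    show "\<forall>e\<in>E. v e = 0" if v: "\<forall>r\<in>R. (\<Sum>e\<in>E. v e * M' r e x) = 0" for v
    proof -
      \<comment> \<open>The entry at \<open>e0\<close> is solved from the pivot row, so that a
        kernel vector of the reduced matrix extends to one of the full matrix.\<close>
      define v' where "v' = v(e0 := - (\<Sum>e\<in>E. v e * M r0 e x) / M r0 e0 x)"
      have "(\<Sum>e\<in>insert e0 E. v' e * M r e x) = 0" if r: "r \<in> R" for r
      proof -
        have "(\<Sum>e\<in>E. v' e * M r e x) = (\<Sum>e\<in>E. v e * M r e x)"
          using insert.hyps by (intro sum.cong) (auto simp: v'_def)
        then have "M r0 e0 x * (\<Sum>e\<in>insert e0 E. v' e * M r e x) = (\<Sum>e\<in>E. v e * M' r e x)"
          unfolding S M'_sum using r0(2) by (simp add: v'_def field_simps)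
        then show ?thesis using v r r0(2) by simp
      qed
      then have "\<forall>e\<in>insert e0 E. v' e = 0" using x by blast
      then show ?thesis using insert.hyps by (auto simp: v'_def split: if_splits)
    qed
    show "\<forall>r\<in>R. (\<Sum>e\<in>E. w e * M' r e a) = 0"
    proof
      fix r assume r: "r \<in> R"
      have "(\<Sum>e\<in>E. w e * M r e a) = - w e0 * M r e0 a" "(\<Sum>e\<in>E. w e * M r0 e a) = - w e0 * M r0 e0 a"
        using w r r0(1) unfolding S by (simp_all add: add_eq_0_iff)
      then show "(\<Sum>e\<in>E. w e * M' r e a) = 0" unfolding M'_sum by simp
    qed
  qed
  have "w e0 * M r0 e0 a + (\<Sum>e\<in>E. w e * M r0 e a) = 0" using w r0(1) unfolding S by blast
  then have "w e0 = 0" using wE a0 by simp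
  then show ?case using wE by simp
qed simp

lemma generic_independent:
  assumes g: "generic n m \<theta> \<theta>'" and N: "finite N" "card N \<le> k"
  shows "k \<le> n \<Longrightarrow> N \<subseteq> {1..n} \<Longrightarrow> \<forall>p\<in>{1..k}. (\<Sum>i\<in>N. c i * \<theta> p i) = 0 \<Longrightarrow> \<forall>i\<in>N. c i = 0"
    and "k \<le> m \<Longrightarrow> N \<subseteq> {1..m} \<Longrightarrow> \<forall>p\<in>{1..k}. (\<Sum>i\<in>N. c i * \<theta>' p i) = 0 \<Longrightarrow> \<forall>i\<in>N. c i = 0"
proof -
  obtain h where h: "h ` N \<subseteq> {1..k}" "inj_on h N"
    using card_le_inj[of N "{1..k}"] N by auto
  \<comment> \<open>The special point places the elements of \<open>N\<close> at distinct unit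
    vectors, chosen by \<open>h\<close>.\<close>
  define x :: "(nat \<times> nat) + (nat \<times> nat) \<Rightarrow> real" where
    "x = case_sum (\<lambda>(p, i). if h i = p then 1 else 0) (\<lambda>(p, i). if h i = p then 1 else 0)"
  have sp: "\<forall>i\<in>N. w i = 0" if w: "\<forall>p\<in>{1..k}. (\<Sum>i\<in>N. w i * (if h i = p then 1 else 0)) = 0" for w :: "nat \<Rightarrow> real"
  proof
    fix i assume i: "i \<in> N"
    have "0 = (\<Sum>j\<in>N. w j * (if h j = h i then 1 else 0))" using w h i by auto
    also have "\<dots> = (\<Sum>j\<in>N. if j = i then w j else 0)"
      using h(2) i by (intro sum.cong) (auto simp: inj_on_def)
    also have "\<dots> = w i" using i N by simp
    finally show "w i = 0" by simp
  qed
  show "\<forall>i\<in>N. c i = 0" if "k \<le> n" "N \<subseteq> {1..n}" "\<forall>p\<in>{1..k}. (\<Sum>i\<in>N. c i * \<theta> p i) = 0"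
    by (rule generic_injective[OF g[unfolded generic_def] N(1), of "{1..k}" "\<lambda>p i y. y (Inl (p, i))" x])
      (use that sp in \<open>auto simp: x_def intro!: rat_poly_fun_var\<close>)
  show "\<forall>i\<in>N. c i = 0" if "k \<le> m" "N \<subseteq> {1..m}" "\<forall>p\<in>{1..k}. (\<Sum>i\<in>N. c i * \<theta>' p i) = 0"
    by (rule generic_injective[OF g[unfolded generic_def] N(1), of "{1..k}" "\<lambda>p i y. y (Inr (p, i))" x])
      (use that sp in \<open>auto simp: x_def intro!: rat_poly_fun_var\<close>)
qed

text \<open>Being stress free is injectivity of a matrix with a column for each edge and a row for
  each vertex and coordinate, whose entries are single variables or zero. Injectivity at the real
  point \<open>X\<close>, \<open>Y\<close> therefore passes to the generic point.\<close>

lemma generic_stress_free_at: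
  assumes g: "generic n m \<theta> \<theta>'" and kl: "k \<le> n" "l \<le> m"
    and fin: "finite E" and ab: "a ` E \<subseteq> {1..n}" "b ` E \<subseteq> {1..m}"
    and sf: "stress_free_at k l X Y E a b"
  shows "stress_free_at k l \<theta> \<theta>' E a b"
  unfolding stress_free_at_def
proof (intro allI impI, elim conjE)
  fix w
  assume A: "\<forall>j. \<forall>p\<in>{1..k}. (\<Sum>e\<in>{e \<in> E. b e = j}. w e * \<theta> p (a e)) = 0"
    and B: "\<forall>i. \<forall>q\<in>{1..l}. (\<Sum>e\<in>{e \<in> E. a e = i}. w e * \<theta>' q (b e)) = 0"
  let ?I = "Inl ` ({1..n} \<times> {1..n}) \<union> Inr ` ({1..m} \<times> {1..m})"
  \<comment> \<open>Rows are listed for all natural numbers; those of labels carried by no edge are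
    zero.\<close>
  define R where "R = Inl ` ((UNIV :: nat set) \<times> {1..k}) \<union> Inr ` ((UNIV :: nat set) \<times> {1..l})"
  define M :: "(nat \<times> nat) + (nat \<times> nat) \<Rightarrow> _ \<Rightarrow> ((nat \<times> nat) + (nat \<times> nat) \<Rightarrow> real) \<Rightarrow> real" where
    "M r e y = (case r of Inl (j, p) \<Rightarrow> if b e = j then y (Inl (p, a e)) else 0
      | Inr (i, q) \<Rightarrow> if a e = i then y (Inr (q, b e)) else 0)" for r e y
  define x where "x = case_sum (\<lambda>(p, i). X p i) (\<lambda>(q, j). Y q j)"
  have filt: "(\<Sum>e\<in>E. v e * (if P e then f e else 0)) = (\<Sum>e\<in>{e \<in> E. P e}. v e * f e)" for v f :: "_ \<Rightarrow> real" and P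
    using fin by (simp add: sum.inter_filter if_distrib[of "(*) _"] cong: if_cong)
  show "\<forall>e\<in>E. w e = 0"
  proof (rule generic_injective[OF g[unfolded generic_def] fin, of R M x])
    fix r e assume r: "r \<in> R" and e: "e \<in> E"
    show "rat_poly_fun ?I (M r e)"
    proof (cases r)
      case (Inl jp)
      obtain j p where jp: "jp = (j, p)" by (cases jp)
      have "rat_poly_fun ?I (\<lambda>y. y (Inl (p, a e)))"
        using r e kl ab Inl jp by (intro rat_poly_fun_var) (auto simp: R_def)
      then show ?thesis using Inl jp by (cases "b e = j") (simp_all add: M_def[abs_def] rat_poly_fun_zero)
    next
      case (Inr iq)
      obtain i q where iq: "iq = (i, q)" by (cases iq)
      have "rat_poly_fun ?I (\<lambda>y. y (Inr (q, b e)))"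
        using r e kl ab Inr iq by (intro rat_poly_fun_var) (auto simp: R_def)
      then show ?thesis using Inr iq by (cases "a e = i") (simp_all add: M_def[abs_def] rat_poly_fun_zero)
    qed
  next
    fix v assume v: "\<forall>r\<in>R. (\<Sum>e\<in>E. v e * M r e x) = 0"
    have "(\<Sum>e\<in>{e \<in> E. b e = j}. v e * X p (a e)) = 0" if "p \<in> {1..k}" for j p
      using v[rule_format, of "Inl (j, p)"] that by (simp add: R_def M_def x_def filt image_iff)
    moreover have "(\<Sum>e\<in>{e \<in> E. a e = i}. v e * Y q (b e)) = 0" if "q \<in> {1..l}" for i q
      using v[rule_format, of "Inr (i, q)"] that by (simp add: R_def M_def x_def filt image_iff)
    ultimately show "\<forall>e\<in>E. v e = 0" using sf unfolding stress_free_at_def by blast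
  next
    show "\<forall>r\<in>R. (\<Sum>e\<in>E. w e * M r e (case_sum (\<lambda>(i, j). \<theta> i j) (\<lambda>(s, t). \<theta>' s t))) = 0"
      using A B by (auto simp: R_def M_def filt)
  qed
qed

section \<open>Balanced shifting and stresses\<close>

text \<open>Vectors with trivial orthogonal complement span the whole space; elimination removes one
  coordinate at a time.\<close>

lemma spanning_if_no_orthogonal:
  fixes v :: "'f \<Rightarrow> 'e \<Rightarrow> real"
  assumes "finite E" "finite T"
    and "\<And>w. \<forall>f\<in>T. (\<Sum>e\<in>E. w e * v f e) = 0 \<Longrightarrow> \<forall>e\<in>E. w e = 0"
  shows "\<exists>c. \<forall>e\<in>E. t e = (\<Sum>f\<in>T. c f * v f e)"
  using assms
proof (induction E arbitrary: v t)
  case (insert e0 E)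
  note orth = insert.prems(2)
  have "\<exists>f\<in>T. v f e0 \<noteq> 0"
  proof (rule ccontr)
    assume "\<not> ?thesis"
    then have "\<forall>f\<in>T. (\<Sum>e\<in>insert e0 E. (if e = e0 then 1 else 0) * v f e) = 0"
      using insert.hyps by (simp add: sum.neutral)
    from orth[OF this] show False by simp
  qed
  then obtain f0 where f0: "f0 \<in> T" "v f0 e0 \<noteq> 0" by blast
  define v' where "v' f e = v f e - v f e0 / v f0 e0 * v f0 e" for f e
  have "\<exists>c. \<forall>e\<in>E. t e - t e0 / v f0 e0 * v f0 e = (\<Sum>f\<in>T. c f * v' f e)"
  proof (rule insert.IH[OF insert.prems(1)])
    fix w assume w: "\<forall>f\<in>T. (\<Sum>e\<in>E. w e * v' f e) = 0"
    define w' where "w' = w(e0 := - (\<Sum>e\<in>E. w e * v f0 e) / v f0 e0)"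
    have "(\<Sum>e\<in>insert e0 E. w' e * v f e) = 0" if f: "f \<in> T" for f
    proof -
      have "(\<Sum>e\<in>E. w' e * v f e) = (\<Sum>e\<in>E. w e * v f e)"
        using insert.hyps by (intro sum.cong) (auto simp: w'_def)
      moreover have "(\<Sum>e\<in>E. w e * v' f e) = (\<Sum>e\<in>E. w e * v f e) - v f e0 / v f0 e0 * (\<Sum>e\<in>E. w e * v f0 e)"
        by (simp add: v'_def sum_distrib_left sum_subtractf algebra_simps)
      ultimately show ?thesis using w f insert.hyps by (simp add: w'_def)
    qed
    then have "\<forall>e\<in>insert e0 E. w' e = 0" using orth by blast
    then show "\<forall>e\<in>E. w e = 0" using insert.hyps by (auto simp: w'_def split: if_splits)
  qed
  then obtain c where c: "\<forall>e\<in>E. t e - t e0 / v f0 e0 * v f0 e = (\<Sum>f\<in>T. c f * v' f e)" by blast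
  \<comment> \<open>The coefficient of the pivot vector is solved from coordinate \<open>e0\<close>.
    On the other coordinates it undoes the multiples of \<open>v f0\<close> subtracted in
    \<open>v'\<close>.\<close>
  define s where "s = t e0 / v f0 e0 - (\<Sum>f\<in>T. c f * v f e0) / v f0 e0"
  define c' where "c' f = c f + (if f = f0 then s else 0)" for f
  have c': "(\<Sum>f\<in>T. c' f * v f e) = (\<Sum>f\<in>T. c f * v f e) + s * v f0 e" for e
  proof -
    have "(\<Sum>f\<in>T. (if f = f0 then s else 0) * v f e) = s * v f0 e"
      using f0(1) insert.prems(1) by (simp add: if_distrib[of "\<lambda>x. x * _"] cong: if_cong)
    then show ?thesis by (simp add: c'_def distrib_right sum.distrib)
  qed
  have "t e = (\<Sum>f\<in>T. c' f * v f e)" if "e \<in> insert e0 E" for e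
  proof (cases "e = e0")
    case True
    then show ?thesis using f0(2) unfolding c' by (simp add: s_def field_simps)
  next
    case False
    then have "t e - t e0 / v f0 e0 * v f0 e = (\<Sum>f\<in>T. c f * v' f e)" using c that by blast
    also have "\<dots> = (\<Sum>f\<in>T. c f * v f e) - (\<Sum>f\<in>T. c f * v f e0) / v f0 e0 * v f0 e"
      by (simp add: v'_def sum_subtractf right_diff_distrib sum_distrib_left sum_distrib_right sum_divide_distrib mult_ac)
    finally show ?thesis unfolding c' by (simp add: s_def algebra_simps)
  qed
  then show ?case by blast
qed simp

section \<open>Forms of bidegree (1,1) and the quotient ring\<close>

lemma mconst_0 [simp]: "mconst 0 = 0"
  by (simp add: mconst_def)

lemma mconst_diff: "mconst (a - b :: real) = mconst a - mconst b"
  by (simp add: mconst_def single_diff)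

lemma mconst_mult: "mconst (a * b :: real) = mconst a * mconst b"
  by (simp add: mconst_def mult_single)

lemma mconst_sum: "mconst (\<Sum>x\<in>A. f x :: real) = (\<Sum>x\<in>A. mconst (f x))"
  by (induction A rule: infinite_finite_induct) (auto simp: mconst_def single_add)

lemma mconst_over: "mconst c \<in> mpolys_over V"
  by (simp add: mconst_def mpolys_over_def)

lemma mvar_over: "v \<in> V \<Longrightarrow> (mvar v :: ('v, real) mpoly) \<in> mpolys_over V"
  by (simp add: mvar_def mpolys_over_def)

lemma sum_over:
  fixes f :: "'x \<Rightarrow> ('v, real) mpoly"
  assumes "\<And>x. x \<in> A \<Longrightarrow> f x \<in> mpolys_over V"
  shows "(\<Sum>x\<in>A. f x) \<in> mpolys_over V"
proof -
  have "0 \<in> (mpolys_over V :: ('v, real) mpoly set)" by (simp add: mpolys_over_def)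
  then show ?thesis using assms
    by (induction A rule: infinite_finite_induct) (simp_all add: mpolys_over_closed(1))
qed

text \<open>The generic bihomogeneous form of bidegree (1,1), given by its coefficient matrix;
  modulo the ideal only the entries at edges matter.\<close>

definition edge_form :: "nat \<Rightarrow> nat \<Rightarrow> (nat \<Rightarrow> nat \<Rightarrow> real) \<Rightarrow> (vertex, real) mpoly" where
  "edge_form n m c = (\<Sum>i\<in>{1..n}. \<Sum>j\<in>{1..m}. mconst (c i j) * (mvar (Inl i) * mvar (Inr j)))"

lemma theta_mult_edge_form: "theta_A n \<theta> p * theta_B m \<theta>' q = edge_form n m (\<lambda>i j. \<theta> p i * \<theta>' q j)"
  unfolding theta_A_def theta_B_def edge_form_def sum_product
  by (intro sum.cong refl) (simp add: mconst_mult mult_ac)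

lemma edge_form_combination:
  "edge_form n m t - (\<Sum>f\<in>T. mconst (c f) * edge_form n m (v f)) =
   edge_form n m (\<lambda>i j. t i j - (\<Sum>f\<in>T. c f * v f i j))"
proof -
  have "(\<Sum>f\<in>T. mconst (c f) * edge_form n m (v f)) =
      (\<Sum>i\<in>{1..n}. \<Sum>j\<in>{1..m}. \<Sum>f\<in>T. mconst (c f) * (mconst (v f i j) * (mvar (Inl i) * mvar (Inr j))))"
    unfolding edge_form_def sum_distrib_left
    by (subst sum.swap) (intro sum.cong refl sum.swap)
  then show ?thesis
    unfolding edge_form_def
    by (simp add: mconst_diff mconst_sum mconst_mult left_diff_distrib sum_subtractf sum_distrib_right mult.assoc)
qed

context
  fixes n m :: nat and E :: "(nat \<times> nat) set"
begin

interpretation R: cring "poly_ring n m" by (rule poly_ring_cring)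

lemma poly_ring_simps [simp]:
  "carrier (poly_ring n m) = mpolys_over (bip_verts n m)" "x \<oplus>\<^bsub>poly_ring n m\<^esub> y = x + y"
  "x \<otimes>\<^bsub>poly_ring n m\<^esub> y = x * y" "\<zero>\<^bsub>poly_ring n m\<^esub> = 0"
  by (simp_all add: poly_ring_def)

lemma vert_over:
  "i \<in> {1..n} \<Longrightarrow> (mvar (Inl i) :: (vertex, real) mpoly) \<in> mpolys_over (bip_verts n m)"
  "j \<in> {1..m} \<Longrightarrow> (mvar (Inr j) :: (vertex, real) mpoly) \<in> mpolys_over (bip_verts n m)"
  by (auto intro!: mvar_over simp: bip_verts_def)

lemma graph_ideal_ideal: "ideal (graph_ideal n m E) (poly_ring n m)"
  unfolding graph_ideal_def
  by (rule R.genideal_ideal) (auto intro!: mpolys_over_closed(2) vert_over)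

lemma non_edge_in_graph_ideal:
  assumes "i \<in> {1..n}" "j \<in> {1..m}" "(i, j) \<notin> E"
  shows "mvar (Inl i) * mvar (Inr j) \<in> graph_ideal n m E"
proof -
  let ?H = "{mvar (Inl i) * mvar (Inl j) | i j. i \<in> {1..n} \<and> j \<in> {1..n} \<and> i < j} \<union>
      {mvar (Inr i) * mvar (Inr j) | i j. i \<in> {1..m} \<and> j \<in> {1..m} \<and> i < j} \<union>
      {mvar (Inl i) * mvar (Inr j) | i j. i \<in> {1..n} \<and> j \<in> {1..m} \<and> (i, j) \<notin> E} :: (vertex, real) mpoly set"
  have "?H \<subseteq> carrier (poly_ring n m)" by (auto intro!: mpolys_over_closed(2) vert_over)
  then have "?H \<subseteq> graph_ideal n m E" unfolding graph_ideal_def by (rule R.genideal_self)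
  then show ?thesis using assms by blast
qed

interpretation I: ideal "graph_ideal n m E" "poly_ring n m" by (rule graph_ideal_ideal)

lemma graph_ideal_mult:
  "x \<in> graph_ideal n m E \<Longrightarrow> a \<in> mpolys_over (bip_verts n m) \<Longrightarrow> a * x \<in> graph_ideal n m E"
  using I.I_l_closed[of x a] by simp

lemma graph_ideal_sum:
  assumes "\<And>x. x \<in> A \<Longrightarrow> f x \<in> graph_ideal n m E"
  shows "(\<Sum>x\<in>A. f x) \<in> graph_ideal n m E"
  using assms
proof (induction A rule: infinite_finite_induct)
  case (insert x A)
  then show ?case using I.a_closed[of "f x" "\<Sum>x\<in>A. f x"] by simp
qed (use I.zero_closed in simp_all)

lemma edge_form_in_graph_ideal:
  assumes "\<And>i j. (i, j) \<in> E \<Longrightarrow> c i j = 0"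
  shows "edge_form n m c \<in> graph_ideal n m E"
  unfolding edge_form_def
proof (intro graph_ideal_sum)
  fix i j assume ij: "i \<in> {1..n}" "j \<in> {1..m}"
  show "mconst (c i j) * (mvar (Inl i) * mvar (Inr j)) \<in> graph_ideal n m E"
  proof (cases "(i, j) \<in> E")
    case True
    then show ?thesis using assms I.zero_closed by simp
  qed (use ij non_edge_in_graph_ideal graph_ideal_mult mconst_over in blast)
qed

lemma edge_form_over: "edge_form n m c \<in> mpolys_over (bip_verts n m)"
  unfolding edge_form_def by (intro sum_over mpolys_over_closed(2) mconst_over vert_over)

lemma residue_class_eq_iff:
  assumes f: "f \<in> mpolys_over (bip_verts n m)" and g: "g \<in> mpolys_over (bip_verts n m)"
  shows "residue_class n m E f = residue_class n m E g \<longleftrightarrow> f - g \<in> graph_ideal n m E"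
proof -
  have "\<ominus>\<^bsub>poly_ring n m\<^esub> g = - g"
    using g mpolys_over_closed(3)[OF g] by (intro R.minus_equality) auto
  then have "f \<ominus>\<^bsub>poly_ring n m\<^esub> g = f - g" by (simp add: a_minus_def)
  then show ?thesis
    using R.quotient_eq_iff_same_a_r_cos[OF graph_ideal_ideal, of f g] f g by (simp add: residue_class_def)
qed

interpretation h: ring_hom_cring "poly_ring n m" "graph_ring n m E" "residue_class n m E"
  using I.rcos_ring_hom_cring[OF poly_ring_cring] by (simp add: graph_ring_def residue_class_def[abs_def])

lemma finsum_residue_class:
  assumes "\<And>x. x \<in> A \<Longrightarrow> g x \<in> mpolys_over (bip_verts n m)"
  shows "finsum (graph_ring n m E) (\<lambda>x. residue_class n m E (g x)) A = residue_class n m E (\<Sum>x\<in>A. g x)"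
proof -
  have "finsum (poly_ring n m) g A = (\<Sum>x\<in>A. g x)" using assms
  proof (induction A rule: infinite_finite_induct)
    case (insert x A)
    then show ?case by (subst R.finsum_insert) auto
  qed (auto simp: R.finsum_infinite)
  then show ?thesis using h.hom_finsum[of g A] assms by (simp add: comp_def)
qed

lemma theta_prod_residue: "theta_prod n m E \<theta> \<theta>' (p, q) = residue_class n m E (edge_form n m (\<lambda>i j. \<theta> p i * \<theta>' q j))"
proof -
  have "theta_A n \<theta> p \<in> mpolys_over (bip_verts n m)" "theta_B m \<theta>' q \<in> mpolys_over (bip_verts n m)"
    unfolding theta_A_def theta_B_def by (intro sum_over mpolys_over_closed(2) mconst_over vert_over; assumption)+
  then show ?thesis
    using h.hom_mult[of "theta_A n \<theta> p" "theta_B m \<theta>' q"] by (simp add: theta_prod_def theta_mult_edge_form)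
qed

text \<open>
  The span takes a coefficient for each residue class, so the coefficients of pairs with
  equal classes are added up.
\<close>

lemma theta_prod_in_span:
  assumes T: "finite T" and c: "\<And>i j. (i, j) \<in> E \<Longrightarrow> \<theta> p i * \<theta>' q j = (\<Sum>f\<in>T. c f * (\<theta> (fst f) i * \<theta>' (snd f) j))"
  shows "theta_prod n m E \<theta> \<theta>' (p, q) \<in> graph_ring_span n m E (theta_prod n m E \<theta> \<theta>' ` T)"
proof -
  let ?\<tau> = "theta_prod n m E \<theta> \<theta>'" and ?rc = "residue_class n m E"
  define P where "P f = edge_form n m (\<lambda>i j. \<theta> (fst f) i * \<theta>' (snd f) j)" for f
  have P: "P f \<in> mpolys_over (bip_verts n m)" for f unfolding P_def by (rule edge_form_over)
  have \<tau>: "?\<tau> f = ?rc (P f)" for f using theta_prod_residue[of \<theta> \<theta>' "fst f" "snd f"] by (simp add: P_def)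
  \<comment> \<open>\<open>g\<close> picks one pair for each residue class, while \<open>d\<close>
    collects the coefficients of all pairs of that class.\<close>
  define g where "g x = (SOME f. f \<in> T \<and> ?\<tau> f = x)" for x
  have g: "g x \<in> T" "?\<tau> (g x) = x" if x: "x \<in> ?\<tau> ` T" for x
  proof -
    have "\<exists>f. f \<in> T \<and> ?\<tau> f = x" using x by blast
    from someI_ex[OF this] show "g x \<in> T" "?\<tau> (g x) = x" unfolding g_def by blast+
  qed
  define d where "d x = (\<Sum>f\<in>{f \<in> T. ?\<tau> f = x}. c f)" for x
  have term_over: "mconst (d x) * P (g x) \<in> mpolys_over (bip_verts n m)" for x
    using mpolys_over_closed(2)[OF mconst_over P] .
  have "finsum (graph_ring n m E) (\<lambda>x. ?rc (mconst (d x)) \<otimes>\<^bsub>graph_ring n m E\<^esub> x) (?\<tau> ` T) =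
      finsum (graph_ring n m E) (\<lambda>x. ?rc (mconst (d x) * P (g x))) (?\<tau> ` T)"
  proof (rule h.S.finsum_cong')
    show "(\<lambda>x. ?rc (mconst (d x) * P (g x))) \<in> ?\<tau> ` T \<rightarrow> carrier (graph_ring n m E)"
      using h.hom_closed term_over by auto
    fix x assume x: "x \<in> ?\<tau> ` T"
    have "?rc (mconst (d x) * P (g x)) = ?rc (mconst (d x)) \<otimes>\<^bsub>graph_ring n m E\<^esub> ?rc (P (g x))"
      using h.hom_mult[of "mconst (d x)" "P (g x)"] by (simp add: mconst_over P)
    then show "?rc (mconst (d x)) \<otimes>\<^bsub>graph_ring n m E\<^esub> x = ?rc (mconst (d x) * P (g x))"
      using g(2)[OF x] \<tau>[of "g x"] by simp
  qed simp
  also have "\<dots> = ?rc (\<Sum>x\<in>?\<tau> ` T. mconst (d x) * P (g x))"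
    by (rule finsum_residue_class[OF term_over])
  also have "(\<Sum>x\<in>?\<tau> ` T. mconst (d x) * P (g x)) = (\<Sum>f\<in>T. mconst (c f) * P (g (?\<tau> f)))"
  proof -
    have "(\<Sum>x\<in>?\<tau> ` T. mconst (d x) * P (g x)) =
        (\<Sum>x\<in>?\<tau> ` T. \<Sum>f\<in>{f \<in> T. ?\<tau> f = x}. mconst (c f) * P (g (?\<tau> f)))"
      by (intro sum.cong refl) (simp add: d_def mconst_sum sum_distrib_right)
    also have "\<dots> = (\<Sum>f\<in>T. mconst (c f) * P (g (?\<tau> f)))"
      using T by (intro sum.group) auto
    finally show ?thesis .
  qed
  also have "?rc \<dots> = ?rc (P (p, q))"
  proof -
    \<comment> \<open>Two corrections lie in the ideal: replacing each pair by the representative of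
      its class, and the coefficients at non-edges, about which \<open>c\<close> says
      nothing.\<close>
    have "P (g (?\<tau> f)) - P f \<in> graph_ideal n m E" if "f \<in> T" for f
      using residue_class_eq_iff[OF P P] g(2)[of "?\<tau> f"] that \<tau> by (metis imageI)
    then have "mconst (c f) * (P (g (?\<tau> f)) - P f) \<in> graph_ideal n m E" if "f \<in> T" for f
      using that graph_ideal_mult mconst_over by blast
    then have 1: "(\<Sum>f\<in>T. mconst (c f) * (P (g (?\<tau> f)) - P f)) \<in> graph_ideal n m E"
      by (intro graph_ideal_sum)
    have "P (p, q) - (\<Sum>f\<in>T. mconst (c f) * P f) \<in> graph_ideal n m E"
      unfolding P_def edge_form_combination using c by (intro edge_form_in_graph_ideal) simp
    then have "mconst (- 1) * (P (p, q) - (\<Sum>f\<in>T. mconst (c f) * P f)) \<in> graph_ideal n m E"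
      using graph_ideal_mult mconst_over by blast
    then have "(\<Sum>f\<in>T. mconst (c f) * (P (g (?\<tau> f)) - P f)) + mconst (- 1) * (P (p, q) - (\<Sum>f\<in>T. mconst (c f) * P f))
        \<in> graph_ideal n m E" using I.a_closed[OF 1] by simp
    moreover have "mconst (- 1 :: real) * (y :: (vertex, real) mpoly) = - y" for y
    proof -
      have "mconst (- 1 :: real) = (- 1 :: (vertex, real) mpoly)" by (simp add: mconst_def single_uminus)
      then show ?thesis by simp
    qed
    ultimately have "(\<Sum>f\<in>T. mconst (c f) * P (g (?\<tau> f))) - P (p, q) \<in> graph_ideal n m E"
      by (simp add: right_diff_distrib sum_subtractf)
    moreover have "(\<Sum>f\<in>T. mconst (c f) * P (g (?\<tau> f))) \<in> mpolys_over (bip_verts n m)"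
      by (intro sum_over mpolys_over_closed(2) mconst_over P)
    ultimately show ?thesis using residue_class_eq_iff P by blast
  qed
  finally have "?\<tau> (p, q) = finsum (graph_ring n m E) (\<lambda>x. ?rc (mconst (d x)) \<otimes>\<^bsub>graph_ring n m E\<^esub> x) (?\<tau> ` T)"
    using \<tau> by simp
  then show ?thesis unfolding graph_ring_span_def using T by blast
qed

end

lemma graph_ring_span_mono: "X \<subseteq> Y \<Longrightarrow> graph_ring_span n m E X \<subseteq> graph_ring_span n m E Y"
  unfolding graph_ring_span_def
  by (rule Collect_mono, intro impI, elim exE conjE, intro exI conjI, assumption+, erule order_trans)

text \<open>A weight orthogonal to all these products satisfies the equilibrium equations, because
  the index on one side runs over its full range and can be cancelled. Stress-freeness then leaves
  only the zero weight, so the products span all functions on \<open>E\<close>.\<close>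

lemma stress_free_at_spanning:
  assumes E: "E \<subseteq> {1..n} \<times> {1..m}" and g: "generic n m \<theta> \<theta>'" and kl: "k \<le> n" "l \<le> m"
    and sf: "stress_free_at k l \<theta> \<theta>' E fst snd"
  obtains c where "\<And>i j. (i, j) \<in> E \<Longrightarrow> t i j =
    (\<Sum>f\<in>{f \<in> {1..n} \<times> {1..m}. fst f \<le> k \<or> snd f \<le> l}. c f * (\<theta> (fst f) i * \<theta>' (snd f) j))"
proof -
  let ?T = "{f \<in> {1..n} \<times> {1..m}. fst f \<le> k \<or> snd f \<le> l}"
  have finE: "finite E" using E finite_subset by blast
  have "\<forall>e\<in>E. w e = 0"
    if w: "\<forall>f\<in>?T. (\<Sum>e\<in>E. w e * (\<theta> (fst f) (fst e) * \<theta>' (snd f) (snd e))) = 0" for w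
  proof -
    have "(\<Sum>e\<in>{e \<in> E. snd e = j}. w e * \<theta> p (fst e)) = 0" if p: "p \<in> {1..k}" for j p
    proof (cases "j \<in> {1..m}")
      case True
      \<comment> \<open>\<open>C\<close> collects the left sides of the equilibrium equations in
        coordinate \<open>p\<close>. Every row of the generic square matrix \<open>\<theta>'\<close>
        annihilates it, so it vanishes.\<close>
      define C where "C j = (\<Sum>e\<in>{e \<in> E. snd e = j}. w e * \<theta> p (fst e))" for j
      have "(\<Sum>j\<in>{1..m}. C j * \<theta>' q j) = 0" if q: "q \<in> {1..m}" for q
      proof -
        have "(\<Sum>j\<in>{1..m}. C j * \<theta>' q j) = (\<Sum>j\<in>{1..m}. \<Sum>e\<in>{e \<in> E. snd e = j}. w e * (\<theta> p (fst e) * \<theta>' q (snd e)))"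
          by (intro sum.cong refl) (simp add: C_def sum_distrib_right mult.assoc)
        also have "\<dots> = (\<Sum>e\<in>E. w e * (\<theta> p (fst e) * \<theta>' q (snd e)))"
          using finE E by (intro sum.group) auto
        also have "\<dots> = 0" using w[rule_format, of "(p, q)"] p q kl by simp
        finally show ?thesis .
      qed
      then have "\<forall>j\<in>{1..m}. C j = 0" using generic_independent(2)[OF g, of "{1..m}" m C] by simp
      then show ?thesis using True by (simp add: C_def)
    next
      case False
      then have "{e \<in> E. snd e = j} = {}" using E by auto
      then show ?thesis by (simp only: sum.empty)
    qed
    moreover have "(\<Sum>e\<in>{e \<in> E. fst e = i}. w e * \<theta>' q (snd e)) = 0" if q: "q \<in> {1..l}" for i q
    proof (cases "i \<in> {1..n}")
      case True
      define C where "C i = (\<Sum>e\<in>{e \<in> E. fst e = i}. w e * \<theta>' q (snd e))" for i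
      have "(\<Sum>i\<in>{1..n}. C i * \<theta> p i) = 0" if p: "p \<in> {1..n}" for p
      proof -
        have "(\<Sum>i\<in>{1..n}. C i * \<theta> p i) = (\<Sum>i\<in>{1..n}. \<Sum>e\<in>{e \<in> E. fst e = i}. w e * (\<theta> p (fst e) * \<theta>' q (snd e)))"
          by (intro sum.cong refl) (simp add: C_def sum_distrib_left mult_ac)
        also have "\<dots> = (\<Sum>e\<in>E. w e * (\<theta> p (fst e) * \<theta>' q (snd e)))"
          using finE E by (intro sum.group) auto
        also have "\<dots> = 0" using w[rule_format, of "(p, q)"] p q kl by simp
        finally show ?thesis .
      qed
      then have "\<forall>i\<in>{1..n}. C i = 0" using generic_independent(1)[OF g, of "{1..n}" n C] by simp
      then show ?thesis using True by (simp add: C_def)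
    next
      case False
      then have "{e \<in> E. fst e = i} = {}" using E by auto
      then show ?thesis by (simp only: sum.empty)
    qed
    ultimately show ?thesis using sf unfolding stress_free_at_def by blast
  qed
  then have "\<exists>c. \<forall>e\<in>E. t (fst e) (snd e) = (\<Sum>f\<in>?T. c f * (\<theta> (fst f) (fst e) * \<theta>' (snd f) (snd e)))"
    by (intro spanning_if_no_orthogonal[OF finE]) simp_all
  then obtain c where c: "\<forall>e\<in>E. t (fst e) (snd e) = (\<Sum>f\<in>?T. c f * (\<theta> (fst f) (fst e) * \<theta>' (snd f) (snd e)))" ..
  show ?thesis by (rule that[of c]) (use c in force)
qed

text \<open>Extends one direction of \<open>lex_less_corner\<close> from the corner to every pair
  beyond \<open>k\<close> and \<open>l\<close>, as the biclique statement requires: one index in the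
  initial segment makes the smaller vertex of the pair come earlier, with ties settled by the other
  index.\<close>

lemma admissible_lex_less:
  assumes r: "admissible n m k l r" and pq: "p \<in> {1..n}" "q \<in> {1..m}" "k < p" "l < q"
    and st: "s \<in> {1..n}" "t \<in> {1..m}" "s \<le> k \<or> t \<le> l"
  shows "lex_less r (s, t) (p, q)"
proof -
  have tr: "trans r" and ir: "irrefl r" and tot: "total_on (bip_verts n m) r"
    using r by (auto simp: admissible_def strict_linear_order_on_def)
  have A: "(Inl i, Inl j) \<in> r" if "i \<in> {1..n}" "j \<in> {1..n}" "i < j" for i j
    using r that unfolding admissible_def by blast
  have B: "(Inr i, Inr j) \<in> r" if "i \<in> {1..m}" "j \<in> {1..m}" "i < j" for i j
    using r that unfolding admissible_def by blast
  have AB: "(Inl i, Inr j) \<in> r \<longleftrightarrow> (Inr j, Inl i) \<notin> r" if "i \<in> {1..n}" "j \<in> {1..m}" for i j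
  proof -
    have "(Inl i, Inr j) \<in> r \<or> (Inr j, Inl i) \<in> r"
      using tot that unfolding total_on_def bip_verts_def by blast
    moreover have "\<not> ((Inl i, Inr j) \<in> r \<and> (Inr j, Inl i) \<in> r)"
      using tr ir by (meson irreflD transD)
    ultimately show ?thesis by blast
  qed
  have seg: "u \<in> bip_verts k l" if "(u, v) \<in> r" "v \<in> bip_verts k l" for u v
    using r that unfolding admissible_def by blast
  have s1: "(Inl i, Inr j) \<in> r" if "i \<in> {1..n}" "j \<in> {1..m}" "i \<le> k" "l < j" for i j
    using AB[of i j] seg[of "Inr j" "Inl i"] that by (auto simp: bip_verts_def)
  have s2: "(Inr j, Inl i) \<in> r" if "i \<in> {1..n}" "j \<in> {1..m}" "k < i" "j \<le> l" for i j
    using AB[of i j] seg[of "Inl i" "Inr j"] that by (auto simp: bip_verts_def)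
  show ?thesis
    using AB[OF st(1,2)] AB[OF pq(1,2)] s1[of s t] s2[of s t] s1[of s q] s2[of p t] A[of s p] B[of t q] pq st
    unfolding lex_less_def sorted_pair_def by (cases "s \<le> k"; cases "t \<le> l") auto
qed

text \<open>No pair with \<open>p > k\<close> and \<open>q > l\<close> survives shifting, and a
  biclique with \<open>k + 1\<close> and \<open>l + 1\<close> vertices contains such a pair by
  pigeonhole. If \<open>k > n\<close> or \<open>l > m\<close> there is no such pair at all, so
  \<open>sf\<close> is asked only within range.\<close>

theorem balanced_shift_stress_free:
  assumes E: "E \<subseteq> {1..n} \<times> {1..m}" and g: "generic n m \<theta> \<theta>'"
    and sf: "k \<le> n \<Longrightarrow> l \<le> m \<Longrightarrow> stress_free_at k l \<theta> \<theta>' E fst snd"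
  shows "stress_free n m E \<theta> \<theta>' k l"
    and "admissible n m k l r \<Longrightarrow> \<not> contains_biclique (k + 1) (l + 1) (balanced_shift n m E \<theta> \<theta>' r)"
proof -
  have main: "(p, q) \<notin> balanced_shift n m E \<theta> \<theta>' r" if r: "admissible n m k l r" and pq: "k < p" "l < q" for p q r
  proof
    assume b: "(p, q) \<in> balanced_shift n m E \<theta> \<theta>' r"
    then have pq': "p \<in> {1..n}" "q \<in> {1..m}" by (auto simp: balanced_shift_def)
    then have kl: "k \<le> n" "l \<le> m" using pq by auto
    let ?T = "{f \<in> {1..n} \<times> {1..m}. fst f \<le> k \<or> snd f \<le> l}"
    let ?L = "{f \<in> {1..n} \<times> {1..m}. lex_less r f (p, q)}"
    obtain c where c: "\<And>i j. (i, j) \<in> E \<Longrightarrow> \<theta> p i * \<theta>' q j = (\<Sum>f\<in>?T. c f * (\<theta> (fst f) i * \<theta>' (snd f) j))"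
      by (rule stress_free_at_spanning[OF E g kl sf[OF kl], of "\<lambda>i j. \<theta> p i * \<theta>' q j"]) (rule that)
    have "theta_prod n m E \<theta> \<theta>' (p, q) \<in> graph_ring_span n m E (theta_prod n m E \<theta> \<theta>' ` ?T)"
      by (rule theta_prod_in_span[OF _ c]) auto
    moreover have "?T \<subseteq> ?L" using admissible_lex_less[OF r pq' pq] by auto
    then have "graph_ring_span n m E (theta_prod n m E \<theta> \<theta>' ` ?T) \<subseteq> graph_ring_span n m E (theta_prod n m E \<theta> \<theta>' ` ?L)"
      by (intro graph_ring_span_mono image_mono)
    ultimately show False using b unfolding balanced_shift_def by blast
  qed
  then show "stress_free n m E \<theta> \<theta>' k l"
    using admissible_exists[of n m k l] unfolding stress_free_def by (metis less_add_one)
  show "\<not> contains_biclique (k + 1) (l + 1) (balanced_shift n m E \<theta> \<theta>' r)" if r: "admissible n m k l r"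
  proof
    assume "contains_biclique (k + 1) (l + 1) (balanced_shift n m E \<theta> \<theta>' r)"
    then obtain P Q where PQ: "finite P" "finite Q" "card P = k + 1" "card Q = l + 1"
      "P \<times> Q \<subseteq> balanced_shift n m E \<theta> \<theta>' r" unfolding contains_biclique_def by blast
    \<comment> \<open>Labels start at 1, so \<open>P\<close> within \<open>{1..k}\<close> would have
      at most \<open>k\<close> elements.\<close>
    have "\<exists>p\<in>P. k < p"
    proof (rule ccontr)
      assume c: "\<not> ?thesis"
      have "Q \<noteq> {}" using PQ(4) by auto
      then have "P \<subseteq> {1..k}" using c PQ(5) by (auto simp: balanced_shift_def not_less)
      then show False using card_mono[of "{1..k}" P] PQ(3) by simp
    qed
    moreover have "\<exists>q\<in>Q. l < q"
    proof (rule ccontr)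
      assume c: "\<not> ?thesis"
      have "P \<noteq> {}" using PQ(3) by auto
      then have "Q \<subseteq> {1..l}" using c PQ(5) by (auto simp: balanced_shift_def not_less)
      then show False using card_mono[of "{1..l}" Q] PQ(4) by simp
    qed
    ultimately show False using main[OF r] PQ(5) by blast
  qed
qed

section \<open>Assembly of the cases\<close>

lemma generic_nonzero:
  assumes g: "generic n m \<theta> \<theta>'"
  shows "i \<in> {1..n} \<Longrightarrow> \<theta> 1 i \<noteq> 0" "j \<in> {1..m} \<Longrightarrow> \<theta>' 1 j \<noteq> 0"
proof -
  show "\<theta> 1 i \<noteq> 0" if "i \<in> {1..n}"
    using generic_independent(1)[OF g, of "{i}" 1 "\<lambda>_. 1"] that by auto
  show "\<theta>' 1 j \<noteq> 0" if "j \<in> {1..m}"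
    using generic_independent(2)[OF g, of "{j}" 1 "\<lambda>_. 1"] that by auto
qed

theorem theorem5p6:
  fixes n m :: nat and E :: "(nat \<times> nat) set"
    and \<theta> \<theta>' :: "nat \<Rightarrow> nat \<Rightarrow> real" and r :: "vertex rel"
  assumes "E \<subseteq> {1..n} \<times> {1..m}"
    and "generic n m \<theta> \<theta>'"
  shows
    "(admissible n m 1 1 r \<and> forest (bip_edges E) \<longrightarrow>
        \<not> contains_biclique 2 2 (balanced_shift n m E \<theta> \<theta>' r) \<and>
        stress_free n m E \<theta> \<theta>' 1 1) \<and>
     (admissible n m 2 1 r \<and> outerplanar (bip_verts n m) (bip_edges E) \<longrightarrow>
        \<not> contains_biclique 3 2 (balanced_shift n m E \<theta> \<theta>' r) \<and>
        stress_free n m E \<theta> \<theta>' 2 1) \<and>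
     (admissible n m 1 2 r \<and> outerplanar (bip_verts n m) (bip_edges E) \<longrightarrow>
        stress_free n m E \<theta> \<theta>' 1 2) \<and>
     (admissible n m 2 2 r \<and> planar (bip_verts n m) (bip_edges E) \<longrightarrow>
        \<not> contains_biclique 3 3 (balanced_shift n m E \<theta> \<theta>' r) \<and>
        stress_free n m E \<theta> \<theta>' 2 2)"
proof (intro conjI impI; elim conjE)
  note E = assms(1) and g = assms(2)
  have finE: "finite E" using E finite_subset by blast
  have AB: "fst ` E \<subseteq> {1..n}" "snd ` E \<subseteq> {1..m}" using E by auto
  note nz = generic_nonzero[OF g]
  have inj: "inj_on (\<lambda>e. (fst e, snd e)) E" "inj_on (\<lambda>e. (snd e, fst e)) E" by (auto simp: inj_on_def)
  {
    assume fo: "forest (bip_edges E)"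
    have "stress_free_at 1 1 \<theta> \<theta>' E fst snd"
      using forest_no_even_set[OF finE fo] nz AB by (intro stress_free_at_acyclic[OF finE]) auto
    note B = balanced_shift_stress_free[OF E g this]
    show "stress_free n m E \<theta> \<theta>' 1 1" by (rule B(1))
    assume "admissible n m 1 1 r"
    from B(2)[OF this] show "\<not> contains_biclique 2 2 (balanced_shift n m E \<theta> \<theta>' r)"
      by (simp add: numeral_2_eq_2)
  }
  {
    assume op: "outerplanar (bip_verts n m) (bip_edges E)"
    then obtain pos \<gamma> where dr: "plane_drawing (bip_verts n m) (bip_edges E) pos \<gamma>"
      and fr: "pos ` bip_verts n m \<subseteq> frontier (outside (drawing_image (bip_verts n m) (bip_edges E) pos \<gamma>))"
      unfolding outerplanar_def by blast
    obtain \<Phi> :: "complex set set" and l s where d: "dual_faces E fst snd \<Phi> l s"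
      and "pos ` bip_verts n m \<subseteq> frontier (outside (drawing_image (bip_verts n m) (bip_edges E) pos \<gamma>)) \<longrightarrow>
        (\<exists>z\<in>\<Phi>. outer_vertices E fst \<Phi> l s z \<and> outer_vertices E snd \<Phi> l s z)"
      by (rule bip_drawing_dual[OF E dr]) (rule that)
    then obtain z where o: "z \<in> \<Phi>" "outer_vertices E fst \<Phi> l s z" "outer_vertices E snd \<Phi> l s z"
      using fr by blast
    have sf: "stress_free_at 2 1 \<theta> \<theta>' E fst snd" if nm: "2 \<le> n" "1 \<le> m"
    proof (rule stress_free_at_outerplanar[where X = \<theta> and Y = \<theta>', OF d inj(1) AB o _ _ nz])
      show "stress_free_at 2 1 \<theta> \<theta>' F a b" if "finite F" "a ` F \<subseteq> {1..n}" "b ` F \<subseteq> {1..m}"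
        "stress_free_at 2 1 X Y F a b" for F :: "(nat \<times> nat) set" and a b X Y
        using generic_stress_free_at[OF g nm] that by blast
      show "\<forall>i\<in>N. c i = 0" if "finite N" "N \<subseteq> {1..n}" "card N \<le> 2" "\<forall>p\<in>{1..2}. (\<Sum>i\<in>N. c i * \<theta> p i) = 0" for N c
        using generic_independent(1)[OF g that(1,3) nm(1) that(2,4)] .
    qed
    show "stress_free n m E \<theta> \<theta>' 2 1" by (rule balanced_shift_stress_free(1)[OF E g sf])
    have d': "dual_faces E snd fst \<Phi> l s" using d dual_faces_swap by blast
    have "stress_free_at 1 2 \<theta> \<theta>' E fst snd" if nm: "1 \<le> n" "2 \<le> m"
    proof -
      \<comment> \<open>Exchanging the sides, together with their placements and outer conditions,
        reduces the case (1,2) to (2,1).\<close>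
      have "stress_free_at 2 1 \<theta>' \<theta> E snd fst"
      proof (rule stress_free_at_outerplanar[where X = \<theta>' and Y = \<theta>, OF d' inj(2) AB(2,1) o(1,3,2) _ _ nz(2,1)])
        show "stress_free_at 2 1 \<theta>' \<theta> F b a" if "finite F" "b ` F \<subseteq> {1..m}" "a ` F \<subseteq> {1..n}"
          "stress_free_at 2 1 Y X F b a" for F :: "(nat \<times> nat) set" and a b X Y
          using generic_stress_free_at[OF g nm that(1,3,2), of X Y] that(4) stress_free_at_swap by blast
        show "\<forall>i\<in>N. c i = 0" if "finite N" "N \<subseteq> {1..m}" "card N \<le> 2" "\<forall>p\<in>{1..2}. (\<Sum>i\<in>N. c i * \<theta>' p i) = 0" for N c
          using generic_independent(2)[OF g that(1,3) nm(2) that(2,4)] .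
      qed
      then show ?thesis using stress_free_at_swap by blast
    qed
    from balanced_shift_stress_free(1)[OF E g this] show "stress_free n m E \<theta> \<theta>' 1 2" .
    assume r: "admissible n m 2 1 r"
    have "\<not> contains_biclique (2 + 1) (1 + 1) (balanced_shift n m E \<theta> \<theta>' r)"
      by (rule balanced_shift_stress_free(2)[OF E g sf r])
    then show "\<not> contains_biclique 3 2 (balanced_shift n m E \<theta> \<theta>' r)"
      by (simp add: numeral_2_eq_2 numeral_3_eq_3)
  }
  {
    assume "planar (bip_verts n m) (bip_edges E)"
    then obtain pos \<gamma> where dr: "plane_drawing (bip_verts n m) (bip_edges E) pos \<gamma>"
      unfolding planar_def by blast
    obtain \<Phi> :: "complex set set" and l s where d: "dual_faces E fst snd \<Phi> l s"
      by (rule bip_drawing_dual[OF E dr]) (rule that)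
    have sf: "stress_free_at 2 2 \<theta> \<theta>' E fst snd" if nm: "2 \<le> n" "2 \<le> m"
    proof (rule stress_free_at_planar[where X = \<theta> and Y = \<theta>', OF d inj(1) AB _ _ _ nz])
      show "stress_free_at 2 2 \<theta> \<theta>' F a b" if "finite F" "a ` F \<subseteq> {1..n}" "b ` F \<subseteq> {1..m}"
        "stress_free_at 2 2 X Y F a b" for F :: "(nat \<times> nat) set" and a b X Y
        using generic_stress_free_at[OF g nm] that by blast
      show "\<forall>i\<in>N. c i = 0" if "finite N" "N \<subseteq> {1..n}" "card N \<le> 2" "\<forall>p\<in>{1..2}. (\<Sum>i\<in>N. c i * \<theta> p i) = 0" for N c
        using generic_independent(1)[OF g that(1,3) nm(1) that(2,4)] .
      show "\<forall>i\<in>N. c i = 0" if "finite N" "N \<subseteq> {1..m}" "card N \<le> 2" "\<forall>p\<in>{1..2}. (\<Sum>i\<in>N. c i * \<theta>' p i) = 0" for N c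
        using generic_independent(2)[OF g that(1,3) nm(2) that(2,4)] .
    qed
    show "stress_free n m E \<theta> \<theta>' 2 2" by (rule balanced_shift_stress_free(1)[OF E g sf])
    assume r: "admissible n m 2 2 r"
    have "\<not> contains_biclique (2 + 1) (2 + 1) (balanced_shift n m E \<theta> \<theta>' r)"
      by (rule balanced_shift_stress_free(2)[OF E g sf r])
    then show "\<not> contains_biclique 3 3 (balanced_shift n m E \<theta> \<theta>' r)"
      by (simp add: numeral_3_eq_3 numeral_2_eq_2)
  }
qed

end
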